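(* Let $\Omega\subset\mathbb R^2$ be a compact convex set, $X:=\Omega\cap\mathbb Z^2$, and assume that the convex hull $\mathrm{Hull}(X)$ has non-empty interior. Let $\mathcal V$ be a family of stencils on $X$. If $\mathrm{Conv}(\mathcal V)$ has non-empty interior (in the vector space of functions $X\to\mathbb R$), then $$\mathrm{Conv}(\mathcal V)=\bigcup_{\mathcal T\prec\mathcal V}\mathrm{Conv}(\mathcal T),$$ where the union is over all triangulations $\mathcal T$ of $X$ such that $\mathcal T\prec\mathcal V$.
   Context: $\|\cdot\|$ is the Euclidean norm. A vector $e=(\alpha,\beta)\in\mathbb Z^2$ is irreducible iff $\gcd(\alpha,\beta)=1$. A basis of $\mathbb Z^2$ is a pair $(f,g)\in(\mathbb Z^2)^2$ with $|\det(f,g)|=1$; direct iff $\det(f,g)=1$, acute iff $\langle f,g\rangle\ge0$. For each irreducible $e$ with $\|e\|>1$ there is a unique direct acute basis $(f,g)$ with $e=f+g$; $f,g$ are called the parents of $e$. Unit vectors have no parents. Linear forms: $S_x^e(u):=u(x+e)-2u(x)+u(x-e)$ for $e$ irreducible; for $e$ irreducible with $\|e\|>1$, of parents $f,g$, $T_x^e(u):=u(x+e)+u(x-f)+u(x-g)-3u(x)$ and $P_x^e(u):=u(x+e)-u(x+f)-u(x+g)+u(x)$. The support of a form is the set of points at which $u$ is evaluated. $\mathcal V_{\max}(x):=\{e\in\mathbb Z^2\text{ irreducible}: x+e\in X\}$. $\mathrm{Cone}(A)$ is the convex cone generated by $A$, with $\mathrm{Cone}(\emptyset)=\{0\}$.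 A family of stencils on $X$ is a collection $\mathcal V=(\mathcal V(x))_{x\in X}$, $\mathcal V(x)\subseteq\mathcal V_{\max}(x)$, such that for all $x\in X$: (Stability) any parent $f\in\mathcal V_{\max}(x)$ of any $e\in\mathcal V(x)$ satisfies $f\in\mathcal V(x)$; (Visibility) $\mathrm{Cone}(\mathcal V(x))=\mathrm{Cone}(\mathcal V_{\max}(x))$. The candidates for refinement $\hat{\mathcal V}(x)$ are all $e\in\mathcal V_{\max}(x)\setminus\mathcal V(x)$ having two parents, both in $\mathcal V(x)$. $\mathrm{Conv}(\mathcal V)$ is the set of $u:X\to\mathbb R$ such that for all $x\in X$: $S_x^e(u)\ge0$ for all $e\in\mathcal V(x)$ with $S_x^e$ supported in $X$; $T_x^e(u)\ge0$ for all $e\in\mathcal V(x)$, $\|e\|>1$, with $T_x^e$ supported in $X$; $P_x^e(u)\ge0$ for all $e\in\hat{\mathcal V}(x)$. A triangulation $\mathcal T$ of $X$ is a (conforming) triangulation covering $\mathrm{Hull}(X)$ whose set of vertices is exactly $X$. $\mathrm{Conv}(\mathcal T)$ is the set of $u:X\to\mathbb R$ whose piecewise linear interpolation $\mathrm I_{\mathcal T}u:\mathrm{Hull}(X)\to\mathbb R$ on $\mathcal T$ is convex. $\mathcal T\prec\mathcal V$ means: for every edge $[x,x+e]$ of $\mathcal T$ (with either endpoint taken as $x$), one has $e\in\mathcal V(x)$. *)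

theory Defs
  imports "HOL-Analysis.Analysis"
begin

type_synonym ivec = "int \<times> int"

definition emb :: "ivec \<Rightarrow> real \<times> real" where
  "emb e = (of_int (fst e), of_int (snd e))"

definition lattice_pts :: "(real \<times> real) set \<Rightarrow> ivec set" where
  "lattice_pts \<Omega> = {x. emb x \<in> \<Omega>}"

definition hull_of :: "ivec set \<Rightarrow> (real \<times> real) set" where
  "hull_of X = convex hull (emb ` X)"

definition irred :: "ivec \<Rightarrow> bool" where
  "irred e \<longleftrightarrow> coprime (fst e) (snd e)"

definition det2 :: "ivec \<Rightarrow> ivec \<Rightarrow> int" where
  "det2 f g = fst f * snd g - snd f * fst g"

definition direct_basis :: "ivec \<Rightarrow> ivec \<Rightarrow> bool" where
  "direct_basis f g \<longleftrightarrow> det2 f g = 1"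

definition acute_basis :: "ivec \<Rightarrow> ivec \<Rightarrow> bool" where
  "acute_basis f g \<longleftrightarrow> \<bar>det2 f g\<bar> = 1 \<and> emb f \<bullet> emb g \<ge> 0"

(* For given e there is exactly one such ordered pair (f, g) if e is irreducible with norm > 1,
   so quantifying over all f, g with "parents e f g" amounts to naming the parents of e. *)
definition parents :: "ivec \<Rightarrow> ivec \<Rightarrow> ivec \<Rightarrow> bool" where
  "parents e f g \<longleftrightarrow> irred e \<and> norm (emb e) > 1 \<and>
     direct_basis f g \<and> acute_basis f g \<and> e = f + g"

definition S_form :: "(ivec \<Rightarrow> real) \<Rightarrow> ivec \<Rightarrow> ivec \<Rightarrow> real" where
  "S_form u x e = u (x + e) - 2 * u x + u (x - e)"

(* f and g stand for the parents of e in the next two forms. *)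
definition T_form :: "(ivec \<Rightarrow> real) \<Rightarrow> ivec \<Rightarrow> ivec \<Rightarrow> ivec \<Rightarrow> ivec \<Rightarrow> real" where
  "T_form u x e f g = u (x + e) + u (x - f) + u (x - g) - 3 * u x"

definition P_form :: "(ivec \<Rightarrow> real) \<Rightarrow> ivec \<Rightarrow> ivec \<Rightarrow> ivec \<Rightarrow> ivec \<Rightarrow> real" where
  "P_form u x e f g = u (x + e) - u (x + f) - u (x + g) + u x"

definition Vmax :: "ivec set \<Rightarrow> ivec \<Rightarrow> ivec set" where
  "Vmax X x = {e. irred e \<and> x + e \<in> X}"

(* Only the values V x with x in X are meaningful. *)
definition stencils :: "ivec set \<Rightarrow> (ivec \<Rightarrow> ivec set) \<Rightarrow> bool" where
  "stencils X V \<longleftrightarrow> (\<forall>x\<in>X.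
     V x \<subseteq> Vmax X x \<and>
     (\<forall>e\<in>V x. \<forall>f g. parents e f g \<longrightarrow>
        (f \<in> Vmax X x \<longrightarrow> f \<in> V x) \<and> (g \<in> Vmax X x \<longrightarrow> g \<in> V x)) \<and>
     convex_cone hull (emb ` V x) = convex_cone hull (emb ` Vmax X x))"

definition candidates :: "ivec set \<Rightarrow> (ivec \<Rightarrow> ivec set) \<Rightarrow> ivec \<Rightarrow> ivec set" where
  "candidates X V x =
     {e \<in> Vmax X x - V x. \<exists>f g. parents e f g \<and> f \<in> V x \<and> g \<in> V x}"

(* Functions X \<rightarrow> \<real> are represented by the extensional functions on X,
   i.e. the points of powertop_real X. *)
definition Conv_stencils :: "ivec set \<Rightarrow> (ivec \<Rightarrow> ivec set) \<Rightarrow> (ivec \<Rightarrow> real) set" where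
  "Conv_stencils X V = {u \<in> X \<rightarrow>\<^sub>E UNIV. \<forall>x\<in>X.
     (\<forall>e\<in>V x. {x + e, x, x - e} \<subseteq> X \<longrightarrow> S_form u x e \<ge> 0) \<and>
     (\<forall>e\<in>V x. \<forall>f g. parents e f g \<and> {x + e, x - f, x - g, x} \<subseteq> X \<longrightarrow> T_form u x e f g \<ge> 0) \<and>
     (\<forall>e\<in>candidates X V x. \<forall>f g. parents e f g \<longrightarrow> P_form u x e f g \<ge> 0)}"

(* A triangulation is given by its set of (closed, nondegenerate) triangles. *)
definition triangulation_of :: "ivec set \<Rightarrow> (real \<times> real) set set \<Rightarrow> bool" where
  "triangulation_of X \<T> \<longleftrightarrow>
     triangulation \<T> \<and> (\<forall>T\<in>\<T>. 2 simplex T) \<and> \<Union>\<T> = hull_of X \<and>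
     {v. \<exists>T\<in>\<T>. v extreme_point_of T} = emb ` X"

(* F is, on hull_of X, the piecewise linear interpolation of u on \<T>; it is determined there
   (see pl_interpolation_unique), and its values outside hull_of X are irrelevant. *)
definition pl_interpolation ::
    "ivec set \<Rightarrow> (real \<times> real) set set \<Rightarrow> (ivec \<Rightarrow> real) \<Rightarrow> (real \<times> real \<Rightarrow> real) \<Rightarrow> bool" where
  "pl_interpolation X \<T> u F \<longleftrightarrow>
     (\<forall>T\<in>\<T>. \<exists>a b. \<forall>p\<in>T. F p = a \<bullet> p + b) \<and> (\<forall>x\<in>X. F (emb x) = u x)"

definition Conv_triangulation ::
    "ivec set \<Rightarrow> (real \<times> real) set set \<Rightarrow> (ivec \<Rightarrow> real) set" where
  "Conv_triangulation X \<T> =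
     {u \<in> X \<rightarrow>\<^sub>E UNIV. \<exists>F. pl_interpolation X \<T> u F \<and> convex_on (hull_of X) F}"

definition subordinate ::
    "ivec set \<Rightarrow> (real \<times> real) set set \<Rightarrow> (ivec \<Rightarrow> ivec set) \<Rightarrow> bool" where
  "subordinate X \<T> V \<longleftrightarrow> (\<forall>x\<in>X. \<forall>e.
     (\<exists>T\<in>\<T>. closed_segment (emb x) (emb (x + e)) edge_of T) \<longrightarrow> e \<in> V x)"

lemma pl_interpolation_unique:
  assumes tri: "triangulation_of X \<T>"
    and F: "pl_interpolation X \<T> u F" and G: "pl_interpolation X \<T> u G"
    and p: "p \<in> hull_of X"
  shows "F p = G p"
proof -
  obtain T where T: "T \<in> \<T>" "p \<in> T"
    using tri p unfolding triangulation_of_def by blast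
  obtain a b c d where ab: "\<And>q. q \<in> T \<Longrightarrow> F q = a \<bullet> q + b"
    and cd: "\<And>q. q \<in> T \<Longrightarrow> G q = c \<bullet> q + d"
    using F G T(1) unfolding pl_interpolation_def by meson
  have "2 simplex T"
    using tri T(1) unfolding triangulation_of_def by blast
  then have "compact T" "convex T"
    by (auto simp: simplex intro: finite_imp_compact_convex_hull)
  then have hull: "T = convex hull {v. v extreme_point_of T}"
    by (rule Krein_Milman_Minkowski)
  have "{v. v extreme_point_of T} \<subseteq> {q. (a - c) \<bullet> q = d - b}"
  proof
    fix v assume "v \<in> {v. v extreme_point_of T}"
    then have v: "v extreme_point_of T" by simp
    then have "v \<in> T" by (simp add: extreme_point_of_def)
    moreover obtain x where "x \<in> X" "v = emb x"
      using tri T(1) v unfolding triangulation_of_def by blast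
    ultimately have "a \<bullet> v + b = c \<bullet> v + d"
      using F G ab cd unfolding pl_interpolation_def by metis
    then show "v \<in> {q. (a - c) \<bullet> q = d - b}" by (simp add: inner_diff_left)
  qed
  then have "T \<subseteq> {q. (a - c) \<bullet> q = d - b}"
    by (subst hull, intro hull_minimal) (auto simp: convex_hyperplane)
  then show ?thesis
    using T(2) ab[OF T(2)] cd[OF T(2)] by (auto simp: inner_diff_left)
qed

end

theory Submission
  imports Defs
begin

text \<open>If u satisfies all inequalities strictly, then, by induction on the length of e, the form P at x is
  positive for every visible e outside of the stencil of x, and the forms S and T are positive
  for every e: if f, g are the parents of e, and f - g, g those of f, then
  P(f, g) = P(f - g, g) + S(g), the last term being taken at the point x + f; while
  S(e) = P(e) + P(-e) + S(f) + S(g) and T(e) = P(e) + S(f) + S(g). Positivity of S and T yields a maximum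
  principle, so that triangles supporting the graph of u from below contain no lattice points except
  their vertices, and positivity of P forces their edges to belong to the stencils. For u generic these
  triangles form a triangulation. An arbitrary u in the cone is a limit of strict and generic functions
  sharing one triangulation.

  Conversely, if u is convex on a triangulation subordinate to the stencils and e = f + g is a candidate at x,
  then x + e lies in the cone of a unimodular triangle with vertex x, which also contains the directions f
  and g by stability, and convexity of u on the hull of this triangle and x + e gives P(e) \<ge> 0.\<close>

section \<open>Bases of the integer lattice\<close>

text \<open>The inequalities at x concern only the stencil and its immediate candidates, whereas
  convexity involves all lattice directions. The link is the structure of the Stern-Brocot tree:
  Visibility and Stability force every gap of \<open>V x\<close> that contains a visible direction
  to be an acute direct basis (a, b). In coordinates on (a, b), the parents of a missing direction
  form a nonnegative integer matrix of determinant 1, and subtracting rows as in Euclid's algorithm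
  reduces it to the identity, that is, to the candidate a + b.

  The hypothesis on the interior supplies one strict and generic function w. At an interior point of
  the cone a small multiple of a positive definite quadratic form is added: this raises S and T,
  while P, which it may lower, stays nonnegative because the sum is still in the cone, and nonzero
  because finitely many bad parameters are avoided. For any u in the cone, u + t w is then strict
  and generic for all small t > 0; since only finitely many sets of lattice triangles exist, one
  triangulation serves for a sequence of t tending to 0.\<close>

definition sm :: "int \<Rightarrow> ivec \<Rightarrow> ivec" where
  "sm k v = (k * fst v, k * snd v)"

definition dot2 :: "ivec \<Rightarrow> ivec \<Rightarrow> int" where
  "dot2 a b = fst a * fst b + snd a * snd b"

lemma det2_simps [simp]:
  "det2 (a + b) c = det2 a c + det2 b c" "det2 c (a + b) = det2 c a + det2 c b"
  "det2 (a - b) c = det2 a c - det2 b c" "det2 c (a - b) = det2 c a - det2 c b"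
  "det2 (- a) c = - det2 a c" "det2 c (- a) = - det2 c a"
  "det2 (sm k a) c = k * det2 a c" "det2 c (sm k a) = k * det2 c a"
  "det2 a a = 0"
  by (auto simp: det2_def sm_def algebra_simps)

lemma det2_swap: "det2 a b = - det2 b a"
  by (simp add: det2_def)

lemma dot2_simps [simp]:
  "dot2 (a + b) c = dot2 a c + dot2 b c" "dot2 c (a + b) = dot2 c a + dot2 c b"
  "dot2 (a - b) c = dot2 a c - dot2 b c" "dot2 c (a - b) = dot2 c a - dot2 c b"
  "dot2 (- a) c = - dot2 a c" "dot2 c (- a) = - dot2 c a"
  "dot2 (sm k a) c = k * dot2 a c" "dot2 c (sm k a) = k * dot2 c a"
  by (auto simp: dot2_def sm_def algebra_simps)

lemma dot2_commute: "dot2 a b = dot2 b a"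
  by (simp add: dot2_def)

lemma sm_simps [simp]: "sm 1 a = a" "sm 0 a = 0" "sm k 0 = 0" "sm (-1) a = - a"
  unfolding sm_def zero_prod_def uminus_prod_def by simp_all

lemma sm_algebra:
  "sm (k + l) a = sm k a + sm l a" "sm (k - l) a = sm k a - sm l a"
  "sm k (a + b) = sm k a + sm k b" "sm k (a - b) = sm k a - sm k b"
  "sm k (sm l a) = sm (k * l) a" "sm (- k) a = - sm k a" "sm k (- a) = - sm k a"
  by (auto simp: sm_def prod_eq_iff algebra_simps)

lemma sm_cancel: "k \<noteq> 0 \<Longrightarrow> sm k a = sm k b \<longleftrightarrow> a = b"
  by (auto simp: sm_def prod_eq_iff)

lemma det2_cramer: "sm (det2 a b) c = sm (det2 c b) a + sm (det2 a c) b"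
  by (auto simp: det2_def sm_def prod_eq_iff algebra_simps)

lemma det2_pluecker: "det2 a b * det2 c d = det2 c b * det2 a d + det2 a c * det2 b d"
  by (simp add: det2_def algebra_simps)

lemma basis_coords:
  assumes "det2 a b = 1"
  shows "c = sm (det2 c b) a + sm (det2 a c) b"
  using det2_cramer[of a b c] assms by simp

lemma dot2_self_ge_0: "dot2 a a \<ge> 0"
  by (simp add: dot2_def)

lemma dot2_self_pos: "dot2 a a > 0 \<longleftrightarrow> a \<noteq> 0"
  using sum_squares_gt_zero_iff[of "fst a" "snd a"]
  by (auto simp: dot2_def prod_eq_iff)

lemma dot2_det2: "dot2 a a * dot2 b b = (dot2 a b)\<^sup>2 + (det2 a b)\<^sup>2"
  by (simp add: dot2_def det2_def power2_eq_square algebra_simps)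

text \<open>Divided by \<open>det2 e a * det2 e b\<close>, this compares the cotangents of the
  angles from e to a and to b through the orientation of (a, b).\<close>

lemma dot2_self_det2: "dot2 e e * det2 a b = dot2 e a * det2 e b - dot2 e b * det2 e a"
  by (simp add: dot2_def det2_def algebra_simps)

lemma emb_simps [simp]:
  "emb (a + b) = emb a + emb b" "emb (a - b) = emb a - emb b" "emb (- a) = - emb a"
  "emb 0 = 0" "emb (sm k a) = of_int k *\<^sub>R emb a"
  by (auto simp: emb_def sm_def prod_eq_iff)

lemma emb_eq_iff [simp]: "emb a = emb b \<longleftrightarrow> a = b"
  by (auto simp: emb_def prod_eq_iff)

lemma inj_emb: "inj emb"
  by (simp add: inj_def)

lemma inner_emb: "emb a \<bullet> emb b = of_int (dot2 a b)"
  by (simp add: emb_def dot2_def inner_prod_def)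

lemma norm_emb_gt_1: "norm (emb e) > 1 \<longleftrightarrow> dot2 e e > 1"
proof -
  have "norm (emb e) > 1 \<longleftrightarrow> emb e \<bullet> emb e > 1"
    by (simp add: norm_eq_sqrt_inner)
  also have "\<dots> \<longleftrightarrow> dot2 e e > 1"
    by (simp only: inner_emb of_int_1_less_iff)
  finally show ?thesis .
qed

lemma irred_det2_1: "det2 a b = 1 \<Longrightarrow> irred a \<and> irred b"
proof -
  assume "det2 a b = 1"
  then have *: "fst a * snd b - snd a * fst b = 1" by (simp add: det2_def)
  have "is_unit d" if "d dvd fst a" "d dvd snd a" for d
    using that * by (metis dvd_diff dvd_mult2)
  moreover have "is_unit d" if "d dvd fst b" "d dvd snd b" for d
    using that * by (metis dvd_diff dvd_mult)
  ultimately show "irred a \<and> irred b"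
    unfolding irred_def by (auto intro: coprimeI)
qed

lemma irred_uminus [simp]: "irred (- e) \<longleftrightarrow> irred e"
  by (simp add: irred_def)

lemma irred_nz: "irred e \<Longrightarrow> e \<noteq> 0"
  by (auto simp: irred_def)

lemma dot2_self_ge_1: "irred e \<Longrightarrow> dot2 e e \<ge> 1"
  using dot2_self_pos[of e] irred_nz[of e] by auto

text \<open>Bezout provides an integral linear form with value 1 at e; its value at v is the
  multiple.\<close>

lemma irred_parallel:
  assumes "irred e" "det2 e v = 0"
  obtains k where "v = sm k e"
proof -
  obtain x y where xy: "x * fst e + y * snd e = 1"
    using bezout_int[of "fst e" "snd e"] assms(1) by (auto simp: irred_def)
  have d: "fst e * snd v = snd e * fst v" using assms(2) by (simp add: det2_def)
  have "v = sm (x * fst v + y * snd v) e"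
    unfolding sm_def prod_eq_iff fst_conv snd_conv using xy d by (intro conjI; algebra)
  then show ?thesis using that by blast
qed

lemma irred_parallel_irred:
  assumes "irred e" "irred v" "det2 e v = 0"
  shows "v = e \<or> v = - e"
proof -
  obtain k where k: "v = sm k e" using irred_parallel[OF assms(1,3)] by blast
  have "k dvd fst v" "k dvd snd v" by (auto simp: k sm_def)
  then have "is_unit k" using assms(2) unfolding irred_def by (metis coprime_common_divisor)
  then have "k = 1 \<or> k = -1" by auto
  then show ?thesis using k by auto
qed

lemma primitive_vector:
  assumes "v \<noteq> (0 :: ivec)"
  obtains e k where "irred e" "k \<ge> 1" "v = sm k e"
proof -
  define k where "k = gcd (fst v) (snd v)"
  have k0: "k > 0" using assms by (auto simp: k_def prod_eq_iff)
  obtain a b where ab: "fst v = a * k" "snd v = b * k" "coprime a b"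
    using gcd_coprime_exists[of "fst v" "snd v"] k0 unfolding k_def by auto
  show ?thesis
    by (rule that[of "(a, b)" k]) (use ab k0 in \<open>auto simp: irred_def sm_def prod_eq_iff\<close>)
qed

lemma irred_det2_exists:
  assumes "irred e"
  obtains f where "det2 e f = 1"
proof -
  obtain x y where xy: "x * fst e + y * snd e = 1"
    using bezout_int[of "fst e" "snd e"] assms(1) by (auto simp: irred_def)
  show ?thesis
    by (rule that[of "(-y, x)"]) (use xy in \<open>simp add: det2_def algebra_simps\<close>)
qed

text \<open>A determinant 1 makes f, g and f + g primitive, and with an acute angle the squared norm
  of f + g is at least 2. The arithmetic below uses \<open>parents\<close> in this form.\<close>

lemma parents_iff:
  "parents e f g \<longleftrightarrow> det2 f g = 1 \<and> dot2 f g \<ge> 0 \<and> e = f + g"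
proof
  assume "parents e f g"
  then show "det2 f g = 1 \<and> dot2 f g \<ge> 0 \<and> e = f + g"
    by (auto simp: parents_def direct_basis_def acute_basis_def inner_emb)
next
  assume *: "det2 f g = 1 \<and> dot2 f g \<ge> 0 \<and> e = f + g"
  then have "irred f" "irred g" using irred_det2_1 by blast+
  then have "dot2 f f \<ge> 1" "dot2 g g \<ge> 1" using dot2_self_ge_1 by blast+
  then have "dot2 e e > 1" using * by (simp add: dot2_commute[of g f])
  moreover have "irred e" using irred_det2_1[of e g] * by simp
  ultimately show "parents e f g" using *
    by (auto simp: parents_def direct_basis_def acute_basis_def inner_emb norm_emb_gt_1
        simp del: emb_simps)
qed

text \<open>Solutions of \<open>det2 f e = 1\<close> differ by multiples of e. The parent is the one
  whose product m with e is a residue modulo n, the squared norm of e; the angle between f and e - f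
  is acute iff \<open>dot2 f f \<le> m\<close>.\<close>

lemma parents_exist:
  assumes e: "irred e" "dot2 e e > 1"
  obtains f g where "parents e f g"
proof -
  define n where "n = dot2 e e"
  obtain f0 where f0: "det2 e f0 = 1" using irred_det2_exists[OF e(1)] by blast
  define f where "f = - f0 - sm (dot2 (- f0) e div n) e"
  define m where "m = dot2 f e"
  have m: "m = dot2 (- f0) e mod n"
    unfolding m_def f_def dot2_simps(3,7) n_def[symmetric]
    by (simp add: minus_mult_div_eq_mod mult.commute)
  have det: "det2 f e = 1" using f0 det2_swap[of e f0] by (simp add: f_def)
  have "0 \<le> m" "m < n" using e by (auto simp: m n_def)
  have L: "n * dot2 f f = m\<^sup>2 + 1"
    using dot2_det2[of f e] det unfolding m_def n_def by (simp add: mult.commute)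
  have "m \<noteq> 0"
  proof
    assume "m = 0"
    then have "n * dot2 f f = 1" using L by simp
    then show False using e(2) unfolding n_def by (simp add: zmult_eq_1_iff)
  qed
  \<comment> \<open>By L,
    \<open>n * (m - dot2 f f) = (m - 1) * (n - m - 1) + (n - 2)\<close>.\<close>
  then have "0 \<le> (m - 1) * (n - m - 1)" using \<open>0 \<le> m\<close> \<open>m < n\<close> by (intro mult_nonneg_nonneg) auto
  then have "n * (m - dot2 f f) \<ge> n - 2"
    using L by (simp add: algebra_simps power2_eq_square)
  moreover have "n \<ge> 2" using e(2) by (simp add: n_def)
  ultimately have "n * (m - dot2 f f) \<ge> 0" by linarith
  then have "m - dot2 f f \<ge> 0" using \<open>n \<ge> 2\<close> by (simp add: zero_le_mult_iff)
  then have "parents e f (e - f)"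
    using det by (simp add: parents_iff m_def)
  then show ?thesis using that by blast
qed

lemma parents_uminus: "parents (- e) (- f) (- g) \<longleftrightarrow> parents e f g"
proof -
  have "- e = - f + - g \<longleftrightarrow> e = f + g"
    by (metis minus_add_distrib neg_equal_iff_equal)
  then show ?thesis by (simp add: parents_iff)
qed

text \<open>A superbase of the lattice contains a pair at an acute angle, whence the third vector is
  opposite to an element having these two as parents: if all three products were at most -1,
  then their pairwise products could not sum up to the square of the determinant, which is 1.\<close>

lemma superbase_acute:
  assumes "a + b + c = 0" "det2 a b = 1"
  shows "dot2 a b \<ge> 0 \<or> dot2 b c \<ge> 0 \<or> dot2 c a \<ge> 0"
proof (rule ccontr)
  assume "\<not> ?thesis"
  then have n: "dot2 a b \<le> -1" "dot2 b c \<le> -1" "dot2 c a \<le> -1" by auto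
  have c: "c = - a - b" using assms(1) by (simp add: eq_neg_iff_add_eq_0 algebra_simps)
  have "dot2 a b * dot2 b c + dot2 b c * dot2 c a + dot2 c a * dot2 a b
      = dot2 a a * dot2 b b - (dot2 a b)\<^sup>2"
    unfolding c by (simp add: dot2_commute[of b a] algebra_simps power2_eq_square)
  also have "\<dots> = 1" using dot2_det2[of a b] assms(2) by simp
  finally have "dot2 a b * dot2 b c + dot2 b c * dot2 c a + dot2 c a * dot2 a b = 1" .
  moreover have "1 \<le> x * y" if "x \<le> -1" "y \<le> -1" for x y :: int
    using mult_mono[of 1 "-x" 1 "-y"] that by auto
  ultimately show False using n by (smt (verit))
qed

section \<open>Stencils\<close>

lemma convex4:
  assumes "convex C" "p \<in> C" "q \<in> C" "r \<in> C" "s \<in> C"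
    and "0 \<le> a" "0 \<le> b" "0 \<le> c" "0 \<le> d" "a + b + c + d = (1 :: real)"
  shows "a *\<^sub>R p + b *\<^sub>R q + c *\<^sub>R r + d *\<^sub>R s \<in> C"
proof -
  have "(\<Sum>i\<in>{..<4::nat}. ([a, b, c, d] ! i) *\<^sub>R ([p, q, r, s] ! i)) \<in> C"
    by (intro convex_sum) (use assms in \<open>auto simp: numeral_eq_Suc less_Suc_eq\<close>)
  then show ?thesis by (simp add: numeral_eq_Suc add.assoc)
qed

lemma convex_on4:
  assumes "convex_on C F" "p \<in> C" "q \<in> C" "r \<in> C" "s \<in> C"
    and "0 \<le> a" "0 \<le> b" "0 \<le> c" "0 \<le> d" "a + b + c + d = (1 :: real)"
  shows "F (a *\<^sub>R p + b *\<^sub>R q + c *\<^sub>R r + d *\<^sub>R s) \<le> a * F p + b * F q + c * F r + d * F s"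
proof -
  have "F (\<Sum>i\<in>{..<4::nat}. ([a, b, c, d] ! i) *\<^sub>R ([p, q, r, s] ! i))
      \<le> (\<Sum>i\<in>{..<4::nat}. ([a, b, c, d] ! i) * F ([p, q, r, s] ! i))"
    by (intro convex_on_sum[of _ C]) (use assms in \<open>auto simp: numeral_eq_Suc less_Suc_eq\<close>)
  then show ?thesis by (simp add: numeral_eq_Suc add.assoc)
qed

text \<open>Convex combinations are certified by integer identities with a common denominator n, the
  base point x taking the remaining weight. Shorter combinations repeat a vector or give it weight
  0.\<close>

lemma lattice_combination:
  assumes "sm n w = sm k1 a + sm k2 b + sm k3 c" "n > 0"
  shows "emb (x + w) = (of_int (n - k1 - k2 - k3) / of_int n) *\<^sub>R emb x
      + (of_int k1 / of_int n) *\<^sub>R emb (x + a) + (of_int k2 / of_int n) *\<^sub>R emb (x + b)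
      + (of_int k3 / of_int n) *\<^sub>R emb (x + c)"
proof -
  have "of_int n *\<^sub>R emb w = of_int k1 *\<^sub>R emb a + of_int k2 *\<^sub>R emb b + of_int k3 *\<^sub>R emb c"
    using arg_cong[OF assms(1), of emb] by simp
  then have "(1 / of_int n) *\<^sub>R (of_int n *\<^sub>R emb w)
      = (1 / of_int n) *\<^sub>R (of_int k1 *\<^sub>R emb a + of_int k2 *\<^sub>R emb b + of_int k3 *\<^sub>R emb c)"
    by simp
  then have w: "emb w = (of_int k1 / of_int n) *\<^sub>R emb a + (of_int k2 / of_int n) *\<^sub>R emb b
      + (of_int k3 / of_int n) *\<^sub>R emb c"
    using assms(2) by (simp add: scaleR_add_right)
  have *: "of_int (n - k1 - k2 - k3) / of_int n
      = 1 - of_int k1 / of_int n - of_int k2 / of_int n - (of_int k3 / of_int n :: real)"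
    using assms(2) by (simp add: field_simps)
  then show ?thesis
    unfolding * emb_simps w scaleR_add_right scaleR_diff_left scaleR_one by simp
qed

section \<open>Open cones and visibility\<close>

definition open_cone :: "ivec \<Rightarrow> ivec \<Rightarrow> ivec set" where
  "open_cone a b = {e. det2 a b > 0 \<and> det2 a e > 0 \<and> det2 e b > 0}"

text \<open>Cutting at c yields strictly smaller cones, since c itself is lost. This lets a minimal
  enclosing pair be reached.\<close>

lemma open_cone_trans:
  assumes "c \<in> open_cone a b"
  shows "open_cone c b \<subset> open_cone a b" "open_cone a c \<subset> open_cone a b"
proof -
  have c: "det2 a b > 0" "det2 a c > 0" "det2 c b > 0"
    using assms by (auto simp: open_cone_def)
  have "d \<in> open_cone a b" if "d \<in> open_cone c b" for d
  proof -
    have d: "det2 c d > 0" "det2 d b > 0" using that by (auto simp: open_cone_def)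
    have "det2 c b * det2 a d = det2 a b * det2 c d + det2 a c * det2 d b"
      by (simp add: det2_def algebra_simps)
    then have "0 < det2 c b * det2 a d" using c d by (simp add: add_pos_pos)
    then show ?thesis using c d by (simp add: open_cone_def zero_less_mult_iff)
  qed
  moreover have "d \<in> open_cone a b" if "d \<in> open_cone a c" for d
  proof -
    have d: "det2 a d > 0" "det2 d c > 0" using that by (auto simp: open_cone_def)
    have "det2 a c * det2 d b = det2 d c * det2 a b + det2 a d * det2 c b"
      by (simp add: det2_def algebra_simps)
    then have "0 < det2 a c * det2 d b" using c d by (simp add: add_pos_pos)
    then show ?thesis using c d by (simp add: open_cone_def zero_less_mult_iff)
  qed
  moreover have "c \<notin> open_cone c b" "c \<notin> open_cone a c" by (auto simp: open_cone_def)
  ultimately show "open_cone c b \<subset> open_cone a b" "open_cone a c \<subset> open_cone a b"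
    using assms by auto
qed

text \<open>The cone opens by less than a half turn, so two distinct primitive directions in it
  cannot be parallel.\<close>

lemma open_cone_cases:
  assumes "e \<in> open_cone a b" "c \<in> open_cone a b" "irred e" "irred c" "c \<noteq> e"
  shows "e \<in> open_cone c b \<or> e \<in> open_cone a c"
proof -
  have *: "det2 a e > 0" "det2 e b > 0" "det2 a c > 0" "det2 c b > 0"
    using assms(1,2) by (auto simp: open_cone_def)
  have "det2 c e \<noteq> 0"
  proof
    assume "det2 c e = 0"
    then have "e = - c" using irred_parallel_irred assms(3-5) by blast
    then show False using * by simp
  qed
  then show ?thesis using * det2_swap[of c e] by (auto simp: open_cone_def)
qed

text \<open>Either set may be empty, namely when no direction lies on that side of e.\<close>

lemma finite_separation:
  fixes R S :: "real set"
  assumes "finite R" "finite S" "\<And>r s. r \<in> R \<Longrightarrow> s \<in> S \<Longrightarrow> r \<le> s"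
  obtains k where "\<And>r. r \<in> R \<Longrightarrow> r \<le> k" "\<And>s. s \<in> S \<Longrightarrow> k \<le> s"
proof (cases "R = {}")
  case True
  show ?thesis
  proof (cases "S = {}")
    case False
    then show ?thesis using that[of "Min S"] True assms(2) by simp
  qed (use that True in auto)
next
  case False
  then show ?thesis using that[of "Max R"] assms by simp
qed

lemma convex_cone_halfspace: "convex_cone {p :: 'a :: real_inner. l \<bullet> p \<le> 0}"
  unfolding convex_cone_iff
  by (auto simp: inner_add_right add_nonpos_nonpos mult_nonneg_nonpos)

text \<open>If no two elements of S enclose e, then the ratios of dot to cross products with e
  on both sides of e can be separated, which gives a linear form that is positive at e and
  nonpositive on S.\<close>

lemma open_cone_if_in_convex_cone_hull:
  assumes "finite S" "\<And>v. v \<in> S \<Longrightarrow> irred v" "irred e" "e \<notin> S"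
    and "emb e \<in> convex_cone hull (emb ` S)"
  obtains a b where "a \<in> S" "b \<in> S" "e \<in> open_cone a b"
proof (rule ccontr)
  assume "\<not> thesis"
  then have no: "\<And>a b. a \<in> S \<Longrightarrow> b \<in> S \<Longrightarrow> e \<notin> open_cone a b" using that by blast
  define \<rho> :: "ivec \<Rightarrow> real" where "\<rho> v = of_int (dot2 e v) / of_int (det2 e v)" for v
  define R where "R = \<rho> ` {v \<in> S. det2 e v > 0}"
  define S' where "S' = \<rho> ` {v \<in> S. det2 e v < 0}"
  have fin: "finite R" "finite S'" using assms(1) by (auto simp: R_def S'_def)
  have le: "r \<le> s" if rs: "r \<in> R" "s \<in> S'" for r s
  proof -
    obtain b where b: "r = \<rho> b" "b \<in> {v \<in> S. det2 e v > 0}" using rs(1) unfolding R_def by blast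
    obtain a where a: "s = \<rho> a" "a \<in> {v \<in> S. det2 e v < 0}" using rs(2) unfolding S'_def by blast
    have "det2 a b \<le> 0"
      using no[of a b] a(2) b(2) det2_swap[of a e] by (auto simp: open_cone_def)
    then have "dot2 e e * det2 a b \<le> 0"
      by (simp add: mult_nonneg_nonpos dot2_self_ge_0)
    then have "dot2 e a * det2 e b \<le> dot2 e b * det2 e a"
      by (simp add: dot2_self_det2)
    then have "real_of_int (dot2 e a) * of_int (det2 e b) \<le> of_int (dot2 e b) * of_int (det2 e a)"
      by (metis of_int_le_iff of_int_mult)
    then show ?thesis using a(2) b(2) unfolding a(1) b(1) \<rho>_def
      by (simp add: divide_simps mult.commute)
  qed
  obtain k where k: "\<And>r. r \<in> R \<Longrightarrow> r \<le> k" "\<And>s. s \<in> S' \<Longrightarrow> k \<le> s"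
    using finite_separation[OF fin le] by blast
  \<comment> \<open>l is e plus k times e turned by a right angle: it is positive at e for every k,
    and its sign at v compares \<open>\<rho> v\<close> with k.\<close>
  define l :: "real \<times> real" where
    "l = (of_int (fst e) + k * of_int (snd e), of_int (snd e) - k * of_int (fst e))"
  have l: "l \<bullet> emb v = of_int (dot2 e v) - k * of_int (det2 e v)" for v
    by (simp add: l_def emb_def dot2_def det2_def inner_prod_def algebra_simps)
  have "l \<bullet> emb v \<le> 0" if v: "v \<in> S" for v
  proof -
    consider "det2 e v > 0" | "det2 e v < 0" | "det2 e v = 0" by linarith
    then show ?thesis
    proof cases
      case 1
      then have "\<rho> v \<le> k" using k(1) v by (auto simp: R_def)
      then show ?thesis using 1 unfolding l \<rho>_def by (simp add: divide_simps mult.commute)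
    next
      case 2
      then have "k \<le> \<rho> v" using k(2) v by (auto simp: S'_def)
      then show ?thesis using 2 unfolding l \<rho>_def by (simp add: divide_simps mult.commute)
    next
      case 3
      then have "v = - e" using irred_parallel_irred assms(2-4) v by blast
      then show ?thesis using dot2_self_ge_0[of e] by (simp add: l det2_def dot2_def)
    qed
  qed
  then have "convex_cone hull (emb ` S) \<subseteq> {p. l \<bullet> p \<le> 0}"
    by (intro hull_minimal convex_cone_halfspace) auto
  then have "l \<bullet> emb e \<le> 0" using assms(5) by blast
  then show False using dot2_self_ge_1[OF assms(3)] by (simp add: l)
qed

lemma lattice_convex:
  assumes "convex C" "emb x \<in> C" "emb (x + a) \<in> C" "emb (x + b) \<in> C" "emb (x + c) \<in> C"
    and "k1 \<ge> 0" "k2 \<ge> 0" "k3 \<ge> 0" "k1 + k2 + k3 \<le> n" "n > 0"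
    and "sm n w = sm k1 a + sm k2 b + sm k3 c"
  shows "emb (x + w) \<in> C"
  unfolding lattice_combination[OF assms(11,10)]
proof (rule convex4)
  show "real_of_int (n - k1 - k2 - k3) / real_of_int n + real_of_int k1 / real_of_int n
      + real_of_int k2 / real_of_int n + real_of_int k3 / real_of_int n = 1"
    using assms(10) by (simp add: field_simps)
qed (use assms in \<open>auto simp del: emb_simps\<close>)

text \<open>Of the convex body two facts are kept: finiteness of X, and that X contains all lattice
  points of its hull. The latter turns convex combinations into visibility.\<close>

locale lattice_stencils =
  fixes X :: "ivec set" and V :: "ivec \<Rightarrow> ivec set"
  assumes finite_X: "finite X"
    and hull_X: "\<And>w. emb w \<in> hull_of X \<Longrightarrow> w \<in> X"
    and stencils: "stencils X V"
begin

lemma convex_X: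
  assumes "x \<in> X" "x + a \<in> X" "x + b \<in> X" "x + c \<in> X"
    and "k1 \<ge> 0" "k2 \<ge> 0" "k3 \<ge> 0" "k1 + k2 + k3 \<le> n" "n > 0"
    and "sm n w = sm k1 a + sm k2 b + sm k3 c"
  shows "x + w \<in> X"
  by (rule hull_X, unfold hull_of_def, rule lattice_convex[OF convex_convex_hull _ _ _ _ assms(5-10)])
    (use assms in \<open>auto intro: hull_inc simp del: emb_simps\<close>)

lemma Vmax_convex:
  assumes "x \<in> X" "a \<in> Vmax X x" "b \<in> Vmax X x" "k1 \<ge> 0" "k2 \<ge> 0" "k1 + k2 \<le> n" "n > 0"
    and "sm n w = sm k1 a + sm k2 b" "irred w"
  shows "w \<in> Vmax X x"
  using convex_X[of x a b a k1 k2 0 n w] assms by (auto simp: Vmax_def)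

lemma V_subset: "x \<in> X \<Longrightarrow> V x \<subseteq> Vmax X x"
  using stencils by (auto simp: stencils_def)

lemma V_irred: "x \<in> X \<Longrightarrow> e \<in> V x \<Longrightarrow> irred e"
  using V_subset unfolding Vmax_def by blast

lemma V_add: "x \<in> X \<Longrightarrow> e \<in> V x \<Longrightarrow> x + e \<in> X"
  using V_subset unfolding Vmax_def by blast

lemma stability:
  assumes "x \<in> X" "e \<in> V x" "det2 f g = 1" "dot2 f g \<ge> 0" "e = f + g"
  shows "f \<in> Vmax X x \<Longrightarrow> f \<in> V x" "g \<in> Vmax X x \<Longrightarrow> g \<in> V x"
  using stencils assms parents_iff[of e f g] unfolding stencils_def by blast+

lemma finite_V: "x \<in> X \<Longrightarrow> finite (V x)"
proof -
  assume "x \<in> X"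
  then have "V x \<subseteq> (\<lambda>y. y - x) ` X"
    using V_add by (metis (no_types, lifting) add_diff_cancel_left' image_iff subsetI)
  then show ?thesis using finite_X finite_subset by blast
qed

text \<open>Visibility gives some enclosing pair. One with the fewest stencil directions in between
  has none: any such direction would cut the cone, and e would lie in one of the two halves.\<close>

lemma enclosing_pair:
  assumes "x \<in> X" "e \<in> Vmax X x" "e \<notin> V x"
  obtains a b where "a \<in> V x" "b \<in> V x" "e \<in> open_cone a b" "V x \<inter> open_cone a b = {}"
proof -
  have e: "irred e" using assms by (auto simp: Vmax_def)
  define Q where "Q = (\<lambda>(a, b). a \<in> V x \<and> b \<in> V x \<and> e \<in> open_cone a b)"
  have "emb e \<in> convex_cone hull (emb ` Vmax X x)"
    using assms(2) by (intro hull_inc) auto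
  then have "emb e \<in> convex_cone hull (emb ` V x)"
    using stencils assms(1) by (auto simp: stencils_def)
  then obtain a b where "Q (a, b)"
    using open_cone_if_in_convex_cone_hull[OF finite_V[OF assms(1)] V_irred[OF assms(1)] e assms(3)]
    unfolding Q_def by blast
  then obtain ab where ab: "Q ab"
    and least: "\<And>cd. Q cd \<Longrightarrow> card (V x \<inter> case_prod open_cone ab) \<le> card (V x \<inter> case_prod open_cone cd)"
    using ex_has_least_nat[of Q "(a, b)" "\<lambda>ab. card (V x \<inter> case_prod open_cone ab)"] by blast
  obtain a b where ab': "ab = (a, b)" by (cases ab)
  have Q: "a \<in> V x" "b \<in> V x" "e \<in> open_cone a b" using ab by (auto simp: Q_def ab')
  have "False" if c: "c \<in> V x" "c \<in> open_cone a b" for c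
  proof -
    have lt: "card (V x \<inter> B) < card (V x \<inter> open_cone a b)"
      if "B \<subset> open_cone a b" "c \<notin> B" for B
      using that c finite_V[OF assms(1)] by (intro psubset_card_mono) auto
    have "c \<notin> open_cone c b" "c \<notin> open_cone a c" by (auto simp: open_cone_def)
    moreover have "Q (c, b) \<or> Q (a, c)"
      using open_cone_cases[OF Q(3) c(2) e V_irred[OF assms(1) c(1)]] c(1) Q assms(3)
      by (auto simp: Q_def)
    ultimately show False
      using lt[of "open_cone c b"] lt[of "open_cone a c"] open_cone_trans[OF c(2)] least
      unfolding ab' by (metis case_prod_conv leD)
  qed
  then show ?thesis using that Q by blast
qed

end

section \<open>Refined stencil inequalities\<close>

lemma basis_coords_sign:
  assumes "s = 1 \<or> s = -1" "s * det2 f g = 1"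
  shows "c = sm (s * det2 c g) f + sm (s * det2 f c) g"
  using assms(1)
proof
  assume s: "s = -1"
  then have "- c = sm (det2 c g) f + sm (det2 f c) g"
    using det2_cramer[of f g c] assms(2) by (simp add: minus_equation_iff[of "det2 f g"])
  then have "c = - (sm (det2 c g) f + sm (det2 f c) g)" by (metis minus_minus)
  then show ?thesis by (simp add: s sm_algebra)
qed (use det2_cramer[of f g c] assms(2) in simp)

lemma dot2_comb:
  "dot2 (sm p f + sm q g) (sm p f + sm q g) = p * p * dot2 f f + 2 * (p * q) * dot2 f g + q * q * dot2 g g"
  by (simp add: dot2_def sm_def algebra_simps)

text \<open>For an acute pair each term of the expanded square grows with p and q, so f + g is a
  shortest lattice vector strictly inside the cone of a basis (f, g).\<close>

lemma dot2_comb_ge: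
  assumes "p \<ge> 1" "q \<ge> 1" "dot2 f g \<ge> 0"
  shows "dot2 (sm p f + sm q g) (sm p f + sm q g) \<ge> dot2 (f + g) (f + g)"
proof -
  have "1 * 1 \<le> p * p" "1 * 1 \<le> p * q" "1 * 1 \<le> q * q"
    using assms by (intro mult_mono; simp)+
  then have "1 * dot2 f f \<le> p * p * dot2 f f" "1 * dot2 g g \<le> q * q * dot2 g g"
    "1 * dot2 f g \<le> (p * q) * dot2 f g"
    using assms dot2_self_ge_0 by (intro mult_right_mono; simp)+
  then show ?thesis unfolding dot2_comb by (simp add: dot2_commute[of g f])
qed

lemma dot2_comb_gt:
  assumes "p \<ge> 1" "q \<ge> 1" "p + q \<ge> 3" "dot2 f g \<ge> 0" "f \<noteq> 0" "g \<noteq> 0"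
  shows "dot2 (sm p f + sm q g) (sm p f + sm q g) > dot2 (f + g) (f + g)"
proof -
  have *: "1 * 1 \<le> p * p" "1 * 1 \<le> p * q" "1 * 1 \<le> q * q"
    using assms by (intro mult_mono; simp)+
  have sq: "2 * 2 \<le> k * k" if "k \<ge> 2" for k :: int using that by (intro mult_mono) auto
  have "p \<ge> 2 \<or> q \<ge> 2" using assms by linarith
  then have "2 * 2 \<le> p * p \<or> 2 * 2 \<le> q * q" using sq by blast
  moreover have "1 * dot2 f f \<le> p * p * dot2 f f" "1 * dot2 g g \<le> q * q * dot2 g g"
    "1 * dot2 f g \<le> (p * q) * dot2 f g"
    using assms dot2_self_ge_0 * by (intro mult_right_mono; simp)+
  moreover have "p * p * dot2 f f > 1 * dot2 f f" if "2 * 2 \<le> p * p"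
    using that assms by (intro mult_strict_right_mono) (auto simp: dot2_self_pos)
  moreover have "q * q * dot2 g g > 1 * dot2 g g" if "2 * 2 \<le> q * q"
    using that assms by (intro mult_strict_right_mono) (auto simp: dot2_self_pos)
  ultimately show ?thesis unfolding dot2_comb by (auto simp: dot2_commute[of g f])
qed

text \<open>\<open>p * s = 1 + q * r\<close> is positive, so p and s have the same sign. If both
  were negative, \<open>q \<ge> 1 - s\<close> and \<open>r \<ge> 1 - p\<close> would make
  \<open>q * r\<close> exceed \<open>p * s\<close>.\<close>

lemma unimodular_nonneg:
  fixes p q r s :: int
  assumes "p * s - q * r = 1" "q \<ge> 0" "r \<ge> 0" "p + r \<ge> 1" "q + s \<ge> 1"
  shows "p \<ge> 1 \<and> s \<ge> 1"
proof (rule ccontr)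
  assume n: "\<not> (p \<ge> 1 \<and> s \<ge> 1)"
  have "q * r \<ge> 0" using assms by simp
  then have "p * s > 0" using assms by linarith
  then have "p < 0" "s < 0" using n by (auto simp: zero_less_mult_iff)
  then have "(1 - s) * (1 - p) \<le> q * r" using assms by (intro mult_mono) auto
  then show False using assms \<open>p < 0\<close> \<open>s < 0\<close> by (simp add: algebra_simps)
qed

text \<open>One step of Euclid's algorithm on the rows (p, q) and (r, s): unless the matrix is the
  identity, one row dominates the other and can be reduced by it. Crossed strict inequalities would
  make the determinant too large or negative.\<close>

lemma unimodular_comparable:
  fixes p q r s :: int
  assumes "p * s - q * r = 1" "q \<ge> 0" "r \<ge> 0" "p \<ge> 1" "s \<ge> 1"
  shows "(p = 1 \<and> q = 0 \<and> r = 0 \<and> s = 1) \<or> (p \<ge> r \<and> q \<ge> s) \<or> (p \<le> r \<and> q \<le> s)"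
proof (rule ccontr)
  assume n: "\<not> ?thesis"
  then consider "p \<ge> r + 1" "s \<ge> q + 1" | "r \<ge> p + 1" "q \<ge> s + 1" by linarith
  then show False
  proof cases
    case 1
    then have "(r + 1) * (q + 1) \<le> p * s" using assms by (intro mult_mono) auto
    then have "r + q \<le> 0" using assms(1) by (simp add: algebra_simps)
    then have "r = 0" "q = 0" using assms by auto
    then have "p = 1" "s = 1" using assms(1,4,5) by (auto simp: pos_zmult_eq_1_iff)
    then show False using n \<open>r = 0\<close> \<open>q = 0\<close> by simp
  next
    case 2
    then have "(s + 1) * (p + 1) \<le> q * r" using assms by (intro mult_mono) auto
    then show False using assms by (simp add: algebra_simps)
  qed
qed

text \<open>Explicit weights: f and g lie in the convex hull of 0, a, b and f + g whenever (f, g) is a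
  direct basis contained in the cone spanned by a direct basis (a, b).\<close>

lemma hull_coords:
  assumes "p * s - q * r = 1" "f = sm p a + sm q b" "g = sm r a + sm s b"
  shows "sm (p + q + r + s - 1) f = sm (p + q - 1) (f + g) + sm (1 + r) a + sm (s - 1) b"
    and "sm (p + q + r + s - 1) g = sm (r + s - 1) (f + g) + sm (p - 1) a + sm (1 + q) b"
proof -
  \<comment> \<open>In coordinates on (a, b), \<open>p + q + r + s - 1\<close> is twice the area of
    the triangle a, b, f + g, and the weights are the barycentric coordinates of f and g in it,
    scaled by that number. They add up to it, so the origin receives weight 0.\<close>
  have ps: "p * s = 1 + q * r" using assms by simp
  have eqs: "(p + q + r + s - 1) * p = (p + q - 1) * (p + r) + (1 + r)"
    "(p + q + r + s - 1) * q = (p + q - 1) * (q + s) + (s - 1)"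
    "(p + q + r + s - 1) * r = (r + s - 1) * (p + r) + (p - 1)"
    "(p + q + r + s - 1) * s = (r + s - 1) * (q + s) + (1 + q)"
    using ps by (simp_all add: algebra_simps)
  have comb: "sm k (sm m a + sm n b) = sm (k * m) a + sm (k * n) b" for k m n
    by (simp add: sm_algebra)
  have fg: "f + g = sm (p + r) a + sm (q + s) b" by (simp add: assms sm_algebra)
  show "sm (p + q + r + s - 1) f = sm (p + q - 1) (f + g) + sm (1 + r) a + sm (s - 1) b"
    unfolding fg unfolding assms(2) comb eqs unfolding sm_algebra(1) by (simp only: add_ac)
  show "sm (p + q + r + s - 1) g = sm (r + s - 1) (f + g) + sm (p - 1) a + sm (1 + q) b"
    unfolding fg unfolding assms(3) comb eqs unfolding sm_algebra(1) by (simp only: add_ac)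
qed

lemma basis_change_det:
  assumes "det2 a b = 1" "det2 f g = 1"
  shows "det2 f b * det2 a g - det2 a f * det2 g b = 1"
  using det2_pluecker[of a b f g] det2_swap[of b g] assms by simp

text \<open>If f lay outside the cone, beyond a, then a would be a combination of f and g with
  positive coefficients, not both 1, hence longer than e. But a is no longer than a + b, which is no
  longer than e. The same holds for g and b.\<close>

lemma parents_in_cone:
  assumes ab: "det2 a b = 1" "dot2 a b \<ge> 0" and e: "e \<in> open_cone a b"
    and fg: "det2 f g = 1" "dot2 f g \<ge> 0" "e = f + g"
  shows "det2 a f \<ge> 0" "det2 g b \<ge> 0"
proof -
  have nz: "a \<noteq> 0" "b \<noteq> 0" "f \<noteq> 0" "g \<noteq> 0"
    using irred_det2_1[OF ab(1)] irred_det2_1[OF fg(1)] irred_nz by auto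
  have pos: "det2 a e \<ge> 1" "det2 e b \<ge> 1" using e by (auto simp: open_cone_def)
  have "dot2 (a + b) (a + b) \<le> dot2 e e"
    using dot2_comb_ge[OF pos(2,1) ab(2)] basis_coords[OF ab(1), of e] by simp
  moreover have "dot2 (a + b) (a + b) = dot2 a a + 2 * dot2 a b + dot2 b b"
    by (simp add: dot2_commute[of b a])
  ultimately have le: "dot2 a a \<le> dot2 e e" "dot2 b b \<le> dot2 e e"
    using ab dot2_self_ge_0[of a] dot2_self_ge_0[of b] by linarith+
  show "det2 a f \<ge> 0"
  proof (rule ccontr)
    assume "\<not> ?thesis"
    then have "det2 f a \<ge> 1" "det2 a g > det2 f a" using pos(1) det2_swap[of a f] by (auto simp: fg)
    then have "dot2 e e < dot2 a a"
      using dot2_comb_gt[of "det2 a g" "det2 f a" f g] basis_coords[OF fg(1), of a] fg nz by simp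
    then show False using le by simp
  qed
  show "det2 g b \<ge> 0"
  proof (rule ccontr)
    assume "\<not> ?thesis"
    then have "det2 b g \<ge> 1" "det2 f b > det2 b g" using pos(2) det2_swap[of g b] by (auto simp: fg)
    then have "dot2 e e < dot2 b b"
      using dot2_comb_gt[of "det2 b g" "det2 f b" f g] basis_coords[OF fg(1), of b] fg nz by simp
    then show False using le by simp
  qed
qed

text \<open>Both pairs enclose e, so \<open>parents_in_cone\<close> applies in both directions and
  makes f and f' parallel; opposite they cannot be, as both have determinant 1 with e.\<close>

lemma parents_unique:
  assumes "parents e f g" "parents e f' g'"
  shows "f = f' \<and> g = g'"
proof -
  have fg: "det2 f g = 1" "dot2 f g \<ge> 0" "e = f + g" and fg': "det2 f' g' = 1" "dot2 f' g' \<ge> 0" "e = f' + g'"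
    using assms by (auto simp: parents_iff)
  have "e \<in> open_cone f g" using fg by (simp add: open_cone_def)
  moreover have "e \<in> open_cone f' g'" using fg' by (simp add: open_cone_def)
  ultimately have "det2 f f' \<ge> 0" "det2 f' f \<ge> 0"
    using parents_in_cone(1)[OF fg(1,2) _ fg'] parents_in_cone(1)[OF fg'(1,2) _ fg] by blast+
  then have "det2 f f' = 0" using det2_swap[of f f'] by simp
  then have "f' = f \<or> f' = - f"
    using irred_parallel_irred irred_det2_1[OF fg(1)] irred_det2_1[OF fg'(1)] by blast
  moreover have "f' \<noteq> - f"
  proof
    assume f': "f' = - f"
    have "det2 f e = 1" "det2 f' e = 1" using fg by simp (simp add: fg'(1,3))
    then show False by (simp add: f')
  qed
  ultimately show ?thesis using fg(3) fg'(3) by simp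
qed

lemma parents_shorter:
  assumes "parents e f g"
  shows "irred f" "irred g" "dot2 f f < dot2 e e" "dot2 g g < dot2 e e"
proof -
  have fg: "det2 f g = 1" "dot2 f g \<ge> 0" "e = f + g" using assms by (auto simp: parents_iff)
  show irr: "irred f" "irred g" using irred_det2_1[OF fg(1)] by auto
  show "dot2 f f < dot2 e e" "dot2 g g < dot2 e e"
    using dot2_self_ge_1[OF irr(1)] dot2_self_ge_1[OF irr(2)] fg by (auto simp: dot2_commute[of g f])
qed

section \<open>Gaps of a stencil\<close>

context lattice_stencils
begin

text \<open>Two consecutive elements a, b of a stencil, enclosing a visible vector e outside of the
  stencil. Writing a = f + g with parents f, g and b in the basis (f, g), stability
  prevents g from entering the cone; this leaves only the case b = g, or b longer than a. The sign s
  allows for both orientations.\<close>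

lemma consecutive_acute_or_longer:
  assumes x: "x \<in> X" and ab: "a \<in> V x" "b \<in> V x" and e: "e \<in> Vmax X x"
    and s: "s = 1 \<or> s = -1"
    and pos: "s * det2 a b > 0" "s * det2 a e > 0" "s * det2 e b > 0"
    and emp: "\<And>c. c \<in> V x \<Longrightarrow> s * det2 a c > 0 \<Longrightarrow> s * det2 c b > 0 \<Longrightarrow> False"
  shows "(s * det2 a b = 1 \<and> dot2 a b \<ge> 0) \<or> dot2 a a < dot2 b b \<or> dot2 a a = 1"
proof (cases "dot2 a a = 1")
  case False
  have irr: "irred a" "irred b" "irred e"
    using V_irred[OF x] ab e by (auto simp: Vmax_def)
  have Vm: "a \<in> Vmax X x" "b \<in> Vmax X x" using V_subset[OF x] ab by auto
  have "dot2 a a > 1" using False dot2_self_ge_1[OF irr(1)] by simp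
  then obtain f' g' where "parents a f' g'" using parents_exist irr(1) by blast
  then have fg': "det2 f' g' = 1" "dot2 f' g' \<ge> 0" "a = f' + g'" by (auto simp: parents_iff)
  have "\<exists>f g. s * det2 f g = 1 \<and> dot2 f g \<ge> 0 \<and> a = f + g \<and> (g \<in> Vmax X x \<longrightarrow> g \<in> V x)"
    using s
  proof
    assume "s = 1"
    then show ?thesis using fg' stability[OF x ab(1) fg'] by (intro exI[of _ f'] exI[of _ g']) auto
  next
    assume "s = -1"
    then have "s * det2 g' f' = 1 \<and> dot2 g' f' \<ge> 0 \<and> a = g' + f' \<and> (f' \<in> Vmax X x \<longrightarrow> f' \<in> V x)"
      using fg' stability[OF x ab(1) fg'] det2_swap[of g' f'] dot2_commute[of g' f']
      by (simp add: add.commute)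
    then show ?thesis by blast
  qed
  then obtain f g where fg: "s * det2 f g = 1" "dot2 f g \<ge> 0" "a = f + g"
    and g_in: "g \<in> Vmax X x \<Longrightarrow> g \<in> V x" by blast
  have irr_fg: "irred f" "irred g"
    using fg(1) s irred_det2_1[of f g] irred_det2_1[of g f] det2_swap[of g f] by auto
  have nz: "f \<noteq> 0" "g \<noteq> 0" using irr_fg irred_nz by auto
  define \<alpha> \<beta> where "\<alpha> = s * det2 b g" and "\<beta> = s * det2 f b"
  have b: "b = sm \<alpha> f + sm \<beta> g" unfolding \<alpha>_def \<beta>_def by (rule basis_coords_sign[OF s fg(1)])
  have ag: "s * det2 a g = 1" using fg by simp
  have gb: "s * det2 g b = - \<alpha>" using det2_swap[of g b] by (simp add: \<alpha>_def)
  have lt: "\<alpha> < \<beta>" using pos(1) gb by (simp add: fg(3) \<beta>_def algebra_simps)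
  \<comment> \<open>With \<open>\<alpha> < \<beta>\<close>, b lies on the ray of g or beyond it,
    strictly between a and g, opposite to f, or strictly inside the cone opposite to (f, g). In the
    second and fourth cases b is longer than a.\<close>
  consider "\<beta> \<ge> 1" "\<alpha> \<le> 0" | "\<beta> \<ge> 1" "\<alpha> \<ge> 1" | "\<beta> = 0" | "\<beta> < 0" by linarith
  then show ?thesis
  proof cases
    case 1
    have "sm (\<beta> - \<alpha>) g = sm 1 b + sm (- \<alpha>) a"
      unfolding b fg(3) by (simp add: sm_algebra)
    then have "g \<in> Vmax X x"
      using Vmax_convex[OF x Vm(2,1), of 1 "- \<alpha>" "\<beta> - \<alpha>" g] 1 lt irr_fg by simp
    then have "\<not> s * det2 g b > 0" using emp[of g] g_in ag by auto
    then have "\<alpha> = 0" using gb 1 by simp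
    then have "det2 g b = 0" using gb s by auto
    then have "b = g \<or> b = - g" using irred_parallel_irred irr irr_fg by blast
    moreover have "b \<noteq> - g"
    proof
      assume "b = - g"
      then have "\<beta> = - 1" using fg(1) by (simp add: \<beta>_def)
      then show False using 1 by simp
    qed
    ultimately have "b = g" by simp
    then show ?thesis using ag fg dot2_self_ge_0[of g] by simp
  next
    case 2
    then show ?thesis
      using dot2_comb_gt[of \<alpha> \<beta> f g] lt fg nz b by simp
  next
    case 3
    then have "det2 f b = 0" using s by (auto simp: \<beta>_def)
    then have "b = f \<or> b = - f" using irred_parallel_irred irr irr_fg by blast
    moreover have "b \<noteq> f" using lt 3 fg(1) by (auto simp: \<alpha>_def)
    ultimately have bf: "b = - f" by simp
    \<comment> \<open>Here g = a + b lies outside the triangle 0, a, b, so its visibility must come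
      from e: g is in the triangle spanned by 0, e and either b or a, according to the sign of
      \<open>\<alpha>'\<close>.\<close>
    define \<alpha>' \<beta>' where "\<alpha>' = s * det2 e g" and "\<beta>' = s * det2 f e"
    have e': "e = sm \<alpha>' f + sm \<beta>' g" unfolding \<alpha>'_def \<beta>'_def by (rule basis_coords_sign[OF s fg(1)])
    have "\<beta>' > 0" using pos(3) det2_swap[of e f] by (simp add: bf \<beta>'_def)
    moreover have "\<alpha>' < \<beta>'" using pos(2) det2_swap[of e g]
      by (simp add: fg(3) \<beta>'_def \<alpha>'_def algebra_simps)
    moreover have "sm \<beta>' g = sm 1 e + sm \<alpha>' b" "sm (\<beta>' - \<alpha>') g = sm 1 e + sm (- \<alpha>') a"
      unfolding e' fg(3) bf by (simp_all add: sm_algebra)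
    ultimately have "g \<in> Vmax X x"
      using Vmax_convex[OF x e Vm(2), of 1 \<alpha>' \<beta>' g] Vmax_convex[OF x e Vm(1), of 1 "- \<alpha>'" "\<beta>' - \<alpha>'" g]
        irr_fg by (cases "\<alpha>' \<ge> 0") auto
    then have "g \<in> V x" by (rule g_in)
    moreover have "s * det2 g b > 0" using fg(1) det2_swap[of g f] by (simp add: bf)
    ultimately show ?thesis using emp[of g] ag by simp
  next
    case 4
    have "dot2 (- b) (- b) > dot2 a a"
      using dot2_comb_gt[of "- \<alpha>" "- \<beta>" f g] 4 lt fg nz b by (simp add: sm_algebra)
    then show ?thesis by simp
  qed
qed simp

text \<open>The alternatives of the preceding lemma are taken in both orientations: a and b cannot
  each be shorter than the other, and nothing is shorter than a unit vector. Two unit vectors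
  remain; the squares of their product and of their positive determinant add up to 1, which again
  gives an acute basis.\<close>

lemma enclosing_basis:
  assumes x: "x \<in> X" and e: "e \<in> Vmax X x" "e \<notin> V x"
  obtains a b where "a \<in> V x" "b \<in> V x" "det2 a b = 1" "dot2 a b \<ge> 0" "e \<in> open_cone a b"
    "V x \<inter> open_cone a b = {}"
proof -
  obtain a b where ab: "a \<in> V x" "b \<in> V x" "e \<in> open_cone a b" "V x \<inter> open_cone a b = {}"
    using enclosing_pair[OF x e] by blast
  have pos: "det2 a b > 0" "det2 a e > 0" "det2 e b > 0" using ab by (auto simp: open_cone_def)
  have emp: "False" if "c \<in> V x" "det2 a c > 0" "det2 c b > 0" for c
    using that ab pos by (auto simp: open_cone_def)
  have "(1 * det2 a b = 1 \<and> dot2 a b \<ge> 0) \<or> dot2 a a < dot2 b b \<or> dot2 a a = 1"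
    by (rule consecutive_acute_or_longer[OF x ab(1,2) e(1)]) (use pos emp in auto)
  moreover have "((-1) * det2 b a = 1 \<and> dot2 b a \<ge> 0) \<or> dot2 b b < dot2 a a \<or> dot2 b b = 1"
  proof (rule consecutive_acute_or_longer[OF x ab(2,1) e(1)])
    show False if "c \<in> V x" "(-1) * det2 b c > 0" "(-1) * det2 c a > 0" for c
      using emp[OF that(1)] that(2,3) det2_swap[of b c] det2_swap[of c a] by simp
  qed (use pos det2_swap[of b a] det2_swap[of b e] det2_swap[of e a] in auto)
  moreover have "dot2 a a \<ge> 1" "dot2 b b \<ge> 1"
    using V_irred[OF x] ab dot2_self_ge_1 by auto
  moreover have "det2 a b = 1 \<and> dot2 a b \<ge> 0" if "dot2 a a = 1" "dot2 b b = 1"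
  proof -
    have *: "(dot2 a b)\<^sup>2 + (det2 a b)\<^sup>2 = 1" using dot2_det2[of a b] that by simp
    have "(det2 a b)\<^sup>2 \<ge> 1" using pos by (simp add: one_le_power)
    then have "(dot2 a b)\<^sup>2 \<le> 0" using * by linarith
    then have "dot2 a b = 0" by simp
    then show ?thesis using * pos by (simp add: power2_eq_1_iff)
  qed
  ultimately have "det2 a b = 1 \<and> dot2 a b \<ge> 0"
    using det2_swap[of b a] dot2_commute[of b a] by (smt (verit))
  then show ?thesis using that ab by blast
qed

section \<open>Positivity of the forms P, S and T\<close>

definition strict :: "(ivec \<Rightarrow> real) \<Rightarrow> bool" where
  "strict u \<longleftrightarrow> (\<forall>x\<in>X.
     (\<forall>e\<in>V x. {x + e, x, x - e} \<subseteq> X \<longrightarrow> S_form u x e > 0) \<and>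
     (\<forall>e\<in>V x. \<forall>f g. parents e f g \<and> {x + e, x - f, x - g, x} \<subseteq> X \<longrightarrow> T_form u x e f g > 0) \<and>
     (\<forall>e\<in>candidates X V x. \<forall>f g. parents e f g \<longrightarrow> P_form u x e f g > 0))"

text \<open>Euclidean descent on the coordinates of (f, g). Each subtraction splits off an S term,
  known to be positive because its direction is shorter than f + g, and the descent ends at (a, b),
  whose sum is a candidate. Membership in X is part of the claim because the S term at x + f also
  evaluates u at x + (f - g).\<close>

lemma P_form_pos_cone:
  assumes u: "strict u" and x: "x \<in> X" and abV: "a \<in> V x" "b \<in> V x"
    and ab: "det2 a b = 1" "dot2 a b \<ge> 0" and emp: "V x \<inter> open_cone a b = {}"
    and S: "\<And>y e. \<lbrakk>irred e; dot2 e e < n; y \<in> X; y + e \<in> X; y - e \<in> X\<rbrakk> \<Longrightarrow> S_form u y e > 0"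
    and fg: "det2 f g = 1" "det2 a f \<ge> 0" "det2 g b \<ge> 0" "det2 f b \<ge> 1" "det2 a g \<ge> 1"
    and e: "x + (f + g) \<in> X" "dot2 (f + g) (f + g) \<le> n"
  shows "x + f \<in> X \<and> x + g \<in> X \<and> P_form u x (f + g) f g > 0"
  using fg e
proof (induction "nat (det2 a f + det2 g b + det2 f b + det2 a g)" arbitrary: f g rule: less_induct)
  case less
  define p q r s where "p = det2 f b" and "q = det2 a f" and "r = det2 g b" and "s = det2 a g"
  note pqrs_def = p_def q_def r_def s_def
  have pqrs: "p * s - q * r = 1" "p \<ge> 1" "q \<ge> 0" "r \<ge> 0" "s \<ge> 1"
    using basis_change_det[OF ab(1) less.prems(1)] less.prems unfolding pqrs_def by auto
  have f: "f = sm p a + sm q b" and g: "g = sm r a + sm s b"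
    using basis_coords[OF ab(1)] unfolding pqrs_def by blast+
  note hc = hull_coords[OF pqrs(1) f g]
  have aX: "x + a \<in> X" "x + b \<in> X" using V_add[OF x] abV by auto
  have fgX: "x + f \<in> X" "x + g \<in> X"
    using convex_X[OF x less.prems(6) aX _ _ _ _ _ hc(1)] convex_X[OF x less.prems(6) aX _ _ _ _ _ hc(2)] pqrs
    by auto
  have irr: "irred f" "irred g" using irred_det2_1[OF less.prems(1)] by auto
  \<comment> \<open>A pair inside an acute cone is acute, so f and g are shorter than f + g.\<close>
  have "dot2 f g = p * r * dot2 a a + (p * s + q * r) * dot2 a b + q * s * dot2 b b"
    unfolding f g by (simp add: dot2_commute[of b a] algebra_simps)
  also have "\<dots> \<ge> 0"
    using pqrs ab dot2_self_ge_0 by (intro add_nonneg_nonneg mult_nonneg_nonneg) auto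
  finally have "dot2 f g \<ge> 0" .
  then have "dot2 f f < n" "dot2 g g < n"
    using less.prems(7) dot2_self_ge_1[OF irr(1)] dot2_self_ge_1[OF irr(2)]
    by (auto simp: dot2_commute[of g f])
  note S' = S[OF irr(1) this(1)] S[OF irr(2) this(2)]
  consider "p = 1" "q = 0" "r = 0" "s = 1" | "p \<ge> r" "q \<ge> s" | "p \<le> r" "q \<le> s"
    using unimodular_comparable pqrs by blast
  then show ?case
  proof cases
    case 1
    then have fgab: "f = a" "g = b" using f g by auto
    have par: "parents (a + b) a b" using ab by (simp add: parents_iff)
    have "a + b \<in> Vmax X x" using less.prems(6) par fgab by (simp add: Vmax_def parents_def)
    moreover have "a + b \<in> open_cone a b" using ab by (simp add: open_cone_def)
    ultimately have "a + b \<in> candidates X V x"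
      using emp par abV unfolding candidates_def by blast
    then have "P_form u x (a + b) a b > 0" using u x par unfolding strict_def by blast
    then show ?thesis using fgX fgab by simp
  next
    case 2
    then have 3: "s \<le> q" "r \<le> p" by simp_all
    \<comment> \<open>The pair (f - g, g) must again have a positive first entry p - r, so p = r has
      to be excluded.\<close>
    have "det2 f b \<noteq> det2 g b"
    proof
      assume "det2 f b = det2 g b"
      then have "p * (s - q) = 1" using pqrs(1) by (simp add: pqrs_def algebra_simps)
      moreover have "p * (s - q) \<le> 0" using pqrs 3 by (intro mult_nonneg_nonpos) auto
      ultimately show False by simp
    qed
    then have ih: "x + (f - g) \<in> X \<and> x + g \<in> X \<and> P_form u x (f - g + g) (f - g) g > 0"
      using less.prems pqrs 3 fgX \<open>dot2 f f < n\<close>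
      by (intro less.hyps) (auto simp: pqrs_def)
    have "P_form u x (f + g) f g = P_form u x (f - g + g) (f - g) g + S_form u (x + f) g"
      by (simp add: P_form_def S_form_def add.assoc add_diff_eq)
    moreover have "S_form u (x + f) g > 0"
      using ih fgX less.prems by (intro S') (auto simp: add.assoc add_diff_eq)
    ultimately show ?thesis using ih fgX by simp
  next
    case 3
    have "det2 a g \<noteq> det2 a f"
    proof
      assume "det2 a g = det2 a f"
      then have "s * (p - r) = 1" using pqrs(1) by (simp add: pqrs_def algebra_simps)
      moreover have "s * (p - r) \<le> 0" using pqrs 3 by (intro mult_nonneg_nonpos) auto
      ultimately show False by simp
    qed
    then have ih: "x + f \<in> X \<and> x + (g - f) \<in> X \<and> P_form u x (f + (g - f)) f (g - f) > 0"
      using less.prems pqrs 3 fgX \<open>dot2 g g < n\<close>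
      by (intro less.hyps) (auto simp: pqrs_def)
    have "P_form u x (f + g) f g = P_form u x (f + (g - f)) f (g - f) + S_form u (x + g) f"
      by (simp add: P_form_def S_form_def add_ac add_diff_eq)
    moreover have "S_form u (x + g) f > 0"
      using ih fgX less.prems by (intro S') (auto simp: add_ac add_diff_eq)
    ultimately show ?thesis using ih fgX by simp
  qed
qed

lemma P_form_pos_aux:
  assumes u: "strict u" and x: "x \<in> X" and e: "e \<in> Vmax X x" "e \<notin> V x"
    and S: "\<And>y d. \<lbrakk>irred d; dot2 d d < dot2 e e; y \<in> X; y + d \<in> X; y - d \<in> X\<rbrakk> \<Longrightarrow> S_form u y d > 0"
    and fg: "parents e f g"
  shows "x + f \<in> X \<and> x + g \<in> X \<and> P_form u x e f g > 0"
proof -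
  obtain a b where ab: "a \<in> V x" "b \<in> V x" "det2 a b = 1" "dot2 a b \<ge> 0" "e \<in> open_cone a b"
    "V x \<inter> open_cone a b = {}"
    using enclosing_basis[OF x e] by blast
  have fg': "det2 f g = 1" "dot2 f g \<ge> 0" "e = f + g" using fg by (auto simp: parents_iff)
  note cone = parents_in_cone[OF ab(3-5) fg']
  have "det2 a e \<ge> 1" "det2 e b \<ge> 1" using ab(5) by (auto simp: open_cone_def)
  then have "det2 f b \<ge> 1 \<and> det2 a g \<ge> 1"
    using unimodular_nonneg[OF basis_change_det[OF ab(3) fg'(1)]] cone by (simp add: fg'(3))
  then show ?thesis
    using P_form_pos_cone[OF u x ab(1-4,6) S fg'(1) cone] e by (auto simp: fg'(3) Vmax_def)
qed

text \<open>A missing direction lies strictly inside an acute basis, so it is at least as long as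
  the sum of that basis and cannot be a unit vector.\<close>

lemma outside_V_parents:
  assumes "x \<in> X" "e \<in> Vmax X x" "e \<notin> V x"
  obtains f g where "parents e f g"
proof -
  obtain a b where ab: "det2 a b = 1" "dot2 a b \<ge> 0" "e \<in> open_cone a b"
    using enclosing_basis[OF assms] by blast
  have "irred a" "irred b" using irred_det2_1[OF ab(1)] by auto
  then have "dot2 a a \<ge> 1" "dot2 b b \<ge> 1" using dot2_self_ge_1 by auto
  then have "dot2 (a + b) (a + b) > 1" using ab by (simp add: dot2_commute[of b a])
  moreover have "det2 a e \<ge> 1" "det2 e b \<ge> 1" using ab(3) by (auto simp: open_cone_def)
  then have "dot2 (a + b) (a + b) \<le> dot2 e e"
    using dot2_comb_ge[OF _ _ ab(2), of "det2 e b" "det2 a e"] basis_coords[OF ab(1), of e] by simp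
  ultimately show ?thesis using parents_exist[of e] assms that by (auto simp: Vmax_def)
qed

text \<open>S is even in e, so it suffices that e or - e belongs to the stencil; otherwise both P
  terms of the decomposition are available. The induction runs over all base points at once, because
  the P terms use S at points other than x.\<close>

lemma S_form_pos:
  assumes u: "strict u" and "irred e" "x \<in> X" "x + e \<in> X" "x - e \<in> X"
  shows "S_form u x e > 0"
  using assms(2-)
proof (induction "nat (dot2 e e)" arbitrary: x e rule: less_induct)
  case less
  have S: "S_form u y d > 0"
    if "irred d" "dot2 d d < dot2 e e" "y \<in> X" "y + d \<in> X" "y - d \<in> X" for y d
    using that dot2_self_ge_1[OF that(1)] by (intro less.hyps) auto
  have Vm: "e \<in> Vmax X x" "- e \<in> Vmax X x" using less.prems by (auto simp: Vmax_def)
  show ?case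
  proof (cases "e \<in> V x \<or> - e \<in> V x")
    case True
    moreover have "S_form u x (- e) = S_form u x e" by (simp add: S_form_def)
    moreover have "S_form u x d > 0" if "d \<in> V x" "x + d \<in> X" "x - d \<in> X" for d
      using u less.prems(2) that by (auto simp: strict_def)
    ultimately show ?thesis using less.prems by (metis diff_minus_eq_add add_uminus_conv_diff)
  next
    case False
    obtain f g where fg: "parents e f g" using outside_V_parents[OF less.prems(2) Vm(1)] False by blast
    note sh = parents_shorter[OF fg]
    have P: "x + f \<in> X \<and> x + g \<in> X \<and> P_form u x e f g > 0"
      using P_form_pos_aux[OF u less.prems(2) Vm(1) _ S fg] False by blast
    have P': "x + - f \<in> X \<and> x + - g \<in> X \<and> P_form u x (- e) (- f) (- g) > 0"
      using P_form_pos_aux[OF u less.prems(2) Vm(2) _ _ fg[folded parents_uminus[of e f g]]] S False by auto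
    have "S_form u x f > 0" "S_form u x g > 0"
      using S sh P P' less.prems by auto
    moreover have "S_form u x e = P_form u x e f g + P_form u x (- e) (- f) (- g) + S_form u x f + S_form u x g"
      by (simp add: S_form_def P_form_def)
    ultimately show ?thesis using P P' by simp
  qed
qed

lemma P_form_pos:
  assumes "strict u" "x \<in> X" "e \<in> Vmax X x" "e \<notin> V x" "parents e f g"
  shows "x + f \<in> X" "x + g \<in> X" "P_form u x e f g > 0"
  using P_form_pos_aux[OF assms(1-4) _ assms(5)] S_form_pos[OF assms(1)] by auto

lemma T_form_pos:
  assumes u: "strict u" and x: "x \<in> X" "x + e \<in> X" "x - f \<in> X" "x - g \<in> X" and fg: "parents e f g"
  shows "T_form u x e f g > 0"
proof (cases "e \<in> V x")
  case True
  moreover have "{x + e, x - f, x - g, x} \<subseteq> X" using x by simp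
  ultimately show ?thesis using u x(1) fg unfolding strict_def by blast
next
  case False
  have "e \<in> Vmax X x" using x fg by (auto simp: Vmax_def parents_def)
  note P = P_form_pos[OF u x(1) this False fg]
  have "S_form u x f > 0" "S_form u x g > 0"
    using S_form_pos[OF u] P x parents_shorter[OF fg] by auto
  moreover have "T_form u x e f g = P_form u x e f g + S_form u x f + S_form u x g"
    by (simp add: T_form_def P_form_def S_form_def)
  ultimately show ?thesis using P by simp
qed

end

section \<open>Lattice points in triangles\<close>

text \<open>For a positive determinant: the barycentric coordinates of v in the triangle 0, a, b,
  multiplied by \<open>det2 a b\<close>, are nonnegative.\<close>

definition in_triangle :: "ivec \<Rightarrow> ivec \<Rightarrow> ivec \<Rightarrow> bool" where
  "in_triangle a b v \<longleftrightarrow> det2 v b \<ge> 0 \<and> det2 a v \<ge> 0 \<and> det2 v b + det2 a v \<le> det2 a b"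

lemma in_triangle_convex:
  assumes "convex C" "emb x \<in> C" "emb (x + a) \<in> C" "emb (x + b) \<in> C"
    and "det2 a b > 0" "in_triangle a b v"
  shows "emb (x + v) \<in> C"
  using lattice_convex[OF assms(1-4,4), of "det2 v b" "det2 a v" 0 "det2 a b" v] assms(5,6)
    det2_cramer[of a b v]
  by (auto simp: in_triangle_def)

text \<open>For primitive a, the lattice vectors v with \<open>det2 a v = 1\<close> are spaced by a,
  so \<open>det2 v b\<close> runs through a residue class modulo D. The triangle admits the values 0
  to D - 1 at this height, hence exactly one such vector. If a is not primitive, its edge contains a
  further lattice point.\<close>

lemma lattice_point_in_triangle:
  assumes D: "det2 a b \<ge> 2"
  obtains v where "v \<noteq> 0" "v \<noteq> a" "v \<noteq> b" "in_triangle a b v"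
proof (cases "irred a")
  case True
  then obtain c where c: "det2 a c = 1" using irred_det2_exists by blast
  define D where "D = det2 a b"
  \<comment> \<open>\<open>det2 c' b\<close> will be - k, which is admissible only for k = 0;
    otherwise adding a shifts it to D - k.\<close>
  define k where "k = det2 b c mod D"
  define c' where "c' = c + sm (det2 b c div D) a"
  have ac': "det2 a c' = 1" by (simp add: c'_def c)
  have "D > 0" using assms by (simp add: D_def)
  have k: "0 \<le> k" "k < D" using D by (auto simp: k_def D_def)
  have "det2 b c' = det2 b c - D * (det2 b c div D)"
    using det2_swap[of b a] by (simp add: c'_def D_def)
  then have bc': "det2 b c' = k" by (simp add: k_def minus_mult_div_eq_mod)
  show ?thesis
  proof (cases "k = 0")
    case True
    show ?thesis
    proof (rule that[of c'])
      show "c' \<noteq> 0" "c' \<noteq> a" using ac' by (auto simp: det2_def)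
      show "c' \<noteq> b" using ac' D by auto
      show "in_triangle a b c'"
        using ac' bc' det2_swap[of c' b] D True by (simp add: in_triangle_def)
    qed
  next
    case False
    show ?thesis
    proof (rule that[of "c' + a"])
      have v: "det2 a (c' + a) = 1" "det2 (c' + a) b = D - k"
        using ac' bc' det2_swap[of c' b] by (auto simp: D_def)
      show "c' + a \<noteq> 0"
      proof
        assume "c' + a = 0"
        then have "det2 a (c' + a) = det2 a 0" by (simp only:)
        then show False using v(1) by (simp add: det2_def)
      qed
      show "c' + a \<noteq> a" using ac' by (auto simp: det2_def)
      show "c' + a \<noteq> b"
      proof
        assume "c' + a = b"
        then show False using v(2) k by simp
      qed
      show "in_triangle a b (c' + a)"
        using v k False by (simp add: in_triangle_def D_def)
    qed
  qed
next
  case False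
  have "a \<noteq> 0" using D by (auto simp: det2_def)
  then obtain e k where e: "irred e" "k \<ge> 1" "a = sm k e" using primitive_vector by blast
  then have k: "k \<ge> 2" using False by (cases "k = 1") auto
  have "k * det2 e b > 0" using D e by simp
  then have pos: "det2 e b > 0" using k by (simp add: zero_less_mult_iff)
  show ?thesis
  proof (rule that[of e])
    show "e \<noteq> 0" using irred_nz[OF e(1)] .
    show "e \<noteq> a"
    proof
      assume ea: "e = a"
      have "det2 a b = k * det2 e b" using arg_cong[OF e(3), of "\<lambda>t. det2 t b"] by simp
      then have "det2 e b = k * det2 e b" unfolding ea[symmetric] .
      moreover have "2 * det2 e b \<le> k * det2 e b" using k pos by (intro mult_right_mono) auto
      ultimately show False using pos by linarith
    qed
    show "e \<noteq> b" using pos by auto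
    show "in_triangle a b e" using pos k e mult_right_mono[of 1 k "det2 e b"]
      by (simp add: in_triangle_def)
  qed
qed

text \<open>The points at which S or T is evaluated lie in C, and w is their midpoint or centroid,
  as a maximum principle requires.\<close>

definition convex_witness :: "(real \<times> real) set \<Rightarrow> ivec \<Rightarrow> bool" where
  "convex_witness C w \<longleftrightarrow>
     (\<exists>e. irred e \<and> emb (w + e) \<in> C \<and> emb (w - e) \<in> C) \<or>
     (\<exists>e f g. parents e f g \<and> emb (w + e) \<in> C \<and> emb (w - f) \<in> C \<and> emb (w - g) \<in> C)"

text \<open>v and c may differ in length, but both are multiples of one primitive e, and convexity
  reaches w + e and w - e inside C.\<close>

lemma convex_witness_opposite:
  assumes C: "convex C" "emb w \<in> C" "emb (w + v) \<in> C" "emb (w + c) \<in> C"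
    and v: "v \<noteq> 0" and vc: "det2 v c = 0" "dot2 v c < 0"
  shows "convex_witness C w"
proof -
  obtain e k where e: "irred e" "k \<ge> 1" "v = sm k e" using primitive_vector[OF v] by blast
  then have "det2 e c = 0" using vc by auto
  then obtain m where m: "c = sm m e" using irred_parallel[OF e(1)] by blast
  have "k * (m * dot2 e e) < 0" using vc e m by (simp add: mult_ac)
  then have "m < 0" using e(2) dot2_self_ge_0[of e]
    by (smt (verit) mult_nonneg_nonneg)
  have "emb (w + e) \<in> C"
    using lattice_convex[OF C(1-3,3,3), of 1 0 0 k e] e by simp
  moreover have "emb (w + - e) \<in> C"
    using lattice_convex[OF C(1,2,4,4,4), of 1 0 0 "- m" "- e"] m \<open>m < 0\<close> by (simp add: sm_algebra)
  then have "emb (w - e) \<in> C" by simp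
  ultimately show ?thesis using e(1) unfolding convex_witness_def by blast
qed

lemma superbase_witness:
  assumes "a + b + c = 0" "det2 a b = 1" "dot2 a b \<ge> 0"
    and "emb (w + a) \<in> C" "emb (w + b) \<in> C" "emb (w + c) \<in> C"
  shows "convex_witness C w"
proof -
  have "c = (- a) + (- b)" using assms(1) by (simp add: add_eq_0_iff)
  then have "parents c (- a) (- b)" using assms(2,3) by (simp add: parents_iff)
  then show ?thesis using assms(4-6) unfolding convex_witness_def
    by (metis diff_minus_eq_add)
qed

text \<open>A lattice point in the interior of a lattice triangle: shrinking the triangle around the point
  either produces opposite vectors, or ends with a superbase.\<close>

lemma convex_witness_interior:
  assumes C: "convex C" "emb w \<in> C" "emb (w + a) \<in> C" "emb (w + b) \<in> C" "emb (w + c) \<in> C"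
    and pos: "det2 a b > 0" "det2 b c > 0" "det2 c a > 0"
  shows "convex_witness C w"
  using assms(3-)
proof (induction "nat (det2 a b + det2 b c + det2 c a)" arbitrary: a b c rule: less_induct)
  case less
  have step: "convex_witness C w"
    if inC: "emb (w + a') \<in> C" "emb (w + b') \<in> C" "emb (w + c') \<in> C"
      and pos: "det2 a' b' \<ge> 2" "det2 b' c' > 0" "det2 c' a' > 0"
      and sum: "det2 a' b' + det2 b' c' + det2 c' a' = det2 a b + det2 b c + det2 c a"
    for a' b' c'
  proof -
    obtain v where v: "v \<noteq> 0" "v \<noteq> a'" "v \<noteq> b'" "in_triangle a' b' v"
      using lattice_point_in_triangle[OF pos(1)] by blast
    define D \<alpha> \<beta> where "D = det2 a' b'" and "\<alpha> = det2 v b'" and "\<beta> = det2 a' v"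
    have nn: "\<alpha> \<ge> 0" "\<beta> \<ge> 0" "\<alpha> + \<beta> \<le> D" "D > 0"
      using v(4) pos by (auto simp: in_triangle_def D_def \<alpha>_def \<beta>_def)
    have Dv: "sm D v = sm \<alpha> a' + sm \<beta> b'" unfolding D_def \<alpha>_def \<beta>_def by (rule det2_cramer)
    have Dvc: "D * det2 v c' = \<beta> * det2 b' c' - \<alpha> * det2 c' a'"
      using arg_cong[OF Dv, of "\<lambda>t. det2 t c'"] det2_swap[of a' c'] by simp
    have vC: "emb (w + v) \<in> C" using in_triangle_convex[OF C(1,2) inC(1,2) _ v(4)] pos by simp
    have "\<alpha> \<noteq> D"
    proof
      assume "\<alpha> = D"
      then have "sm D v = sm D a'" using Dv nn by simp
      then show False using v nn by (simp add: sm_cancel)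
    qed
    have "\<beta> \<noteq> D"
    proof
      assume "\<beta> = D"
      then have "sm D v = sm D b'" using Dv nn by simp
      then show False using v nn by (simp add: sm_cancel)
    qed
    have lt: "\<alpha> < D" "\<beta> < D" using nn \<open>\<alpha> \<noteq> D\<close> \<open>\<beta> \<noteq> D\<close> by auto
    \<comment> \<open>The side of the line along c' on which v lies decides whether v replaces b' or
      a' while w stays strictly inside. If v is on that line, v and c' are opposite.\<close>
    consider "det2 v c' > 0" | "det2 v c' < 0" | "det2 v c' = 0" by linarith
    then show ?thesis
    proof cases
      case 1
      have \<alpha>c: "\<alpha> * det2 c' a' \<ge> 0" using nn pos by simp
      have "D * det2 v c' > 0" using 1 nn by simp
      then have "\<beta> * det2 b' c' > 0" using Dvc \<alpha>c by linarith
      then have "\<beta> > 0" using pos by (simp add: zero_less_mult_iff)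
      have "D * det2 v c' \<le> D * det2 b' c'"
        using Dvc \<alpha>c mult_right_mono[of \<beta> D "det2 b' c'"] lt pos by linarith
      then have "det2 v c' \<le> det2 b' c'" using nn by simp
      then show ?thesis
        using less.hyps[of a' v c'] 1 \<open>\<beta> > 0\<close> inC vC pos sum lt by (simp add: \<beta>_def D_def)
    next
      case 2
      have \<beta>c: "\<beta> * det2 b' c' \<ge> 0" using nn pos by simp
      have "D * det2 v c' < 0" using 2 nn by (simp add: mult_pos_neg)
      then have "\<alpha> * det2 c' a' > 0" using Dvc \<beta>c by linarith
      then have "\<alpha> > 0" using pos by (simp add: zero_less_mult_iff)
      have "D * det2 c' v \<le> D * det2 c' a'"
        using Dvc \<beta>c mult_right_mono[of \<alpha> D "det2 c' a'"] lt pos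
        unfolding det2_swap[of c' v] mult_minus_right by linarith
      then have "det2 c' v \<le> det2 c' a'" using nn by simp
      then show ?thesis
        using less.hyps[of v b' c'] 2 \<open>\<alpha> > 0\<close> inC vC pos sum lt det2_swap[of c' v]
        by (simp add: \<alpha>_def D_def)
    next
      case 3
      have "dot2 v c' < 0"
      proof -
        have *: "dot2 v v * det2 b' c' = - dot2 v c' * \<alpha>" "dot2 v v * det2 c' a' = - dot2 v c' * \<beta>"
          using dot2_self_det2[of v b' c'] dot2_self_det2[of v c' a'] 3 det2_swap[of v a']
          by (auto simp: \<alpha>_def \<beta>_def)
        have "dot2 v v * det2 b' c' > 0" using v pos by (simp add: dot2_self_pos)
        then have "- dot2 v c' * \<alpha> > 0" using * by simp
        then show ?thesis using nn by (auto simp: zero_less_mult_iff mult_less_0_iff)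
      qed
      then show ?thesis using convex_witness_opposite[OF C(1,2) vC inC(3) v(1) 3] by simp
    qed
  qed
  show ?case
  proof (cases "det2 a b \<ge> 2 \<or> det2 b c \<ge> 2 \<or> det2 c a \<ge> 2")
    case True
    then consider "det2 a b \<ge> 2" | "det2 b c \<ge> 2" | "det2 c a \<ge> 2" by blast
    then show ?thesis
    proof cases
      case 1
      show ?thesis by (rule step[of a b c]) (use less.prems 1 in simp_all)
    next
      case 2
      show ?thesis by (rule step[of b c a]) (use less.prems 2 in simp_all)
    next
      case 3
      show ?thesis by (rule step[of c a b]) (use less.prems 3 in simp_all)
    qed
  next
    case False
    then have 1: "det2 a b = 1" "det2 b c = 1" "det2 c a = 1" using less.prems by auto
    have "sm (det2 a b) c = sm (det2 c b) a + sm (det2 a c) b" by (rule det2_cramer)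
    then have "c = - a - b" using 1 det2_swap[of c b] det2_swap[of a c] by simp
    then have z: "a + b + c = 0" "b + c + a = 0" "c + a + b = 0" by auto
    consider "dot2 a b \<ge> 0" | "dot2 b c \<ge> 0" | "dot2 c a \<ge> 0"
      using superbase_acute[OF z(1) 1(1)] by blast
    then show ?thesis
    proof cases
      case 1
      then show ?thesis using superbase_witness[OF z(1) \<open>det2 a b = 1\<close> _ less.prems(1,2,3)] by blast
    next
      case 2
      then show ?thesis using superbase_witness[OF z(2) \<open>det2 b c = 1\<close> _ less.prems(2,3,1)] by blast
    next
      case 3
      then show ?thesis using superbase_witness[OF z(3) \<open>det2 c a = 1\<close> _ less.prems(3,1,2)] by blast
    qed
  qed
qed

section \<open>Planar triangles and affine interpolation\<close>

definition cross :: "real \<times> real \<Rightarrow> real \<times> real \<Rightarrow> real" where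
  "cross p q = fst p * snd q - snd p * fst q"

text \<open>Interpolation in barycentric coordinates, defined on the whole plane because it is
  compared with u also outside of the triangle.\<close>

definition interp :: "real \<times> real \<Rightarrow> real \<times> real \<Rightarrow> real \<times> real \<Rightarrow> real \<Rightarrow> real \<Rightarrow> real \<Rightarrow> real \<times> real \<Rightarrow> real" where
  "interp a b c \<alpha> \<beta> \<gamma> p = (cross (b - p) (c - p) * \<alpha> + cross (c - p) (a - p) * \<beta>
      + cross (a - p) (b - p) * \<gamma>) / cross (b - a) (c - a)"

lemma cross_bary_sum:
  "cross (b - p) (c - p) + cross (c - p) (a - p) + cross (a - p) (b - p) = cross (b - a) (c - a)"
  by (simp add: cross_def algebra_simps)

lemma cross_bary_point:
  "cross (b - a) (c - a) *\<^sub>R p = cross (b - p) (c - p) *\<^sub>R a + cross (c - p) (a - p) *\<^sub>R b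
      + cross (a - p) (b - p) *\<^sub>R c"
  by (simp add: cross_def prod_eq_iff algebra_simps)

lemma cross_rotate: "cross (c - b) (a - b) = cross (b - a) (c - a)"
  by (simp add: cross_def algebra_simps)

lemma cross_of_bary:
  assumes "p = r *\<^sub>R a + s *\<^sub>R b + t *\<^sub>R c" "r + s + t = 1"
  shows "cross (b - p) (c - p) = r * cross (b - a) (c - a)"
    "cross (c - p) (a - p) = s * cross (b - a) (c - a)"
    "cross (a - p) (b - p) = t * cross (b - a) (c - a)"
proof -
  have r: "r = 1 - s - t" using assms(2) by simp
  show "cross (b - p) (c - p) = r * cross (b - a) (c - a)"
    "cross (c - p) (a - p) = s * cross (b - a) (c - a)"
    "cross (a - p) (b - p) = t * cross (b - a) (c - a)"
    unfolding assms(1) r by (simp_all add: cross_def algebra_simps)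
qed

lemma interp_bary:
  assumes "cross (b - a) (c - a) \<noteq> 0" "p = r *\<^sub>R a + s *\<^sub>R b + t *\<^sub>R c" "r + s + t = 1"
  shows "interp a b c \<alpha> \<beta> \<gamma> p = r * \<alpha> + s * \<beta> + t * \<gamma>"
proof -
  have "interp a b c \<alpha> \<beta> \<gamma> p
      = (r * \<alpha> + s * \<beta> + t * \<gamma>) * cross (b - a) (c - a) / cross (b - a) (c - a)"
    unfolding interp_def cross_of_bary[OF assms(2,3)] by (simp add: algebra_simps)
  then show ?thesis using assms(1) by simp
qed

lemma interp_vertices:
  assumes "cross (b - a) (c - a) \<noteq> 0"
  shows "interp a b c \<alpha> \<beta> \<gamma> a = \<alpha>" "interp a b c \<alpha> \<beta> \<gamma> b = \<beta>" "interp a b c \<alpha> \<beta> \<gamma> c = \<gamma>"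
  using interp_bary[OF assms, of a 1 0 0] interp_bary[OF assms, of b 0 1 0]
    interp_bary[OF assms, of c 0 0 1] by auto

lemma interp_rotate: "interp b c a \<beta> \<gamma> \<alpha> = interp a b c \<alpha> \<beta> \<gamma>"
  by (rule ext) (simp add: interp_def cross_rotate add_ac)

lemma interp_affine:
  obtains A k where "\<And>p. interp a b c \<alpha> \<beta> \<gamma> p = A \<bullet> p + k"
proof -
  define D where "D = cross (b - a) (c - a)"
  define A where "A = (((snd b - snd c) * \<alpha> + (snd c - snd a) * \<beta> + (snd a - snd b) * \<gamma>) / D,
      ((fst c - fst b) * \<alpha> + (fst a - fst c) * \<beta> + (fst b - fst a) * \<gamma>) / D)"
  define k where "k = (cross b c * \<alpha> + cross c a * \<beta> + cross a b * \<gamma>) / D"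
  have "interp a b c \<alpha> \<beta> \<gamma> p = A \<bullet> p + k" for p
    unfolding A_def k_def interp_def D_def[symmetric] inner_prod_def fst_conv snd_conv inner_real_def
      times_divide_eq_left add_divide_distrib[symmetric]
    by (rule arg_cong[of _ _ "\<lambda>t. t / D"]) (simp add: cross_def algebra_simps)
  then show ?thesis using that by blast
qed

lemma triangleI:
  "p = r *\<^sub>R a + s *\<^sub>R b + t *\<^sub>R c \<Longrightarrow> r + s + t = 1 \<Longrightarrow> 0 \<le> r \<Longrightarrow> 0 \<le> s \<Longrightarrow> 0 \<le> t
    \<Longrightarrow> p \<in> convex hull {a, b, c}"
  unfolding convex_hull_3 mem_Collect_eq by (intro exI conjI; assumption)

lemma triangleE:
  assumes "p \<in> convex hull {a, b, c}"
  obtains r s t where "0 \<le> r" "0 \<le> s" "0 \<le> t" "r + s + t = 1" "p = r *\<^sub>R a + s *\<^sub>R b + t *\<^sub>R c"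
  using assms unfolding convex_hull_3 mem_Collect_eq by (elim exE conjE) (rule that)

lemma triangle_iff:
  assumes D: "cross (b - a) (c - a) > 0"
  shows "p \<in> convex hull {a, b, c} \<longleftrightarrow>
    cross (b - p) (c - p) \<ge> 0 \<and> cross (c - p) (a - p) \<ge> 0 \<and> cross (a - p) (b - p) \<ge> 0"
proof
  assume "p \<in> convex hull {a, b, c}"
  then obtain r s t where rst: "0 \<le> r" "0 \<le> s" "0 \<le> t" "r + s + t = 1"
    and p: "p = r *\<^sub>R a + s *\<^sub>R b + t *\<^sub>R c"
    by (rule triangleE)
  show "cross (b - p) (c - p) \<ge> 0 \<and> cross (c - p) (a - p) \<ge> 0 \<and> cross (a - p) (b - p) \<ge> 0"
    unfolding cross_of_bary[OF p rst(4)] using D rst by simp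
next
  assume nn: "cross (b - p) (c - p) \<ge> 0 \<and> cross (c - p) (a - p) \<ge> 0 \<and> cross (a - p) (b - p) \<ge> 0"
  define D where "D = cross (b - a) (c - a)"
  have D0: "D > 0" using D by (simp add: D_def)
  have "D *\<^sub>R p = cross (b - p) (c - p) *\<^sub>R a + cross (c - p) (a - p) *\<^sub>R b
      + cross (a - p) (b - p) *\<^sub>R c"
    unfolding D_def by (rule cross_bary_point)
  from arg_cong[OF this, of "\<lambda>q. (1 / D) *\<^sub>R q"]
  have "p = (cross (b - p) (c - p) / D) *\<^sub>R a + (cross (c - p) (a - p) / D) *\<^sub>R b
      + (cross (a - p) (b - p) / D) *\<^sub>R c"
    using D0 by (simp add: scaleR_add_right)
  moreover have "cross (b - p) (c - p) / D + cross (c - p) (a - p) / D + cross (a - p) (b - p) / D = 1"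
    using D cross_bary_sum[of b p c a] by (simp add: D_def add_divide_distrib[symmetric])
  ultimately show "p \<in> convex hull {a, b, c}"
    by (rule triangleI) (use nn D in \<open>auto simp: D_def\<close>)
qed

text \<open>The point w lies below the graph of the interpolant on the triangle a, b, c. Moving from
  p away from w, the ray leaves the triangle on the side opposite to a; replacing a by w
  thus yields a triangle containing p with a lower interpolated value.\<close>

lemma interp_replace_vertex:
  assumes D: "cross (b - a) (c - a) > 0"
    and p: "cross (b - p) (c - p) > 0" "cross (c - p) (a - p) > 0" "cross (a - p) (b - p) > 0"
    and w: "cross (b - w) (c - w) > 0"
      "cross (b - p) (c - p) * cross (c - w) (a - w) \<le> cross (c - p) (a - p) * cross (b - w) (c - w)"
      "cross (b - p) (c - p) * cross (a - w) (b - w) \<le> cross (a - p) (b - p) * cross (b - w) (c - w)"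
    and below: "\<delta> < interp a b c \<alpha> \<beta> \<gamma> w"
  shows "p \<in> convex hull {w, b, c} \<and> interp w b c \<delta> \<beta> \<gamma> p < interp a b c \<alpha> \<beta> \<gamma> p"
proof -
  define D where "D = cross (b - a) (c - a)"
  define r s t where "r = cross (b - p) (c - p)" and "s = cross (c - p) (a - p)" and "t = cross (a - p) (b - p)"
  define l m n where "l = cross (b - w) (c - w)" and "m = cross (c - w) (a - w)" and "n = cross (a - w) (b - w)"
  have Dp: "D > 0" "r > 0" "l > 0" using assms by (auto simp: D_def r_def l_def)
  have sums: "r + s + t = D" "l + m + n = D"
    unfolding D_def r_def s_def t_def l_def m_def n_def by (rule cross_bary_sum)+
  have le: "r * m \<le> s * l" "r * n \<le> t * l"
    using w unfolding r_def s_def t_def l_def m_def n_def by auto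
  \<comment> \<open>Barycentric coordinates of p in w, b, c, found by eliminating a between
    \<open>D *\<^sub>R p\<close> and \<open>D *\<^sub>R w\<close>.\<close>
  define r' s' t' where "r' = r / l" and "s' = (s * l - r * m) / (D * l)" and "t' = (t * l - r * n) / (D * l)"
  have nn: "r' > 0" "s' \<ge> 0" "t' \<ge> 0" using Dp le by (auto simp: r'_def s'_def t'_def)
  have "r * D + (s * l - r * m) + (t * l - r * n) = D * l"
  proof -
    have s: "s = D - r - t" and m: "m = D - l - n" using sums by auto
    show ?thesis unfolding s m by (simp add: algebra_simps)
  qed
  then have one: "(r * D + (s * l - r * m) + (t * l - r * n)) / (D * l) = 1" using Dp by simp
  have r': "r' = r * D / (D * l)" using Dp by (simp add: r'_def)
  have "r' + s' + t' = (r * D + (s * l - r * m) + (t * l - r * n)) / (D * l)"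
    unfolding r' s'_def t'_def by (simp only: add_divide_distrib)
  from trans[OF this one] have sum1: "r' + s' + t' = 1" .
  have dp: "D *\<^sub>R p = r *\<^sub>R a + s *\<^sub>R b + t *\<^sub>R c"
    unfolding D_def r_def s_def t_def by (rule cross_bary_point)
  have dw: "D *\<^sub>R w = l *\<^sub>R a + m *\<^sub>R b + n *\<^sub>R c"
    unfolding D_def l_def m_def n_def by (rule cross_bary_point)
  have coefs: "D * l * r' = r * D" "D * l * s' = s * l - r * m" "D * l * t' = t * l - r * n"
    using Dp by (simp_all add: r'_def s'_def t'_def)
  have "(D * l) *\<^sub>R (r' *\<^sub>R w + s' *\<^sub>R b + t' *\<^sub>R c)
      = r *\<^sub>R (D *\<^sub>R w) + (s * l - r * m) *\<^sub>R b + (t * l - r * n) *\<^sub>R c"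
    by (simp only: scaleR_add_right scaleR_scaleR coefs)
  also have "\<dots> = l *\<^sub>R (D *\<^sub>R p)"
    unfolding dp dw by (simp add: algebra_simps)
  also have "\<dots> = (D * l) *\<^sub>R p" by (simp add: mult.commute)
  finally have pw: "p = r' *\<^sub>R w + s' *\<^sub>R b + t' *\<^sub>R c"
    using Dp by simp
  obtain A k where Ak: "\<And>q. interp a b c \<alpha> \<beta> \<gamma> q = A \<bullet> q + k" using interp_affine by blast
  have v: "A \<bullet> b + k = \<beta>" "A \<bullet> c + k = \<gamma>"
    using interp_vertices(2,3)[of b a c \<alpha> \<beta> \<gamma>] D unfolding Ak by simp_all
  have "interp w b c \<delta> \<beta> \<gamma> p = r' * \<delta> + s' * \<beta> + t' * \<gamma>"
    by (rule interp_bary[OF _ pw sum1]) (use w(1) in simp)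
  also have "\<dots> < r' * (A \<bullet> w + k) + s' * \<beta> + t' * \<gamma>"
    using below nn Ak by simp
  also have "\<dots> = r' * (A \<bullet> w) + s' * (A \<bullet> b) + t' * (A \<bullet> c) + (r' + s' + t') * k"
    unfolding v[symmetric] by (simp add: algebra_simps)
  also have "\<dots> = A \<bullet> p + k"
    unfolding sum1 by (simp add: pw inner_add_right)
  finally have "interp w b c \<delta> \<beta> \<gamma> p < interp a b c \<alpha> \<beta> \<gamma> p" by (simp add: Ak)
  moreover have "p \<in> convex hull {w, b, c}"
    by (rule triangleI[OF pw sum1]) (use nn in auto)
  ultimately show ?thesis by simp
qed

text \<open>The vertex to be replaced is one where the ratio of the coordinates of w to those of p
  is greatest. This ratio is positive since the coordinates of w have a positive sum.\<close>

lemma max_ratio: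
  fixes r s t l m n :: real
  assumes "r > 0" "s > 0" "t > 0" "l + m + n > 0"
  shows "(l > 0 \<and> r * m \<le> s * l \<and> r * n \<le> t * l) \<or> (m > 0 \<and> s * n \<le> t * m \<and> s * l \<le> r * m)
    \<or> (n > 0 \<and> t * l \<le> r * n \<and> t * m \<le> s * n)"
proof -
  define l' m' n' where "l' = l / r" and "m' = m / s" and "n' = n / t"
  have lmn: "l = l' * r" "m = m' * s" "n = n' * t" using assms by (auto simp: l'_def m'_def n'_def)
  have le: "x * (y' * y) \<le> y * (x' * x)" if "y' \<le> x'" "x > 0" "y > 0" for x y x' y' :: real
    using mult_right_mono[OF that(1), of "x * y"] that by (simp add: mult_ac)
  have "l' > 0 \<or> m' > 0 \<or> n' > 0"
    using assms unfolding lmn by (smt (verit) mult_nonneg_nonneg mult_minus_left)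
  then consider "l' > 0" "m' \<le> l'" "n' \<le> l'" | "m' > 0" "l' \<le> m'" "n' \<le> m'" | "n' > 0" "l' \<le> n'" "m' \<le> n'"
    by linarith
  then show ?thesis unfolding lmn using assms le by cases simp_all
qed

lemma cross_swap: "cross p q = - cross q p"
  by (simp add: cross_def)

text \<open>Caratheodory leaves at most three points. Were they collinear, p would be on a line
  through two points of P, or equal to a point of P and so on its line to another one.\<close>

lemma triangle_avoiding_lines:
  assumes p: "p \<in> convex hull P" and off: "\<And>x y. x \<in> P \<Longrightarrow> y \<in> P \<Longrightarrow> x \<noteq> y \<Longrightarrow> cross (x - p) (y - p) \<noteq> 0"
    and P: "interior (convex hull P) \<noteq> {}"
  obtains a b c where "a \<in> P" "b \<in> P" "c \<in> P" "cross (b - a) (c - a) > 0" "p \<in> convex hull {a, b, c}"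
proof -
  obtain S where S: "finite S" "S \<subseteq> P" "card S \<le> 3" "p \<in> convex hull S"
    using p caratheodory[of P] by auto
  have "card S \<noteq> 0" using S by auto
  then consider "card S = 1" | "card S = 2" | "card S = 3" using S(3) by linarith
  then have "\<exists>a b c. S = {a, b, c}"
  proof cases
    case 1
    then show ?thesis by (metis card_1_singletonE insert_absorb2)
  next
    case 2
    then show ?thesis by (metis card_2_iff insert_absorb2)
  next
    case 3
    then show ?thesis by (metis card_3_iff)
  qed
  then obtain a b c where abc: "S = {a, b, c}" by blast
  then have inP: "a \<in> P" "b \<in> P" "c \<in> P" using S by auto
  obtain r s t where rst: "r + s + t = 1" "p = r *\<^sub>R a + s *\<^sub>R b + t *\<^sub>R c"
    using S(4) unfolding abc by (rule triangleE)
  note bary = cross_of_bary[OF rst(2,1)]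
  have "cross (b - a) (c - a) \<noteq> 0"
  proof
    assume D: "cross (b - a) (c - a) = 0"
    then have "cross (a - p) (b - p) = 0" "cross (b - p) (c - p) = 0" unfolding bary by simp_all
    then have "a = b" "b = c" using off inP by blast+
    then have "p = a" using rst by (simp add: scaleR_left_distrib[symmetric])
    moreover have "P \<noteq> {a}" using P by auto
    then obtain y where "y \<in> P" "y \<noteq> a" using inP(1) by blast
    ultimately show False using off[OF inP(1) \<open>y \<in> P\<close>] by (simp add: cross_def)
  qed
  then consider "cross (b - a) (c - a) > 0" | "cross (c - a) (b - a) > 0"
    using cross_swap[of "b - a" "c - a"] by linarith
  then show ?thesis
    using that inP S(4) unfolding abc by cases (auto simp: insert_commute)
qed

text \<open>Among all triangles with vertices in P containing p, one with the lowest interpolated value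
  at p supports u from below.\<close>

lemma supporting_triangle:
  assumes fin: "finite P" and p: "p \<in> convex hull P"
    and off: "\<And>x y. x \<in> P \<Longrightarrow> y \<in> P \<Longrightarrow> x \<noteq> y \<Longrightarrow> cross (x - p) (y - p) \<noteq> 0"
    and P: "interior (convex hull P) \<noteq> {}"
  obtains a b c where "a \<in> P" "b \<in> P" "c \<in> P" "cross (b - a) (c - a) > 0" "p \<in> convex hull {a, b, c}"
    "\<And>w. w \<in> P \<Longrightarrow> interp a b c (u a) (u b) (u c) w \<le> u w"
proof -
  define Q where "Q = {(a, b, c). a \<in> P \<and> b \<in> P \<and> c \<in> P \<and> cross (b - a) (c - a) > 0 \<and> p \<in> convex hull {a, b, c}}"
  define val where "val = (\<lambda>(a, b, c). interp a b c (u a) (u b) (u c) p)"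
  have "Q \<subseteq> P \<times> P \<times> P" by (auto simp: Q_def)
  then have "finite Q" by (rule finite_subset) (use fin in simp)
  moreover obtain a0 b0 c0 where "a0 \<in> P" "b0 \<in> P" "c0 \<in> P" "cross (b0 - a0) (c0 - a0) > 0"
      "p \<in> convex hull {a0, b0, c0}"
    by (rule triangle_avoiding_lines[OF p off P])
  then have "(a0, b0, c0) \<in> Q" by (simp add: Q_def)
  then have "Q \<noteq> {}" by blast
  ultimately obtain \<tau> where \<tau>: "\<tau> \<in> Q" "\<And>\<sigma>. \<sigma> \<in> Q \<Longrightarrow> val \<tau> \<le> val \<sigma>"
    using arg_min_if_finite(1)[of Q val] arg_min_least[of Q _ val] by blast
  obtain a b c where abc: "\<tau> = (a, b, c)" by (cases \<tau>)
  have Q: "a \<in> P" "b \<in> P" "c \<in> P" "cross (b - a) (c - a) > 0" "p \<in> convex hull {a, b, c}"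
    using \<tau>(1) by (auto simp: Q_def abc)
  have key: False
    if abc': "(a', b', c') \<in> Q" "val (a', b', c') = val \<tau>" and w: "w \<in> P"
      and below: "u w < interp a' b' c' (u a') (u b') (u c') w"
      and pos: "cross (b' - p) (c' - p) > 0" "cross (c' - p) (a' - p) > 0" "cross (a' - p) (b' - p) > 0"
      and rat: "cross (b' - w) (c' - w) > 0"
        "cross (b' - p) (c' - p) * cross (c' - w) (a' - w) \<le> cross (c' - p) (a' - p) * cross (b' - w) (c' - w)"
        "cross (b' - p) (c' - p) * cross (a' - w) (b' - w) \<le> cross (a' - p) (b' - p) * cross (b' - w) (c' - w)"
    for a' b' c' w
  proof -
    have Q': "b' \<in> P" "c' \<in> P" "cross (b' - a') (c' - a') > 0" using abc'(1) by (auto simp: Q_def)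
    note r = interp_replace_vertex[OF Q'(3) pos rat below]
    then have "(w, b', c') \<in> Q" using w Q' rat by (simp add: Q_def)
    then have "val \<tau> \<le> val (w, b', c')" by (rule \<tau>(2))
    then show False using r abc'(2) by (simp add: val_def)
  qed
  have nz: "a \<noteq> b" "b \<noteq> c" "c \<noteq> a" using Q(4) by (auto simp: cross_def)
  then have pos: "cross (b - p) (c - p) > 0" "cross (c - p) (a - p) > 0" "cross (a - p) (b - p) > 0"
    using Q(5) off[OF Q(1,2)] off[OF Q(2,3)] off[OF Q(3,1)] unfolding triangle_iff[OF Q(4)] by auto
  \<comment> \<open>Cyclic rotation allows the replaced vertex to be the first one.\<close>
  have "{b, c, a} = {a, b, c}" "{c, a, b} = {a, b, c}" by auto
  then have rot: "(b, c, a) \<in> Q" "(c, a, b) \<in> Q"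
    using Q cross_rotate[of c b a] cross_rotate[of a c b] by (auto simp: Q_def)
  have rotv: "val (b, c, a) = val \<tau>" "val (c, a, b) = val \<tau>"
    by (auto simp: val_def abc interp_rotate)
  have "interp a b c (u a) (u b) (u c) w \<le> u w" if w: "w \<in> P" for w
  proof (rule ccontr)
    assume "\<not> ?thesis"
    then have below: "u w < interp a b c (u a) (u b) (u c) w" by simp
    have "cross (b - w) (c - w) + cross (c - w) (a - w) + cross (a - w) (b - w) > 0"
      using Q(4) cross_bary_sum[of b w c a] by simp
    from max_ratio[OF pos this] show False
    proof (elim disjE conjE, goal_cases)
      case 1
      show False by (rule key[of a b c w]) (use 1 \<tau>(1) abc w pos below in \<open>simp_all\<close>)
    next
      case 2
      show False by (rule key[OF rot(1) rotv(1) w]) (use 2 pos below in \<open>simp_all add: interp_rotate\<close>)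
    next
      case 3
      show False by (rule key[OF rot(2) rotv(2) w]) (use 3 pos below in \<open>simp_all add: interp_rotate\<close>)
    qed
  qed
  then show ?thesis using that Q by blast
qed

lemma negligible_line:
  assumes "x \<noteq> y"
  shows "negligible {p. cross (x - p) (y - p) = 0}"
proof -
  have "{p. cross (x - p) (y - p) = 0} = {p. (snd x - snd y, fst y - fst x) \<bullet> p = - cross x y}"
    by (auto simp: cross_def inner_prod_def algebra_simps)
  moreover have "(snd x - snd y, fst y - fst x) \<noteq> 0" using assms by (auto simp: prod_eq_iff)
  ultimately show ?thesis using negligible_hyperplane by metis
qed

text \<open>The part of the interior missed by U is open and negligible, hence empty; closedness
  does the rest. This passes from points in general position to all points of the hull.\<close>

lemma subset_closed_if_off_negligible:
  fixes C :: "'a :: euclidean_space set"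
  assumes C: "convex C" "interior C \<noteq> {}" and B: "negligible B" and U: "closed U" "C - B \<subseteq> U"
  shows "C \<subseteq> U"
proof -
  have "interior C \<subseteq> U"
  proof (rule ccontr)
    assume "\<not> interior C \<subseteq> U"
    then have ne: "interior C - U \<noteq> {}" by blast
    have "interior C - U \<subseteq> B" using U(2) interior_subset by blast
    then have "negligible (interior C - U)" using B negligible_subset by blast
    moreover have "open (interior C - U)" using U(1) by (simp add: open_Diff)
    ultimately show False using ne open_not_negligible by blast
  qed
  then have "closure (interior C) \<subseteq> U" using U(1) by (simp add: closure_minimal)
  then show ?thesis using convex_closure_interior[OF C] closure_subset by blast
qed

section \<open>Supporting triangles\<close>

lemma cross_emb: "cross (emb a) (emb b) = of_int (det2 a b)"
  by (simp add: cross_def emb_def det2_def)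

lemma cross_emb_diff: "cross (emb a - emb p) (emb b - emb p) = of_int (det2 (a - p) (b - p))"
  by (simp only: emb_simps(2)[symmetric] cross_emb)

lemma collinear_cross: "collinear {a, b, c} \<longleftrightarrow> cross (b - a) (c - a) = 0"
proof -
  have "collinear {a, b, c} \<longleftrightarrow> collinear {0, b - a, c - a}"
    using collinear_3[of b a c] by (simp add: insert_commute)
  also have "\<dots> \<longleftrightarrow> cross (b - a) (c - a) = 0"
  proof
    assume "collinear {0, b - a, c - a}"
    then consider "b - a = 0" | k where "c - a = k *\<^sub>R (b - a)"
      using collinear_lemma[of "b - a" "c - a"] by (metis scaleR_zero_left)
    then show "cross (b - a) (c - a) = 0" by cases (simp_all add: cross_def)
  next
    assume 0: "cross (b - a) (c - a) = 0"
    define v w where "v = b - a" and "w = c - a"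
    have vw: "fst v * snd w = snd v * fst w" using 0 by (simp add: cross_def v_def w_def)
    have "collinear {0, v, w}"
    proof (cases "v = 0")
      case False
      then have "fst v \<noteq> 0 \<or> snd v \<noteq> 0" by (auto simp: prod_eq_iff)
      then have "w = (if fst v \<noteq> 0 then fst w / fst v else snd w / snd v) *\<^sub>R v"
        using vw by (auto simp: prod_eq_iff field_simps)
      then show ?thesis using collinear_lemma by blast
    qed simp
    then show "collinear {0, b - a, c - a}" by (simp add: v_def w_def)
  qed
  finally show ?thesis .
qed

lemma affine_independent_cross:
  "\<not> affine_dependent {a, b, c} \<and> card {a, b, c} = 3 \<longleftrightarrow> cross (b - a) (c - a) \<noteq> 0"
proof
  assume "\<not> affine_dependent {a, b, c} \<and> card {a, b, c} = 3"
  then show "cross (b - a) (c - a) \<noteq> 0"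
    unfolding collinear_cross[symmetric] collinear_3_eq_affine_dependent by (auto simp: card_insert_if split: if_splits)
next
  assume "cross (b - a) (c - a) \<noteq> 0"
  then show "\<not> affine_dependent {a, b, c} \<and> card {a, b, c} = 3"
    unfolding collinear_cross[symmetric] collinear_3_eq_affine_dependent by auto
qed

lemma edge_endpoints:
  assumes "closed_segment p q edge_of T"
  shows "p extreme_point_of T" "q extreme_point_of T" "p \<noteq> q"
proof -
  have F: "closed_segment p q face_of T" "aff_dim (closed_segment p q) = 1"
    using assms by (auto simp: edge_of_def)
  show "p \<noteq> q" using F(2) by auto
  have "p extreme_point_of closed_segment p q" "q extreme_point_of closed_segment p q"
    by (auto simp: extreme_point_of_segment)
  then show "p extreme_point_of T" "q extreme_point_of T"
    using extreme_point_of_face[OF F(1)] by auto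
qed

text \<open>Points of weight 0 may lie outside of C; they are replaced by some q in C, which exists
  because a weight is positive.\<close>

lemma in_convex_if_support:
  assumes C: "convex C" and "0 \<le> r" "0 \<le> s" "0 \<le> t" "r + s + t = (1 :: real)"
    and "r > 0 \<Longrightarrow> a \<in> C" "s > 0 \<Longrightarrow> b \<in> C" "t > 0 \<Longrightarrow> c \<in> C"
  shows "r *\<^sub>R a + s *\<^sub>R b + t *\<^sub>R c \<in> C"
proof -
  obtain q where q: "q \<in> C" using assms by (metis add.right_neutral less_eq_real_def zero_neq_one)
  define a' b' c' where "a' = (if r > 0 then a else q)" and "b' = (if s > 0 then b else q)"
    and "c' = (if t > 0 then c else q)"
  have "r *\<^sub>R a' + s *\<^sub>R b' + t *\<^sub>R c' + 0 *\<^sub>R q \<in> C"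
    by (rule convex4[OF C]) (use assms q in \<open>auto simp: a'_def b'_def c'_def\<close>)
  moreover have "r *\<^sub>R a' = r *\<^sub>R a" "s *\<^sub>R b' = s *\<^sub>R b" "t *\<^sub>R c' = t *\<^sub>R c"
    using assms by (auto simp: a'_def b'_def c'_def)
  ultimately show ?thesis by simp
qed

text \<open>Pairing the relation with b and with c, a nonnegative product would annihilate both
  square terms, against m + n > 0.\<close>

lemma edge_vector_dot_neg:
  assumes "sm m b + sm n c = 0" "m \<ge> 0" "n \<ge> 0" "m + n > 0" "b \<noteq> 0" "c \<noteq> 0"
  shows "dot2 b c < 0"
proof -
  have 1: "m * dot2 b b + n * dot2 b c = 0"
    using arg_cong[OF assms(1), of "dot2 b"] by (simp add: dot2_def[of _ 0])
  have 2: "m * dot2 b c + n * dot2 c c = 0"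
    using arg_cong[OF assms(1), of "dot2 c"] dot2_commute[of c b] by (simp add: dot2_def[of _ 0])
  have pos: "dot2 b b > 0" "dot2 c c > 0" using assms by (simp_all add: dot2_self_pos)
  show ?thesis
  proof (rule ccontr)
    assume "\<not> ?thesis"
    then have nn: "m * dot2 b b \<ge> 0" "n * dot2 b c \<ge> 0" "m * dot2 b c \<ge> 0" "n * dot2 c c \<ge> 0"
      using assms pos by auto
    then have "m * dot2 b b = 0" "n * dot2 c c = 0" using 1 2 by linarith+
    then show False using pos assms(4) by auto
  qed
qed

text \<open>Seen from w, the vertices have nonnegative determinants. If all are positive, w is
  interior; if one vanishes, w is inside an edge and the ends of that edge are opposite.\<close>

lemma convex_witness_triangle:
  assumes D: "det2 (y - x) (z - x) > 0" and w: "emb w \<in> convex hull {emb x, emb y, emb z}"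
    and ne: "w \<noteq> x" "w \<noteq> y" "w \<noteq> z"
  shows "convex_witness (convex hull {emb x, emb y, emb z}) w"
proof -
  define C where "C = convex hull {emb x, emb y, emb z}"
  define a b c where "a = x - w" and "b = y - w" and "c = z - w"
  have C: "convex C" "emb w \<in> C" using w by (auto simp: C_def)
  have inC: "emb (w + a) \<in> C" "emb (w + b) \<in> C" "emb (w + c) \<in> C"
    by (auto simp: C_def a_def b_def c_def hull_inc simp del: emb_simps)
  have D': "cross (emb y - emb x) (emb z - emb x) > 0" using D by (simp add: cross_emb_diff)
  have nn: "det2 b c \<ge> 0" "det2 c a \<ge> 0" "det2 a b \<ge> 0"
    using w unfolding triangle_iff[OF D'] cross_emb_diff a_def b_def c_def by auto
  have "det2 b c + det2 c a + det2 a b = det2 (y - x) (z - x)"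
    by (simp add: a_def b_def c_def det2_def algebra_simps)
  then have sum: "det2 b c + det2 c a + det2 a b > 0" using D by simp
  have nz: "a \<noteq> 0" "b \<noteq> 0" "c \<noteq> 0" using ne by (auto simp: a_def b_def c_def)
  have rel: "sm (det2 b c) a + sm (det2 c a) b + sm (det2 a b) c = 0"
    by (simp add: sm_def det2_def prod_eq_iff algebra_simps)
  have edge: "convex_witness C w"
    if "det2 b' c' = 0" "sm m b' + sm n c' = 0" "m \<ge> 0" "n \<ge> 0" "m + n > 0"
      "emb (w + b') \<in> C" "emb (w + c') \<in> C" "b' \<noteq> 0" "c' \<noteq> 0" for b' c' m n
    using convex_witness_opposite[OF C that(6,7,8,1)] edge_vector_dot_neg[OF that(2-5,8,9)] by blast
  consider "det2 b c > 0" "det2 c a > 0" "det2 a b > 0" | "det2 b c = 0" | "det2 c a = 0" | "det2 a b = 0"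
    using nn by linarith
  then have "convex_witness C w"
  proof cases
    case 1
    then show ?thesis using convex_witness_interior[OF C inC] by blast
  next
    case 2
    show ?thesis by (rule edge[of b c "det2 c a" "det2 a b"]) (use 2 rel nn sum inC nz in auto)
  next
    case 3
    show ?thesis by (rule edge[of c a "det2 a b" "det2 b c"]) (use 3 rel nn sum inC nz in \<open>auto simp: add.commute\<close>)
  next
    case 4
    show ?thesis by (rule edge[of a b "det2 b c" "det2 c a"]) (use 4 rel nn sum inC nz in auto)
  qed
  then show ?thesis by (simp add: C_def)
qed

context lattice_stencils
begin

text \<open>A triangle in a lower face of the convex hull of the graph of u, with the affine
  function of that face. A face with more than three touching points contains several such
  triangles.\<close>

definition supports :: "(ivec \<Rightarrow> real) \<Rightarrow> ivec \<Rightarrow> ivec \<Rightarrow> ivec \<Rightarrow> real \<times> real \<Rightarrow> real \<Rightarrow> bool" where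
  "supports u x y z A k \<longleftrightarrow> x \<in> X \<and> y \<in> X \<and> z \<in> X \<and> det2 (y - x) (z - x) > 0 \<and>
     (\<forall>w\<in>X. A \<bullet> emb w + k \<le> u w) \<and>
     A \<bullet> emb x + k = u x \<and> A \<bullet> emb y + k = u y \<and> A \<bullet> emb z + k = u z"

lemma supports_rotate: "supports u x y z A k \<Longrightarrow> supports u y z x A k"
proof -
  have "det2 (z - y) (x - y) = det2 (y - x) (z - x)" by (simp add: det2_def algebra_simps)
  then show "supports u x y z A k \<Longrightarrow> supports u y z x A k" by (simp add: supports_def)
qed

lemma supports_subset: "supports u x y z A k \<Longrightarrow> convex hull {emb x, emb y, emb z} \<subseteq> hull_of X"
  unfolding hull_of_def supports_def by (intro hull_mono) auto

text \<open>A maximum principle: at a lattice point of the triangle other than a vertex where u exceeds the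
  supporting affine function most, one of the forms S, T would be nonpositive.\<close>

lemma no_lattice_points_in_supporting_triangle:
  assumes u: "strict u" and s: "supports u x y z A k"
    and w: "emb w \<in> convex hull {emb x, emb y, emb z}"
  shows "w = x \<or> w = y \<or> w = z"
proof (rule ccontr)
  assume ne: "\<not> ?thesis"
  define C where "C = convex hull {emb x, emb y, emb z}"
  define v where "v p = u p - (A \<bullet> emb p + k)" for p
  define N where "N = {p \<in> X. emb p \<in> C} - {x, y, z}"
  have inX: "p \<in> X" if "emb p \<in> C" for p
    using that supports_subset[OF s] hull_X unfolding C_def by blast
  have "w \<in> N" using inX[of w] w ne by (simp add: N_def C_def)
  then have "finite N" "N \<noteq> {}" using finite_X by (auto simp: N_def)
  then obtain p where p: "p \<in> N" "\<And>q. q \<in> N \<Longrightarrow> v q \<le> v p"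
    using Max_in[of "v ` N"] Max_ge[of "v ` N"] by fastforce
  \<comment> \<open>The excess v vanishes at the vertices and is nonnegative elsewhere, so p is
    maximal among all lattice points of C.\<close>
  have le: "v q \<le> v p" if "emb q \<in> C" for q
  proof (cases "q \<in> {x, y, z}")
    case True
    then have "v q = 0" using s by (auto simp: supports_def v_def)
    also have "\<dots> \<le> v p" using s p(1) by (auto simp: supports_def v_def N_def)
    finally show ?thesis .
  next
    case False
    then show ?thesis using p(2)[of q] that inX by (auto simp: N_def)
  qed
  have pX: "p \<in> X" using p by (simp add: N_def)
  have "convex_witness C p"
    using convex_witness_triangle[of y x z p] s p(1) by (auto simp: supports_def N_def C_def)
  then consider e where "irred e" "emb (p + e) \<in> C" "emb (p - e) \<in> C"
    | e f g where "parents e f g" "emb (p + e) \<in> C" "emb (p - f) \<in> C" "emb (p - g) \<in> C"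
    unfolding convex_witness_def by blast
  then show False
  proof cases
    case 1
    have "S_form u p e > 0" by (rule S_form_pos[OF u 1(1) pX inX[OF 1(2)] inX[OF 1(3)]])
    also have "S_form u p e = v (p + e) + v (p - e) - 2 * v p"
      by (simp add: S_form_def v_def inner_add_right inner_diff_right)
    finally show False using le[OF 1(2)] le[OF 1(3)] by simp
  next
    case 2
    have "e = f + g" using 2(1) by (simp add: parents_iff)
    have "T_form u p e f g > 0" by (rule T_form_pos[OF u pX inX[OF 2(2)] inX[OF 2(3)] inX[OF 2(4)] 2(1)])
    also have "T_form u p e f g = v (p + e) + v (p - f) + v (p - g) - 3 * v p"
      unfolding \<open>e = f + g\<close> by (simp add: T_form_def v_def inner_add_right inner_diff_right)
    finally show False using le[OF 2(2)] le[OF 2(3)] le[OF 2(4)] by simp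
  qed
qed

lemma empty_triangle_unimodular:
  assumes D: "det2 (y - x) (z - x) > 0"
    and empty: "\<And>w. emb w \<in> convex hull {emb x, emb y, emb z} \<Longrightarrow> w = x \<or> w = y \<or> w = z"
  shows "det2 (y - x) (z - x) = 1"
proof (rule ccontr)
  assume "det2 (y - x) (z - x) \<noteq> 1"
  then have "det2 (y - x) (z - x) \<ge> 2" using D by simp
  then obtain v where v: "v \<noteq> 0" "v \<noteq> y - x" "v \<noteq> z - x" "in_triangle (y - x) (z - x) v"
    by (rule lattice_point_in_triangle)
  have "emb (x + v) \<in> convex hull {emb x, emb y, emb z}"
    by (rule in_triangle_convex[OF convex_convex_hull _ _ _ D v(4)]) (auto intro: hull_inc simp del: emb_simps)
  then show False using empty[of "x + v"] v by (auto simp: algebra_simps)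
qed

lemma supporting_triangle_unimodular:
  assumes "strict u" "supports u x y z A k"
  shows "det2 (y - x) (z - x) = 1"
  using empty_triangle_unimodular[of y x z] no_lattice_points_in_supporting_triangle[OF assms] assms(2)
  by (auto simp: supports_def)

text \<open>Supporting triangles of a strict function are unimodular, so a fourth touching point
  would complete one of them to a unimodular parallelogram; these are the degeneracies to
  exclude.\<close>

definition generic :: "(ivec \<Rightarrow> real) \<Rightarrow> bool" where
  "generic u \<longleftrightarrow> (\<forall>x f g. det2 f g = 1 \<and> {x, x + f, x + g, x + (f + g)} \<subseteq> X \<longrightarrow> P_form u x (f + g) f g \<noteq> 0)"

lemma no_flat_parallelogram:
  assumes u: "strict u" "generic u" and s: "supports u x y z A k"
    and w: "w \<in> X" "A \<bullet> emb w + k = u w" "w = y + z - x"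
  shows False
proof -
  have d: "det2 (y - x) (z - x) = 1" by (rule supporting_triangle_unimodular[OF u(1) s])
  have "P_form u x ((y - x) + (z - x)) (y - x) (z - x) = u w - u y - u z + u x"
    by (simp add: P_form_def w(3) algebra_simps)
  also have "\<dots> = 0"
  proof -
    have "A \<bullet> emb w = A \<bullet> emb y + A \<bullet> emb z - A \<bullet> emb x"
      by (simp add: w(3) inner_add_right inner_diff_right)
    then show ?thesis using s w(2) unfolding supports_def by linarith
  qed
  finally have "P_form u x ((y - x) + (z - x)) (y - x) (z - x) = 0" .
  moreover have "x + ((y - x) + (z - x)) = w" by (simp add: w(3))
  then have "{x, x + (y - x), x + (z - x), x + ((y - x) + (z - x))} \<subseteq> X"
    using s w(1) by (simp add: supports_def)
  ultimately show False using u(2) d unfolding generic_def by blast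
qed

text \<open>Any three noncollinear touching points span a unimodular triangle. Hence p, q and 1 - p
  - q, the coordinates of w, are all in {-1, 0, 1}, which leaves the three vertices and the three
  completions to a parallelogram.\<close>

lemma supporting_function_touches_vertices:
  assumes u: "strict u" "generic u" and s: "supports u x y z A k"
    and w: "w \<in> X" "A \<bullet> emb w + k = u w"
  shows "w = x \<or> w = y \<or> w = z"
proof -
  define a b v where "a = y - x" and "b = z - x" and "v = w - x"
  define p q where "p = det2 v b" and "q = det2 a v"
  have d: "det2 a b = 1" unfolding a_def b_def by (rule supporting_triangle_unimodular[OF u(1) s])
  have v: "v = sm p a + sm q b" unfolding p_def q_def by (rule basis_coords[OF d])
  have un: "det2 (y' - x') (z' - x') \<in> {-1, 0, 1}" if "{x', y', z'} \<subseteq> {x, y, z, w}" for x' y' z'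
  proof -
    have *: "x' \<in> X \<and> A \<bullet> emb x' + k = u x'" "y' \<in> X \<and> A \<bullet> emb y' + k = u y'"
      "z' \<in> X \<and> A \<bullet> emb z' + k = u z'" "\<forall>w\<in>X. A \<bullet> emb w + k \<le> u w"
      using s w that unfolding supports_def by auto
    have "supports u x' y' z' A k" if "det2 (y' - x') (z' - x') > 0"
      using * that by (simp add: supports_def)
    moreover have "supports u x' z' y' A k" if "det2 (z' - x') (y' - x') > 0"
      using * that by (simp add: supports_def)
    ultimately show ?thesis
      using supporting_triangle_unimodular[OF u(1)] det2_swap[of "y' - x'" "z' - x'"]
      by (metis equal_neg_zero insert_iff linorder_neqE_linordered_idom neg_0_less_iff_less minus_minus)
  qed
  have p: "p \<in> {-1, 0, 1}" unfolding p_def v_def b_def by (rule un) simp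
  have q: "q \<in> {-1, 0, 1}" unfolding q_def a_def v_def by (rule un) simp
  have "det2 (y - w) (z - w) \<in> {-1, 0, 1}" by (rule un) simp
  moreover have "det2 (y - w) (z - w) = 1 - p - q"
  proof -
    have "y - w = a - v" "z - w = b - v" by (auto simp: a_def b_def v_def)
    then show ?thesis using d by (simp add: p_def q_def)
  qed
  ultimately have r: "1 - p - q \<in> {-1, 0, 1}" by (simp only:)
  note flat = no_flat_parallelogram[OF u s w] no_flat_parallelogram[OF u supports_rotate[OF s] w]
    no_flat_parallelogram[OF u supports_rotate[OF supports_rotate[OF s]] w]
  consider "p = 0" "q = 0" | "p = 1" "q = 0" | "p = 0" "q = 1" | "p = 1" "q = 1" | "p = 1" "q = -1" | "p = -1" "q = 1"
    using p q r by auto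
  then show ?thesis
  proof cases
    case 4
    then have "w = y + z - x" using v by (simp add: a_def b_def v_def algebra_simps)
    then show ?thesis using flat by blast
  next
    case 5
    then have "w = x + y - z" using v by (simp add: a_def b_def v_def algebra_simps)
    then show ?thesis using flat by blast
  next
    case 6
    then have "w = z + x - y" using v by (simp add: a_def b_def v_def algebra_simps)
    then show ?thesis using flat by blast
  qed (use v in \<open>simp_all add: a_def b_def v_def\<close>)
qed

end

section \<open>The triangulation by supporting triangles\<close>

context lattice_stencils
begin

lemma supports_below:
  assumes s: "supports u x y z A k" and s': "supports u x' y' z' A' k'"
    and p: "p \<in> convex hull {emb x, emb y, emb z}"
  shows "A' \<bullet> p + k' \<le> A \<bullet> p + k"
proof -
  have "convex {p. (A' - A) \<bullet> p \<le> k - k'}" by (rule convex_halfspace_le)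
  moreover have "(A' - A) \<bullet> emb w \<le> k - k'" if "w \<in> X" "A \<bullet> emb w + k = u w" for w
  proof -
    have "A' \<bullet> emb w + k' \<le> u w" using s' that(1) unfolding supports_def by blast
    then show ?thesis using that(2) by (simp add: inner_diff_left)
  qed
  then have "{emb x, emb y, emb z} \<subseteq> {p. (A' - A) \<bullet> p \<le> k - k'}"
    using s unfolding supports_def by blast
  ultimately have "p \<in> {p. (A' - A) \<bullet> p \<le> k - k'}" using p hull_minimal by blast
  then show ?thesis by (simp add: inner_diff_left)
qed

text \<open>The excess of u over the second function is nonnegative at x, y, z and averages to 0 at
  p, so every vertex of positive weight touches the second function and is one of its
  vertices.\<close>

lemma supports_equal_inside:
  assumes u: "strict u" "generic u" and s: "supports u x y z A k" and s': "supports u x' y' z' A' k'"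
    and p: "p \<in> convex hull {emb x, emb y, emb z}" and eq: "A' \<bullet> p + k' = A \<bullet> p + k"
  shows "p \<in> convex hull {emb x', emb y', emb z'}"
proof -
  obtain r q t where rqt: "0 \<le> r" "0 \<le> q" "0 \<le> t" "r + q + t = 1"
    and pp: "p = r *\<^sub>R emb x + q *\<^sub>R emb y + t *\<^sub>R emb z"
    using p by (rule triangleE)
  define \<delta> where "\<delta> w = u w - (A' \<bullet> emb w + k')" for w
  have nn: "\<delta> w \<ge> 0" if "w \<in> X" for w using s' that by (simp add: supports_def \<delta>_def)
  have xyz: "x \<in> X" "y \<in> X" "z \<in> X" using s by (auto simp: supports_def)
  have ux: "u x = A \<bullet> emb x + k" "u y = A \<bullet> emb y + k" "u z = A \<bullet> emb z + k"
    using s by (auto simp: supports_def)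
  have "r * \<delta> x + q * \<delta> y + t * \<delta> z = (A \<bullet> p + (r + q + t) * k) - (A' \<bullet> p + (r + q + t) * k')"
    unfolding pp \<delta>_def ux by (simp add: inner_add_right algebra_simps)
  also have "\<dots> = 0" using eq rqt(4) by simp
  finally have "r * \<delta> x + q * \<delta> y + t * \<delta> z = 0" .
  moreover have "r * \<delta> x \<ge> 0" "q * \<delta> y \<ge> 0" "t * \<delta> z \<ge> 0" using rqt nn xyz by auto
  ultimately have 0: "r * \<delta> x = 0" "q * \<delta> y = 0" "t * \<delta> z = 0" by linarith+
  have v: "emb w \<in> convex hull {emb x', emb y', emb z'}" if "w \<in> X" "\<delta> w = 0" for w
    using supporting_function_touches_vertices[OF u s' that(1)] that(2)
    by (auto simp: \<delta>_def intro: hull_inc)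
  show ?thesis unfolding pp
    by (rule in_convex_if_support) (use rqt 0 v xyz in auto)
qed

definition supporting_triangles :: "(ivec \<Rightarrow> real) \<Rightarrow> (real \<times> real) set set" where
  "supporting_triangles u =
     {T. \<exists>x y z A k. supports u x y z A k \<and> T = convex hull {emb x, emb y, emb z}}"

lemma supporting_triangles_subset: "supporting_triangles u \<subseteq> (\<lambda>S. convex hull (emb ` S)) ` Pow X"
proof
  fix T assume "T \<in> supporting_triangles u"
  then obtain x y z A k where s: "supports u x y z A k" "T = convex hull {emb x, emb y, emb z}"
    by (auto simp: supporting_triangles_def)
  have "T = (\<lambda>S. convex hull (emb ` S)) {x, y, z}" using s(2) by simp
  moreover have "{x, y, z} \<in> Pow X" using s(1) by (simp add: supports_def)
  ultimately show "T \<in> (\<lambda>S. convex hull (emb ` S)) ` Pow X" by (rule image_eqI)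
qed

lemma finite_supporting_triangles: "finite (supporting_triangles u)"
  by (rule finite_subset[OF supporting_triangles_subset]) (use finite_X in simp)

lemma supports_cross: "supports u x y z A k \<Longrightarrow> cross (emb y - emb x) (emb z - emb x) > 0"
  by (simp add: supports_def cross_emb_diff)

text \<open>Points off the lines through two points of X are covered by
  \<open>supporting_triangle\<close>. The lines are negligible and the finite union of triangles is
  closed.\<close>

lemma supporting_triangles_cover:
  assumes int: "interior (hull_of X) \<noteq> {}"
  shows "\<Union>(supporting_triangles u) = hull_of X"
proof
  show "\<Union>(supporting_triangles u) \<subseteq> hull_of X"
    using supports_subset unfolding supporting_triangles_def by blast
  define P where "P = emb ` X"
  define B where "B = (\<Union>(x, y)\<in>{(x, y). x \<in> P \<and> y \<in> P \<and> x \<noteq> y}. {p. cross (x - p) (y - p) = 0})"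
  have P: "finite P" "interior (convex hull P) \<noteq> {}"
    using finite_X int by (auto simp: P_def hull_of_def)
  have "{(x, y). x \<in> P \<and> y \<in> P \<and> x \<noteq> y} \<subseteq> P \<times> P" by auto
  then have "finite {(x, y). x \<in> P \<and> y \<in> P \<and> x \<noteq> y}"
    by (rule finite_subset) (use P in simp)
  then have "negligible B" unfolding B_def
    by (rule negligible_Union[OF finite_imageI]) (auto intro: negligible_line)
  moreover have "closed (\<Union>(supporting_triangles u))"
    by (rule closed_Union[OF finite_supporting_triangles])
      (auto simp: supporting_triangles_def intro!: compact_imp_closed finite_imp_compact_convex_hull)
  moreover have "p \<in> \<Union>(supporting_triangles u)" if p: "p \<in> convex hull P" "p \<notin> B" for p
  proof -
    have off: "cross (x - p) (y - p) \<noteq> 0" if "x \<in> P" "y \<in> P" "x \<noteq> y" for x y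
      using p(2) that unfolding B_def by blast
    define u' where "u' q = u (inv emb q)" for q
    have u': "u' (emb w) = u w" for w by (simp add: u'_def inv_f_f[OF inj_emb])
    obtain a b c where abc: "a \<in> P" "b \<in> P" "c \<in> P" "cross (b - a) (c - a) > 0" "p \<in> convex hull {a, b, c}"
      and le: "\<And>w. w \<in> P \<Longrightarrow> interp a b c (u' a) (u' b) (u' c) w \<le> u' w"
      using supporting_triangle[OF P(1) p(1) off P(2), where u = u'] by blast
    obtain x y z where xyz: "x \<in> X" "y \<in> X" "z \<in> X" "a = emb x" "b = emb y" "c = emb z"
      using abc unfolding P_def by blast
    obtain A k where Ak: "\<And>q. interp a b c (u' a) (u' b) (u' c) q = A \<bullet> q + k"
      using interp_affine by blast
    have "cross (b - a) (c - a) \<noteq> 0" using abc(4) by simp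
    note iv = interp_vertices[OF this, of "u' a" "u' b" "u' c", unfolded Ak, unfolded xyz(4-6) u']
    have "supports u x y z A k"
      unfolding supports_def
    proof (intro conjI ballI)
      show "0 < det2 (y - x) (z - x)" using abc(4) by (simp add: xyz cross_emb_diff)
      show "A \<bullet> emb w + k \<le> u w" if "w \<in> X" for w
        using le[of "emb w"] that by (simp add: Ak P_def u')
    qed (use xyz iv in auto)
    then show ?thesis using abc(5) unfolding xyz(4-6) supporting_triangles_def by blast
  qed
  ultimately show "hull_of X \<subseteq> \<Union>(supporting_triangles u)"
    using subset_closed_if_off_negligible[of "convex hull P" B] P(2)
    unfolding hull_of_def P_def[symmetric] by blast
qed

text \<open>Two triangles meet exactly where their affine functions agree. On T the function of T'
  is the lower one, so the intersection is cut out by a supporting line and is a face of T.\<close>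

lemma supporting_triangulation:
  assumes u: "strict u" "generic u" and int: "interior (hull_of X) \<noteq> {}"
  shows "triangulation_of X (supporting_triangles u)"
proof -
  have simp2: "2 simplex T" if T: "T \<in> supporting_triangles u" for T
  proof -
    obtain x y z A k where s: "supports u x y z A k" "T = convex hull {emb x, emb y, emb z}"
      using T by (auto simp: supporting_triangles_def)
    have "\<not> affine_dependent {emb x, emb y, emb z} \<and> card {emb x, emb y, emb z} = 3"
      using supports_cross[OF s(1)] unfolding affine_independent_cross by simp
    then show ?thesis unfolding simplex_def s(2) by (intro exI[of _ "{emb x, emb y, emb z}"]) simp
  qed
  have face: "T \<inter> T' face_of T" if T: "T \<in> supporting_triangles u" "T' \<in> supporting_triangles u" for T T'
  proof -
    obtain x y z A k where s: "supports u x y z A k" "T = convex hull {emb x, emb y, emb z}"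
      using T(1) by (auto simp: supporting_triangles_def)
    obtain x' y' z' A' k' where s': "supports u x' y' z' A' k'" "T' = convex hull {emb x', emb y', emb z'}"
      using T(2) by (auto simp: supporting_triangles_def)
    have "T \<inter> T' = T \<inter> {p. (A' - A) \<bullet> p = k - k'}"
    proof (intro set_eqI iffI; elim IntE)
      fix p assume p: "p \<in> T" "p \<in> T'"
      have "A' \<bullet> p + k' = A \<bullet> p + k"
        using supports_below[OF s(1) s'(1)] supports_below[OF s'(1) s(1)] p unfolding s(2) s'(2)
        by (meson antisym)
      then show "p \<in> T \<inter> {p. (A' - A) \<bullet> p = k - k'}" using p by (simp add: inner_diff_left)
    next
      fix p assume p: "p \<in> T" "p \<in> {p. (A' - A) \<bullet> p = k - k'}"
      then have "A' \<bullet> p + k' = A \<bullet> p + k" by (simp add: inner_diff_left)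
      then show "p \<in> T \<inter> T'" using supports_equal_inside[OF u s(1) s'(1)] p unfolding s(2) s'(2) by blast
    qed
    also have "\<dots> face_of T"
    proof (rule face_of_Int_supporting_hyperplane_le)
      show "convex T" by (simp add: s(2))
      show "(A' - A) \<bullet> p \<le> k - k'" if "p \<in> T" for p
      proof -
        have "A' \<bullet> p + k' \<le> A \<bullet> p + k"
          using supports_below[OF s(1) s'(1)] that unfolding s(2) by blast
        then show ?thesis by (simp add: inner_diff_left)
      qed
    qed
    finally show ?thesis .
  qed
  have "v \<in> emb ` X" if T: "T \<in> supporting_triangles u" "v extreme_point_of T" for T v
    using T extreme_point_of_convex_hull unfolding supporting_triangles_def supports_def by blast
  moreover have "\<exists>T\<in>supporting_triangles u. emb w extreme_point_of T" if w: "w \<in> X" for w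
  proof -
    have "emb w \<in> \<Union>(supporting_triangles u)"
      using w unfolding supporting_triangles_cover[OF int] hull_of_def by (simp add: hull_inc)
    then obtain x y z A k where s: "supports u x y z A k" "emb w \<in> convex hull {emb x, emb y, emb z}"
      unfolding supporting_triangles_def by blast
    have "\<not> affine_dependent {emb x, emb y, emb z}"
      using supports_cross[OF s(1)] affine_independent_cross[of "emb x" "emb y" "emb z"] by simp
    moreover have "emb w \<in> {emb x, emb y, emb z}"
      using no_lattice_points_in_supporting_triangle[OF u(1) s] by auto
    ultimately have "emb w extreme_point_of convex hull {emb x, emb y, emb z}"
      using extreme_point_of_convex_hull_affine_independent by blast
    then show ?thesis using s(1) unfolding supporting_triangles_def by blast
  qed
  ultimately have "{v. \<exists>T\<in>supporting_triangles u. v extreme_point_of T} = emb ` X" by blast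
  moreover have "triangulation (supporting_triangles u)"
    unfolding triangulation_def using finite_supporting_triangles face simp2 by blast
  ultimately show ?thesis
    unfolding triangulation_of_def using simp2 supporting_triangles_cover[OF int] by simp
qed

text \<open>For a missing edge e, the segments from p to p + e and from p + f to p + g have the same
  midpoint. The supporting function equals u at the ends of the first and is below u at those of the
  second, which makes P nonpositive.\<close>

lemma supporting_triangles_subordinate:
  assumes u: "strict u"
  shows "subordinate X (supporting_triangles u) V"
  unfolding subordinate_def
proof (intro ballI allI impI)
  fix p e
  assume p: "p \<in> X" and "\<exists>T\<in>supporting_triangles u. closed_segment (emb p) (emb (p + e)) edge_of T"
  then obtain x y z A k where s: "supports u x y z A k"
    and ed: "closed_segment (emb p) (emb (p + e)) edge_of (convex hull {emb x, emb y, emb z})"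
    unfolding supporting_triangles_def by blast
  note ep = edge_endpoints[OF ed]
  have pe: "p \<in> {x, y, z}" "p + e \<in> {x, y, z}" "e \<noteq> 0"
    using extreme_point_of_convex_hull[OF ep(1)] extreme_point_of_convex_hull[OF ep(2)] ep(3)
    by (auto simp del: emb_simps)
  have peX: "p + e \<in> X" "A \<bullet> emb (p + e) + k = u (p + e)" "A \<bullet> emb p + k = u p"
  proof -
    have "q \<in> X \<and> A \<bullet> emb q + k = u q" if "q \<in> {x, y, z}" for q
      using s that unfolding supports_def by auto
    then show "p + e \<in> X" "A \<bullet> emb (p + e) + k = u (p + e)" "A \<bullet> emb p + k = u p"
      using pe(1,2) by blast+
  qed
  have d: "det2 (y - x) (z - x) = 1" by (rule supporting_triangle_unimodular[OF u s])
  then have d': "det2 (z - y) (x - y) = 1" "det2 (x - z) (y - z) = 1"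
    by (simp_all add: det2_def algebra_simps)
  have "e = (p + e) - p" by simp
  then have "e \<in> {y - x, z - x, x - y, z - y, x - z, y - z}" using pe
    by (smt (verit) cancel_comm_monoid_add_class.diff_cancel insert_iff singletonD)
  then have e: "irred e" using irred_det2_1[OF d] irred_det2_1[OF d'(1)] irred_det2_1[OF d'(2)] by blast
  then have eV: "e \<in> Vmax X p" using peX by (simp add: Vmax_def)
  show "e \<in> V p"
  proof (rule ccontr)
    assume ne: "e \<notin> V p"
    obtain f g where fg: "parents e f g" using outside_V_parents[OF p eV ne] by blast
    note P = P_form_pos[OF u p eV ne fg]
    have "A \<bullet> emb (p + f) + k \<le> u (p + f)" "A \<bullet> emb (p + g) + k \<le> u (p + g)"
      using s P unfolding supports_def by blast+
    moreover have "e = f + g" using fg by (simp add: parents_iff)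
    then have "A \<bullet> emb (p + e) + A \<bullet> emb p = A \<bullet> emb (p + f) + A \<bullet> emb (p + g)"
      by (simp add: inner_add_right)
    ultimately show False using P(3) peX unfolding P_form_def by linarith
  qed
qed

text \<open>The interpolation is the maximum of finitely many affine functions, one chosen for each
  triangle.\<close>

lemma supporting_triangles_convex:
  assumes u: "strict u" "generic u" "u \<in> X \<rightarrow>\<^sub>E UNIV" and int: "interior (hull_of X) \<noteq> {}"
  shows "u \<in> Conv_triangulation X (supporting_triangles u)"
proof -
  define \<T> where "\<T> = supporting_triangles u"
  have "\<forall>T\<in>\<T>. \<exists>Ak. \<exists>x y z. supports u x y z (fst Ak) (snd Ak) \<and> T = convex hull {emb x, emb y, emb z}"
    unfolding \<T>_def supporting_triangles_def by force
  then obtain Ak where Ak: "\<And>T. T \<in> \<T> \<Longrightarrow>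
      \<exists>x y z. supports u x y z (fst (Ak T)) (snd (Ak T)) \<and> T = convex hull {emb x, emb y, emb z}"
    by metis
  define L where "L T p = fst (Ak T) \<bullet> p + snd (Ak T)" for T p
  define F where "F p = Max ((\<lambda>T. L T p) ` \<T>)" for p
  have fin: "finite ((\<lambda>T. L T p) ` \<T>)" for p
    unfolding \<T>_def by (intro finite_imageI finite_supporting_triangles)
  have le: "L T' p \<le> L T p" if "T \<in> \<T>" "T' \<in> \<T>" "p \<in> T" for T T' p
    using Ak[OF that(1)] Ak[OF that(2)] that(3) supports_below unfolding L_def by blast
  have FL: "F p = L T p" if "T \<in> \<T>" "p \<in> T" for T p
    unfolding F_def by (rule Max_eqI[OF fin]) (use le that in blast)+
  have cover: "\<Union>\<T> = hull_of X" unfolding \<T>_def by (rule supporting_triangles_cover[OF int])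
  have "F (emb w) = u w" if w: "w \<in> X" for w
  proof -
    have "emb w \<in> \<Union>\<T>" using w unfolding cover hull_of_def by (simp add: hull_inc)
    then obtain T where T: "T \<in> \<T>" "emb w \<in> T" by blast
    then obtain x y z where s: "supports u x y z (fst (Ak T)) (snd (Ak T))" "T = convex hull {emb x, emb y, emb z}"
      using Ak by blast
    have "w \<in> {x, y, z}"
      using no_lattice_points_in_supporting_triangle[OF u(1) s(1)] T(2) s(2) by blast
    then show ?thesis using s(1) unfolding FL[OF T] L_def supports_def by blast
  qed
  moreover have "\<exists>a b. \<forall>p\<in>T. F p = a \<bullet> p + b" if "T \<in> \<T>" for T
    using FL[OF that] unfolding L_def by blast
  ultimately have "pl_interpolation X \<T> u F" unfolding pl_interpolation_def by blast
  moreover have "convex_on (hull_of X) F"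
  proof (rule convex_onI)
    show cvx: "convex (hull_of X)" by (simp add: hull_of_def)
    fix t :: real and p q
    assume t: "0 < t" "t < 1" and pq: "p \<in> hull_of X" "q \<in> hull_of X"
    define m where "m = (1 - t) *\<^sub>R p + t *\<^sub>R q"
    have "m \<in> hull_of X" unfolding m_def using cvx t pq by (simp add: convex_alt)
    then obtain T where T: "T \<in> \<T>" "m \<in> T" using cover by blast
    have "F m = L T m" by (rule FL[OF T])
    also have "\<dots> = (1 - t) * L T p + t * L T q"
      by (simp add: L_def m_def inner_add_right algebra_simps)
    also have "\<dots> \<le> (1 - t) * F p + t * F q"
      using t T(1) unfolding F_def by (intro add_mono mult_left_mono Max_ge[OF fin]) auto
    finally show "F ((1 - t) *\<^sub>R p + t *\<^sub>R q) \<le> (1 - t) * F p + t * F q" by (simp add: m_def)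
  qed
  ultimately have "\<exists>F. pl_interpolation X \<T> u F \<and> convex_on (hull_of X) F" by blast
  then show ?thesis unfolding Conv_triangulation_def \<T>_def using u(3) by simp
qed

end

section \<open>Perturbation to strict and generic functions\<close>

lemma interior_line:
  assumes w: "w \<in> powertop_real X interior_of S"
  obtains \<delta> where "\<delta> > 0" "\<And>\<epsilon>. \<bar>\<epsilon>\<bar> < \<delta> \<Longrightarrow> (\<lambda>x\<in>X. w x + \<epsilon> * r x) \<in> S"
proof -
  obtain U where U: "openin (powertop_real X) U" "w \<in> U" "U \<subseteq> S"
    using w by (auto simp: interior_of_def)
  define \<phi> where "\<phi> \<epsilon> = (\<lambda>x\<in>X. w x + \<epsilon> * r x)" for \<epsilon>
  have "continuous_map euclideanreal (powertop_real X) \<phi>"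
    unfolding continuous_map_componentwise
  proof (intro conjI ballI)
    show "\<phi> ` topspace euclideanreal \<subseteq> extensional X" by (auto simp: \<phi>_def)
    show "continuous_map euclideanreal euclideanreal (\<lambda>\<epsilon>. \<phi> \<epsilon> x)" if "x \<in> X" for x
      using that by (auto simp: \<phi>_def intro!: continuous_intros)
  qed
  then have "openin euclideanreal {\<epsilon> \<in> topspace euclideanreal. \<phi> \<epsilon> \<in> U}"
    using U(1) by (rule openin_continuous_map_preimage)
  then have op: "open {\<epsilon>. \<phi> \<epsilon> \<in> U}" by simp
  have "w \<in> topspace (powertop_real X)" using U openin_subset by blast
  then have "w \<in> extensional X" by (simp add: PiE_def)
  then have "\<phi> 0 = w" by (simp add: \<phi>_def extensional_restrict)
  then obtain \<delta> where "\<delta> > 0" "\<And>\<epsilon>. dist \<epsilon> 0 < \<delta> \<Longrightarrow> \<phi> \<epsilon> \<in> U"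
    using op U(2) unfolding open_dist by (metis mem_Collect_eq)
  then show ?thesis using that[of \<delta>] U(3) unfolding \<phi>_def by (auto simp: dist_real_def)
qed

text \<open>Positive definite for N > 0, with discriminant \<open>- 3 * N\<^sup>2\<close>. The
  parameter allows the polar form to be nonzero on finitely many prescribed bases at once.\<close>

definition quadr :: "real \<Rightarrow> ivec \<Rightarrow> real" where
  "quadr N x = (of_int (fst x))\<^sup>2 + N * of_int (fst x) * of_int (snd x) + N\<^sup>2 * (of_int (snd x))\<^sup>2"

definition quadr_polar :: "real \<Rightarrow> ivec \<Rightarrow> ivec \<Rightarrow> real" where
  "quadr_polar N f g = 2 * of_int (fst f * fst g) + N * of_int (fst f * snd g + snd f * fst g)
      + N\<^sup>2 * (2 * of_int (snd f * snd g))"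

lemma quadr_pos:
  assumes "N > 0" "e \<noteq> 0"
  shows "quadr N e > 0"
proof -
  define a b where "a = real_of_int (fst e)" and "b = real_of_int (snd e)"
  have "quadr N e = (a + N * b / 2)\<^sup>2 + 3 / 4 * (N * b)\<^sup>2"
    by (simp add: quadr_def a_def b_def power2_eq_square algebra_simps)
  moreover have "a \<noteq> 0 \<or> b \<noteq> 0" using assms(2) by (auto simp: a_def b_def prod_eq_iff)
  then have "a + N * b / 2 \<noteq> 0 \<or> N * b \<noteq> 0" using assms(1) by auto
  then have "(a + N * b / 2)\<^sup>2 + 3 / 4 * (N * b)\<^sup>2 > 0"
    by (metis add_nonneg_pos add_pos_nonneg mult_pos_pos zero_le_power2 zero_less_power2 divide_pos_pos zero_less_numeral mult_nonneg_nonneg divide_nonneg_nonneg zero_le_numeral)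
  ultimately show ?thesis by simp
qed

lemma S_form_quadr: "S_form (quadr N) x e = 2 * quadr N e"
  by (simp add: S_form_def quadr_def power2_eq_square algebra_simps)

lemma T_form_quadr: "T_form (quadr N) x (f + g) f g = quadr N (f + g) + quadr N f + quadr N g"
  by (simp add: T_form_def quadr_def power2_eq_square algebra_simps)

lemma P_form_quadr: "P_form (quadr N) x (f + g) f g = quadr_polar N f g"
  by (simp add: P_form_def quadr_def quadr_polar_def power2_eq_square algebra_simps)

text \<open>If all coefficients in N vanished, both products in the determinant would be 0.\<close>

lemma quadr_polar_roots_finite:
  assumes "det2 f g = 1"
  shows "finite {N. quadr_polar N f g = 0}"
proof -
  define p :: "real poly" where
    "p = [:2 * of_int (fst f * fst g), of_int (fst f * snd g + snd f * fst g), 2 * of_int (snd f * snd g):]"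
  have "p \<noteq> 0"
  proof
    assume "p = 0"
    then have 0: "fst f * fst g = 0" "fst f * snd g + snd f * fst g = 0" "snd f * snd g = 0"
      by (auto simp: p_def simp flip: of_int_mult of_int_add)
    then show False using assms by (auto simp: det2_def)
  qed
  moreover have "quadr_polar N f g = poly p N" for N
    by (simp add: p_def quadr_polar_def power2_eq_square algebra_simps)
  ultimately show ?thesis using poly_roots_finite by simp
qed

lemma forms_add_mult:
  "S_form (\<lambda>x. u x + t * v x) x e = S_form u x e + t * S_form v x e"
  "T_form (\<lambda>x. u x + t * v x) x e f g = T_form u x e f g + t * T_form v x e f g"
  "P_form (\<lambda>x. u x + t * v x) x e f g = P_form u x e f g + t * P_form v x e f g"
  by (simp_all add: S_form_def T_form_def P_form_def algebra_simps)

lemma forms_restrict: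
  "{x + e, x, x - e} \<subseteq> X \<Longrightarrow> S_form (restrict u X) x e = S_form u x e"
  "{x + e, x - f, x - g, x} \<subseteq> X \<Longrightarrow> T_form (restrict u X) x e f g = T_form u x e f g"
  "{x + e, x + f, x + g, x} \<subseteq> X \<Longrightarrow> P_form (restrict u X) x e f g = P_form u x e f g"
  by (auto simp: S_form_def T_form_def P_form_def)

text \<open>Interpolation is linear: interpolants of u + t1 w and of u + t2 w yield those of u and of w,
  hence of every u + t w, and convexity passes to the limit as t tends to 0.\<close>

lemma Conv_triangulation_limit:
  assumes tri: "triangulation_of X \<T>" and u: "u \<in> X \<rightarrow>\<^sub>E UNIV"
    and lim: "t \<longlonglongrightarrow> 0" and t: "\<And>n. (\<lambda>x\<in>X. u x + t n * w x) \<in> Conv_triangulation X \<T>"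
    and ne: "t m \<noteq> t n"
  shows "u \<in> Conv_triangulation X \<T>"
proof -
  obtain F where F: "\<And>n. pl_interpolation X \<T> (\<lambda>x\<in>X. u x + t n * w x) (F n)" "\<And>n. convex_on (hull_of X) (F n)"
    using t unfolding Conv_triangulation_def by (simp add: Bex_def) metis
  define d where "d = t n - t m"
  have d: "d \<noteq> 0" using ne by (simp add: d_def)
  \<comment> \<open>G and H solve F = H + t G at the two parameters t m and t n; so G interpolates
    w, and H interpolates u.\<close>
  define G where "G p = (F n p - F m p) / d" for p
  define H where "H p = (t n * F m p - t m * F n p) / d" for p
  have aff: "\<exists>a b. \<forall>p\<in>T. F k p = a \<bullet> p + b" if "T \<in> \<T>" for T k
    using F(1)[of k] that unfolding pl_interpolation_def by blast
  have val: "F k (emb x) = u x + t k * w x" if "x \<in> X" for x k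
  proof -
    have "F k (emb x) = (\<lambda>x\<in>X. u x + t k * w x) x"
      using F(1)[of k] that unfolding pl_interpolation_def by blast
    then show ?thesis using that by simp
  qed
  have comb_aff: "\<exists>a b. \<forall>p\<in>T. \<alpha> * F m p + \<beta> * F n p = a \<bullet> p + b" if T: "T \<in> \<T>" for T \<alpha> \<beta>
  proof -
    obtain a b where 1: "\<forall>p\<in>T. F m p = a \<bullet> p + b" using aff[OF T] by blast
    obtain a' b' where 2: "\<forall>p\<in>T. F n p = a' \<bullet> p + b'" using aff[OF T] by blast
    from 1 2 have "\<forall>p\<in>T. \<alpha> * F m p + \<beta> * F n p = (\<alpha> *\<^sub>R a + \<beta> *\<^sub>R a') \<bullet> p + (\<alpha> * b + \<beta> * b')"
      by (simp add: inner_add_left algebra_simps)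
    then show ?thesis by blast
  qed
  have HG: "H p + s * G p = ((t n - s) / d) * F m p + ((s - t m) / d) * F n p" for s p
    using d by (simp add: H_def G_def field_simps)
  have HG_val: "H (emb x) + s * G (emb x) = u x + s * w x" if "x \<in> X" for s x
  proof -
    have "H (emb x) + s * G (emb x) = ((t n - s) * (u x + t m * w x) + (s - t m) * (u x + t n * w x)) / d"
      unfolding HG val[OF that] by (simp add: add_divide_distrib)
    also have "(t n - s) * (u x + t m * w x) + (s - t m) * (u x + t n * w x) = (u x + s * w x) * d"
      by (simp add: d_def algebra_simps)
    finally show ?thesis using d by simp
  qed
  have pl: "pl_interpolation X \<T> (\<lambda>x\<in>X. u x + s * w x) (\<lambda>p. H p + s * G p)" for s
    unfolding pl_interpolation_def
  proof (intro conjI ballI)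
    show "\<exists>a b. \<forall>p\<in>T. H p + s * G p = a \<bullet> p + b" if "T \<in> \<T>" for T
      unfolding HG by (rule comb_aff[OF that])
  qed (use HG_val in simp)
  \<comment> \<open>Uniqueness extends the decomposition from m and n to every k.\<close>
  have eq: "F k p = H p + t k * G p" if "p \<in> hull_of X" for k p
    by (rule pl_interpolation_unique[OF tri F(1) pl that])
  have "convex_on (hull_of X) H"
  proof (rule convex_onI)
    show cvx: "convex (hull_of X)" by (simp add: hull_of_def)
    fix s :: real and p q
    assume s: "0 < s" "s < 1" and pq: "p \<in> hull_of X" "q \<in> hull_of X"
    define r where "r = (1 - s) *\<^sub>R p + s *\<^sub>R q"
    have r: "r \<in> hull_of X" unfolding r_def using cvx s pq by (simp add: convex_alt)
    have le: "H r + t k * G r \<le> (1 - s) * (H p + t k * G p) + s * (H q + t k * G q)" for k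
      using convex_onD[OF F(2)[of k], of s p q] s pq r unfolding r_def[symmetric]
      by (simp add: eq)
    have A: "(\<lambda>k. H r + t k * G r) \<longlonglongrightarrow> H r + 0 * G r"
      by (intro tendsto_intros lim)
    have B: "(\<lambda>k. (1 - s) * (H p + t k * G p) + s * (H q + t k * G q))
        \<longlonglongrightarrow> (1 - s) * (H p + 0 * G p) + s * (H q + 0 * G q)"
      by (intro tendsto_intros lim)
    have "H r + 0 * G r \<le> (1 - s) * (H p + 0 * G p) + s * (H q + 0 * G q)"
      by (rule LIMSEQ_le[OF A B]) (intro exI allI impI le)
    then show "H ((1 - s) *\<^sub>R p + s *\<^sub>R q) \<le> (1 - s) * H p + s * H q" by (simp add: r_def)
  qed
  moreover have "pl_interpolation X \<T> u H"
  proof -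
    have "(\<lambda>x\<in>X. u x + 0 * w x) = u" using u by (auto simp: PiE_def extensional_def restrict_def)
    then show ?thesis using pl[of 0] by simp
  qed
  ultimately show ?thesis using u unfolding Conv_triangulation_def by blast
qed

section \<open>Strict generic functions and approximation\<close>

context lattice_stencils
begin

definition parallelograms :: "(ivec \<times> ivec \<times> ivec) set" where
  "parallelograms = {(x, f, g). det2 f g = 1 \<and> {x, x + f, x + g, x + (f + g)} \<subseteq> X}"

lemma finite_parallelograms: "finite parallelograms"
proof (rule finite_subset)
  show "parallelograms \<subseteq> (\<lambda>(x, y, z). (x, y - x, z - x)) ` (X \<times> X \<times> X)"
  proof
    fix p assume "p \<in> parallelograms"
    then obtain x f g where "p = (x, f, g)" "x \<in> X" "x + f \<in> X" "x + g \<in> X"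
      unfolding parallelograms_def by blast
    then show "p \<in> (\<lambda>(x, y, z). (x, y - x, z - x)) ` (X \<times> X \<times> X)"
      by (intro image_eqI[of _ _ "(x, x + f, x + g)"]) auto
  qed
qed (use finite_X in simp)

lemma generic_iff: "generic u \<longleftrightarrow> (\<forall>(x, f, g)\<in>parallelograms. P_form u x (f + g) f g \<noteq> 0)"
  unfolding generic_def parallelograms_def by blast

lemma Conv_stencilsD:
  assumes "u \<in> Conv_stencils X V" "x \<in> X"
  shows "e \<in> V x \<Longrightarrow> {x + e, x, x - e} \<subseteq> X \<Longrightarrow> S_form u x e \<ge> 0"
    and "e \<in> V x \<Longrightarrow> parents e f g \<Longrightarrow> {x + e, x - f, x - g, x} \<subseteq> X \<Longrightarrow> T_form u x e f g \<ge> 0"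
  using assms unfolding Conv_stencils_def by blast+

lemma candidate_parallelogram:
  assumes x: "x \<in> X" and e: "e \<in> candidates X V x" and fg: "parents e f g"
  shows "{x + e, x + f, x + g, x} \<subseteq> X" "(x, f, g) \<in> parallelograms" "e = f + g"
proof -
  have e': "det2 f g = 1" "dot2 f g \<ge> 0" "e = f + g" using fg by (auto simp: parents_iff)
  obtain f' g' where f'g': "parents e f' g'" "f' \<in> V x" "g' \<in> V x"
    using e unfolding candidates_def by blast
  have eV: "e \<in> Vmax X x" "e \<notin> V x" using e by (auto simp: candidates_def)
  obtain a b where ab: "a \<in> V x" "b \<in> V x" "det2 a b = 1" "dot2 a b \<ge> 0" "e \<in> open_cone a b"
    using enclosing_basis[OF x eV] by blast
  note cone = parents_in_cone[OF ab(3-5) e']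
  have "det2 a e \<ge> 1" "det2 e b \<ge> 1" using ab(5) by (auto simp: open_cone_def)
  then have pos: "det2 f b \<ge> 1 \<and> det2 a g \<ge> 1"
    using unimodular_nonneg[OF basis_change_det[OF ab(3) e'(1)]] cone by (simp add: e'(3))
  note hc = hull_coords[OF basis_change_det[OF ab(3) e'(1)] basis_coords[OF ab(3)] basis_coords[OF ab(3)]]
  have X': "x + (f + g) \<in> X" "x + a \<in> X" "x + b \<in> X"
    using eV V_add[OF x] ab by (auto simp: Vmax_def e'(3))
  have "x + f \<in> X"
    by (rule convex_X[OF x X' _ _ _ _ _ hc(1)]) (use pos cone in auto)
  moreover have "x + g \<in> X"
    by (rule convex_X[OF x X' _ _ _ _ _ hc(2)]) (use pos cone in auto)
  ultimately show "{x + e, x + f, x + g, x} \<subseteq> X" "(x, f, g) \<in> parallelograms" "e = f + g"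
    using x X' e' by (auto simp: parallelograms_def)
qed

lemma strict_generic_exists:
  assumes "powertop_real X interior_of Conv_stencils X V \<noteq> {}"
  obtains w where "strict w" "generic w"
proof -
  obtain w0 where w0: "w0 \<in> powertop_real X interior_of Conv_stencils X V" using assms by blast
  have "finite (\<Union>(x, f, g)\<in>parallelograms. {N. quadr_polar N f g = 0})"
    by (rule finite_UN_I[OF finite_parallelograms])
      (auto simp: parallelograms_def intro: quadr_polar_roots_finite)
  then obtain N where N: "N > 0" "N \<notin> (\<Union>(x, f, g)\<in>parallelograms. {N. quadr_polar N f g = 0})"
    using infinite_Ioi[of "0 :: real"] by (metis (no_types, lifting) finite_subset greaterThan_iff subsetI)
  define r where "r = quadr N"
  have rP: "P_form r x (f + g) f g \<noteq> 0" if "(x, f, g) \<in> parallelograms" for x f g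
    using N(2) that unfolding r_def P_form_quadr by blast
  obtain \<delta> where \<delta>: "\<delta> > 0" "\<And>\<epsilon>. \<bar>\<epsilon>\<bar> < \<delta> \<Longrightarrow> (\<lambda>x\<in>X. w0 x + \<epsilon> * r x) \<in> Conv_stencils X V"
    using interior_line[OF w0, of r] by blast
  have w0C: "w0 \<in> Conv_stencils X V" by (rule subsetD[OF interior_of_subset w0])
  \<comment> \<open>Each parallelogram forbids one \<epsilon>, the root of an affine function that
    is not constant by the choice of N.\<close>
  have "finite ((\<lambda>(x, f, g). - P_form w0 x (f + g) f g / P_form r x (f + g) f g) ` parallelograms)" (is "finite ?B")
    by (intro finite_imageI finite_parallelograms)
  then have "\<not> {0<..<\<delta>} \<subseteq> ?B" using infinite_Ioo[OF \<delta>(1)] finite_subset by blast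
  then obtain \<epsilon> where "\<epsilon> \<in> {0<..<\<delta>}" and nB: "\<epsilon> \<notin> ?B" by (meson subsetI)
  then have \<epsilon>: "0 < \<epsilon>" "\<epsilon> < \<delta>" by simp_all
  define w where "w = (\<lambda>x\<in>X. w0 x + \<epsilon> * r x)"
  have wC: "w \<in> Conv_stencils X V" using \<delta>(2)[of \<epsilon>] \<epsilon> by (simp add: w_def)
  have gen: "generic w" unfolding generic_iff
  proof clarify
    fix x f g assume p: "(x, f, g) \<in> parallelograms" and 0: "P_form w x (f + g) f g = 0"
    have "P_form w0 x (f + g) f g + \<epsilon> * P_form r x (f + g) f g = 0"
      using p 0 unfolding w_def by (subst (asm) forms_restrict) (auto simp: parallelograms_def forms_add_mult)
    then have "\<epsilon> = - P_form w0 x (f + g) f g / P_form r x (f + g) f g"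
      using rP[OF p] by (simp add: field_simps)
    also have "\<dots> \<in> ?B" using p by (intro rev_image_eqI[OF p]) simp
    finally show False using nB by contradiction
  qed
  have "strict w" unfolding strict_def
  proof (intro ballI conjI allI impI)
    fix x e assume *: "x \<in> X" "e \<in> V x" "{x + e, x, x - e} \<subseteq> X"
    have "S_form w0 x e \<ge> 0" using Conv_stencilsD(1)[OF w0C *] .
    moreover have "quadr N e > 0" using quadr_pos[OF N(1)] V_irred[OF *(1,2)] irred_nz by blast
    ultimately show "S_form w x e > 0"
      using \<epsilon> unfolding w_def forms_restrict(1)[OF *(3)] forms_add_mult r_def S_form_quadr
      by (simp add: add_nonneg_pos)
  next
    fix x e f g
    assume *: "x \<in> X" "e \<in> V x" and "parents e f g \<and> {x + e, x - f, x - g, x} \<subseteq> X"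
    then have **: "parents e f g" "{x + e, x - f, x - g, x} \<subseteq> X" by auto
    have T0: "T_form w0 x e f g \<ge> 0" using Conv_stencilsD(2)[OF w0C * **] .
    have efg: "e = f + g" using **(1) unfolding parents_iff by blast
    have "irred f" "irred g" by (rule parents_shorter[OF **(1)])+
    moreover have "irred e" using **(1) unfolding parents_def by blast
    ultimately have "quadr N e > 0" "quadr N f > 0" "quadr N g > 0" using quadr_pos[OF N(1)] irred_nz by blast+
    then have "T_form r x e f g > 0" unfolding efg r_def T_form_quadr by simp
    then show "T_form w x e f g > 0"
      using \<epsilon> T0 unfolding w_def forms_restrict(2)[OF **(2)] forms_add_mult by (simp add: add_nonneg_pos)
  next
    fix x e f g assume *: "x \<in> X" "e \<in> candidates X V x" "parents e f g"
    have "P_form w x e f g \<ge> 0" using wC * unfolding Conv_stencils_def by blast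
    moreover have "P_form w x e f g \<noteq> 0"
      using gen candidate_parallelogram[OF *] unfolding generic_iff by blast
    ultimately show "P_form w x e f g > 0" by simp
  qed
  then show ?thesis using that gen by blast
qed

lemma strict_add:
  assumes u: "u \<in> Conv_stencils X V" and w: "strict w" and t: "t > 0"
  shows "strict (\<lambda>x\<in>X. u x + t * w x)"
  unfolding strict_def
proof (intro ballI conjI allI impI)
  fix x e assume *: "x \<in> X" "e \<in> V x" "{x + e, x, x - e} \<subseteq> X"
  have "S_form u x e \<ge> 0" using Conv_stencilsD(1)[OF u *] .
  moreover have "S_form w x e > 0" using w * unfolding strict_def by blast
  ultimately show "S_form (\<lambda>x\<in>X. u x + t * w x) x e > 0"
    using t unfolding forms_restrict(1)[OF *(3)] forms_add_mult by (simp add: add_nonneg_pos)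
next
  fix x e f g
  assume *: "x \<in> X" "e \<in> V x" and "parents e f g \<and> {x + e, x - f, x - g, x} \<subseteq> X"
  then have **: "parents e f g" "{x + e, x - f, x - g, x} \<subseteq> X" by auto
  have "T_form u x e f g \<ge> 0" using Conv_stencilsD(2)[OF u * **] .
  moreover have "T_form w x e f g > 0" using w * ** unfolding strict_def by blast
  ultimately show "T_form (\<lambda>x\<in>X. u x + t * w x) x e f g > 0"
    using t unfolding forms_restrict(2)[OF **(2)] forms_add_mult by (simp add: add_nonneg_pos)
next
  fix x e f g assume *: "x \<in> X" "e \<in> candidates X V x" "parents e f g"
  have "P_form u x e f g \<ge> 0" using u * unfolding Conv_stencils_def by blast
  moreover have "P_form w x e f g > 0" using w * unfolding strict_def by blast
  ultimately show "P_form (\<lambda>x\<in>X. u x + t * w x) x e f g > 0"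
    using t unfolding forms_restrict(3)[OF candidate_parallelogram(1)[OF *]] forms_add_mult
    by (simp add: add_nonneg_pos)
qed

lemma generic_add:
  assumes w: "generic w"
  obtains \<tau> where "\<tau> > 0" "\<And>t. 0 < t \<Longrightarrow> t \<le> \<tau> \<Longrightarrow> generic (\<lambda>x\<in>X. u x + t * w x)"
proof -
  define B where "B = (\<lambda>(x, f, g). - P_form u x (f + g) f g / P_form w x (f + g) f g) ` parallelograms \<inter> {0<..}"
  have fin: "finite (insert 1 B)" unfolding B_def by (simp add: finite_parallelograms)
  \<comment> \<open>Half of the least positive root, so that \<tau> itself is admissible; the 1
    keeps the set nonempty.\<close>
  define \<tau> where "\<tau> = Min (insert 1 B) / 2"
  have "Min (insert 1 B) \<in> insert 1 B" using fin by (intro Min_in) auto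
  then have pos: "Min (insert 1 B) > 0" unfolding B_def by auto
  then have "\<tau> > 0" by (simp add: \<tau>_def)
  moreover have "generic (\<lambda>x\<in>X. u x + t * w x)" if t: "0 < t" "t \<le> \<tau>" for t
    unfolding generic_iff
  proof clarify
    fix x f g assume p: "(x, f, g) \<in> parallelograms"
      and 0: "P_form (\<lambda>x\<in>X. u x + t * w x) x (f + g) f g = 0"
    have "P_form u x (f + g) f g + t * P_form w x (f + g) f g = 0"
      using p 0 by (subst (asm) forms_restrict) (auto simp: parallelograms_def forms_add_mult)
    moreover have "P_form w x (f + g) f g \<noteq> 0" using w p unfolding generic_iff by blast
    ultimately have "t = - P_form u x (f + g) f g / P_form w x (f + g) f g"
      by (simp add: field_simps)
    moreover have "t > 0" by (rule t(1))
    ultimately have "t \<in> B" unfolding B_def by (intro IntI rev_image_eqI[OF p]) simp_all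
    then have "Min (insert 1 B) \<le> t" using fin by (intro Min_le) auto
    then show False using t pos by (simp add: \<tau>_def)
  qed
  ultimately show ?thesis using that by blast
qed

text \<open>By pigeonhole one triangulation recurs for infinitely many parameters. The subsequence
  is strictly increasing, so it has two distinct parameters, from which the limit lemma separates u
  and w.\<close>

lemma Conv_stencils_subset:
  assumes int: "interior (hull_of X) \<noteq> {}"
    and ne: "powertop_real X interior_of Conv_stencils X V \<noteq> {}"
    and u: "u \<in> Conv_stencils X V"
  shows "\<exists>\<T>. triangulation_of X \<T> \<and> subordinate X \<T> V \<and> u \<in> Conv_triangulation X \<T>"
proof -
  obtain w where w: "strict w" "generic w" using strict_generic_exists[OF ne] by blast
  obtain \<tau> where \<tau>: "\<tau> > 0" "\<And>t. 0 < t \<Longrightarrow> t \<le> \<tau> \<Longrightarrow> generic (\<lambda>x\<in>X. u x + t * w x)"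
    using generic_add[OF w(2)] by blast
  define t where "t n = \<tau> / real (Suc n)" for n
  have t: "t n > 0" "t n \<le> \<tau>" for n using \<tau>(1) by (auto simp: t_def field_simps)
  define v where "v n = (\<lambda>x\<in>X. u x + t n * w x)" for n
  have v: "strict (v n)" "generic (v n)" "v n \<in> X \<rightarrow>\<^sub>E UNIV" for n
    using strict_add[OF u w(1) t(1)] \<tau>(2)[OF t] by (auto simp: v_def)
  define \<T> where "\<T> n = supporting_triangles (v n)" for n
  have "finite (range \<T>)"
  proof (rule finite_subset)
    show "range \<T> \<subseteq> Pow ((\<lambda>S. convex hull (emb ` S)) ` Pow X)"
      using supporting_triangles_subset unfolding \<T>_def by blast
  qed (use finite_X in simp)
  then obtain m where "infinite {n. \<T> n = \<T> m}"
    using pigeonhole_infinite[of UNIV \<T>] by auto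
  then obtain s :: "nat \<Rightarrow> nat" where s: "strict_mono s" "\<And>n. \<T> (s n) = \<T> m"
    using infinite_enumerate[of "{n. \<T> n = \<T> m}"] by auto
  have "(\<lambda>n. \<tau> * inverse (real (Suc n))) \<longlonglongrightarrow> \<tau> * 0"
    by (intro tendsto_intros LIMSEQ_inverse_real_of_nat)
  then have "t \<longlonglongrightarrow> 0" by (simp add: t_def[abs_def] divide_inverse)
  then have lim: "(\<lambda>n. t (s n)) \<longlonglongrightarrow> 0" using LIMSEQ_subseq_LIMSEQ[OF _ s(1)] by (auto simp: o_def)
  have "s 0 \<noteq> s 1" using strict_mono_eq[OF s(1)] by simp
  then have ne: "t (s 0) \<noteq> t (s 1)" using \<tau>(1) by (simp add: t_def field_simps)
  have tri: "triangulation_of X (\<T> m)"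
    unfolding \<T>_def by (rule supporting_triangulation[OF v(1,2) int])
  have vT: "(\<lambda>x\<in>X. u x + t (s n) * w x) \<in> Conv_triangulation X (\<T> m)" for n
    using supporting_triangles_convex[OF v(1-3) int, of "s n"] s(2)[of n] by (simp add: \<T>_def v_def)
  have uE: "u \<in> X \<rightarrow>\<^sub>E UNIV" using u unfolding Conv_stencils_def by blast
  have "u \<in> Conv_triangulation X (\<T> m)"
    by (rule Conv_triangulation_limit[OF tri uE lim vT ne])
  moreover have "subordinate X (\<T> m) V"
    unfolding \<T>_def by (rule supporting_triangles_subordinate[OF v(1)])
  ultimately show ?thesis using tri by blast
qed

end

section \<open>Functions convex on a triangulation\<close>

lemma lattice_jensen:
  assumes F: "convex_on C F" "emb x \<in> C" "emb (x + a) \<in> C" "emb (x + b) \<in> C" "emb (x + c) \<in> C"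
    and k: "k1 \<ge> 0" "k2 \<ge> 0" "k3 \<ge> 0" "k1 + k2 + k3 \<le> n" "n > 0"
    and w: "sm n w = sm k1 a + sm k2 b + sm k3 c"
  shows "of_int n * F (emb (x + w)) \<le> of_int (n - k1 - k2 - k3) * F (emb x) + of_int k1 * F (emb (x + a))
      + of_int k2 * F (emb (x + b)) + of_int k3 * F (emb (x + c))"
proof -
  have "F (emb (x + w)) \<le> of_int (n - k1 - k2 - k3) / of_int n * F (emb x)
      + of_int k1 / of_int n * F (emb (x + a)) + of_int k2 / of_int n * F (emb (x + b))
      + of_int k3 / of_int n * F (emb (x + c))"
    unfolding lattice_combination[OF w k(5)]
  proof (rule convex_on4[OF F])
    show "real_of_int (n - k1 - k2 - k3) / real_of_int n + real_of_int k1 / real_of_int n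
        + real_of_int k2 / real_of_int n + real_of_int k3 / real_of_int n = 1"
      using k(5) by (simp add: field_simps)
  qed (use k in auto)
  also have "\<dots> = (of_int (n - k1 - k2 - k3) * F (emb x) + of_int k1 * F (emb (x + a))
      + of_int k2 * F (emb (x + b)) + of_int k3 * F (emb (x + c))) / of_int n"
    by (simp only: add_divide_distrib times_divide_eq_left)
  finally show ?thesis using k(5) by (simp add: pos_le_divide_eq mult.commute)
qed

lemma finite_lattice_pts:
  assumes "compact \<Omega>"
  shows "finite (lattice_pts \<Omega>)"
proof -
  obtain B where B: "\<And>p. p \<in> \<Omega> \<Longrightarrow> norm p \<le> B"
    using compact_imp_bounded[OF assms] unfolding bounded_iff by blast
  have "lattice_pts \<Omega> \<subseteq> {-\<lceil>B\<rceil>..\<lceil>B\<rceil>} \<times> {-\<lceil>B\<rceil>..\<lceil>B\<rceil>}"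
  proof
    fix x assume "x \<in> lattice_pts \<Omega>"
    then have "norm (emb x) \<le> B" using B by (simp add: lattice_pts_def)
    then have le: "\<bar>real_of_int (fst x)\<bar> \<le> B" "\<bar>real_of_int (snd x)\<bar> \<le> B"
      using norm_fst_le[of "fst (emb x)" "snd (emb x)"] norm_snd_le[of "snd (emb x)" "fst (emb x)"]
      by (simp_all add: emb_def)
    have "\<bar>fst x\<bar> \<le> \<lceil>B\<rceil>" "\<bar>snd x\<bar> \<le> \<lceil>B\<rceil>"
      using order_trans[OF le(1) le_of_int_ceiling] order_trans[OF le(2) le_of_int_ceiling]
      by (simp_all only: of_int_abs[symmetric] of_int_le_iff)
    then show "x \<in> {-\<lceil>B\<rceil>..\<lceil>B\<rceil>} \<times> {-\<lceil>B\<rceil>..\<lceil>B\<rceil>}" by (cases x) auto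
  qed
  then show ?thesis by (rule finite_subset) simp
qed

text \<open>The point is a vertex of some triangle T'. Extremality passes from T' to the common
  face, and from there to T.\<close>

lemma triangulation_vertex:
  assumes tri: "triangulation_of X \<T>" and T: "T \<in> \<T>" and x: "x \<in> X" "emb x \<in> T"
  shows "emb x extreme_point_of T"
proof -
  have "emb x \<in> {v. \<exists>T\<in>\<T>. v extreme_point_of T}"
    using tri x(1) unfolding triangulation_of_def by simp
  then obtain T' where T': "T' \<in> \<T>" "emb x extreme_point_of T'" by blast
  have tr: "triangulation \<T>" using tri unfolding triangulation_of_def by blast
  have f1: "T' \<inter> T face_of T'" and f2: "T \<inter> T' face_of T"
    using tr T T'(1) unfolding triangulation_def by blast+
  have "emb x \<in> T'" using T'(2) by (simp add: extreme_point_of_def)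
  then have "emb x extreme_point_of (T \<inter> T')"
    using extreme_point_of_face[OF f1, of "emb x"] T'(2) x(2) by (simp add: Int_commute)
  then show ?thesis using extreme_point_of_face[OF f2, of "emb x"] by blast
qed

lemma triangle_edge:
  assumes "\<not> affine_dependent {p, q, r}" "p \<noteq> q"
  shows "closed_segment p q edge_of convex hull {p, q, r}"
  unfolding edge_of_def
proof
  show "closed_segment p q face_of convex hull {p, q, r}"
    unfolding face_of_convex_hull_affine_independent[OF assms(1)] segment_convex_hull
    by (intro exI[of _ "{p, q}"]) auto
  show "aff_dim (closed_segment p q) = 1"
    using assms(2) by (simp add: segment_convex_hull aff_dim_convex_hull aff_dim_2)
qed

text \<open>Small multiples of a vector pointing from x into the hull lie in one and the same triangle,
  infinitely often, and this triangle contains x by closedness.\<close>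

lemma triangle_in_direction:
  assumes tri: "triangulation_of X \<T>" and x: "x \<in> X" and e: "x + e \<in> X"
  obtains T n where "T \<in> \<T>" "emb x \<in> T" "n > 0" "emb x + (1 / real n) *\<^sub>R emb e \<in> T"
proof -
  define p where "p n = emb x + (1 / real (Suc n)) *\<^sub>R emb e" for n
  have cover: "\<Union>\<T> = hull_of X" and tr: "triangulation \<T>"
    using tri unfolding triangulation_of_def by blast+
  have fin: "finite \<T>" using tr unfolding triangulation_def by blast
  have inhull: "p n \<in> hull_of X" for n
  proof -
    have "p n = (1 - 1 / real (Suc n)) *\<^sub>R emb x + (1 / real (Suc n)) *\<^sub>R emb (x + e)"
      by (simp add: p_def scaleR_left_diff_distrib scaleR_add_right del: of_nat_Suc)
    moreover have "emb w \<in> hull_of X" if "w \<in> X" for w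
      unfolding hull_of_def by (rule hull_inc[OF imageI[OF that]])
    moreover have "convex (hull_of X)" by (simp add: hull_of_def)
    ultimately show ?thesis
      using convexD_alt[of "hull_of X" "emb x" "emb (x + e)" "1 / real (Suc n)"] x e
      by (simp del: of_nat_Suc emb_simps)
  qed
  then have "\<forall>n. \<exists>T. T \<in> \<T> \<and> p n \<in> T" using cover by blast
  then obtain f where f: "\<And>n. f n \<in> \<T>" "\<And>n. p n \<in> f n" by metis
  have "finite (range f)" using f(1) fin by (meson finite_subset image_subset_iff)
  then obtain m where "infinite {n. f n = f m}"
    using pigeonhole_infinite[of UNIV f] by auto
  then obtain s :: "nat \<Rightarrow> nat" where s: "strict_mono s" "\<And>n. f (s n) = f m"
    using infinite_enumerate[of "{n. f n = f m}"] by auto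
  have "(\<lambda>n. emb x + inverse (real (Suc n)) *\<^sub>R emb e) \<longlonglongrightarrow> emb x + 0 *\<^sub>R emb e"
    by (intro tendsto_intros LIMSEQ_inverse_real_of_nat)
  then have "p \<longlonglongrightarrow> emb x" by (simp add: p_def[abs_def] inverse_eq_divide)
  then have lim: "(p \<circ> s) \<longlonglongrightarrow> emb x" by (rule LIMSEQ_subseq_LIMSEQ[OF _ s(1)])
  have cl: "closed (f m)"
  proof -
    have "2 simplex f m" using tri f(1) unfolding triangulation_of_def by blast
    then show ?thesis
      by (auto simp: simplex intro!: compact_imp_closed finite_imp_compact_convex_hull)
  qed
  have mem: "(p \<circ> s) n \<in> f m" for n using f(2)[of "s n"] s(2) by simp
  have "emb x \<in> f m" by (rule closed_sequentially[OF cl mem lim])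
  then show ?thesis using that[of "f m" "Suc m"] f[of m] by (simp add: p_def)
qed

context lattice_stencils
begin

text \<open>A triangle into which e points from x has x as a vertex and contains no lattice points
  but its vertices, so it is unimodular. Since e is primitive, it can be on the boundary of the cone
  only as a or b.\<close>

lemma triangulation_direction:
  assumes tri: "triangulation_of X \<T>" and x: "x \<in> X" and e: "e \<in> Vmax X x"
  obtains (edge) T where "T \<in> \<T>" "closed_segment (emb x) (emb (x + e)) edge_of T"
  | (triangle) a b where "convex hull {emb x, emb (x + a), emb (x + b)} \<in> \<T>"
      "x + a \<in> X" "x + b \<in> X"
      "closed_segment (emb x) (emb (x + a)) edge_of convex hull {emb x, emb (x + a), emb (x + b)}"
      "closed_segment (emb x) (emb (x + b)) edge_of convex hull {emb x, emb (x + a), emb (x + b)}"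
      "det2 a b = 1" "det2 a e \<ge> 1" "det2 e b \<ge> 1"
proof -
  have e': "irred e" "x + e \<in> X" using e by (auto simp: Vmax_def)
  obtain T n where T: "T \<in> \<T>" "emb x \<in> T" and n: "n > 0" "emb x + (1 / real n) *\<^sub>R emb e \<in> T"
    by (rule triangle_in_direction[OF tri x e'(2)])
  have "2 simplex T" using tri T(1) unfolding triangulation_of_def by blast
  then obtain C where C: "\<not> affine_dependent C" "card C = 3" "T = convex hull C"
    unfolding simplex_def by auto
  have ext: "v extreme_point_of T \<longleftrightarrow> v \<in> C" for v
    unfolding C(3) by (rule extreme_point_of_convex_hull_affine_independent[OF C(1)])
  have "{v. \<exists>T\<in>\<T>. v extreme_point_of T} = emb ` X" using tri unfolding triangulation_of_def by blast
  then have CX: "C \<subseteq> emb ` X" using T(1) ext by blast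
  have xC: "emb x \<in> C" using triangulation_vertex[OF tri T(1) x T(2)] ext by blast
  have "finite C" using C(2) by (intro card_ge_0_finite) simp
  then have "card (C - {emb x}) = 2" using xC C(2) by (simp add: card_Diff_singleton)
  then obtain q r where qr: "C - {emb x} = {q, r}" unfolding card_2_iff by blast
  then have "q \<in> C" "r \<in> C" by blast+
  then obtain y' z' where yz': "q = emb y'" "r = emb z'" using CX by blast
  have C': "C = {emb x, emb y', emb z'}" using qr xC unfolding yz' by blast
  have "cross (emb y' - emb x) (emb z' - emb x) \<noteq> 0"
    using C(1,2) affine_independent_cross[of "emb x" "emb y'" "emb z'"] unfolding C' by blast
  then have "det2 (y' - x) (z' - x) > 0 \<or> det2 (z' - x) (y' - x) > 0"
    using det2_swap[of "y' - x" "z' - x"] unfolding cross_emb_diff by linarith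
  then have "\<exists>y z. C = {emb x, emb y, emb z} \<and> det2 (y - x) (z - x) > 0"
    using C' by (metis insert_commute)
  then obtain y z where Cyz: "C = {emb x, emb y, emb z}" and D: "det2 (y - x) (z - x) > 0" by blast
  define a b where "a = y - x" and "b = z - x"
  have yz: "y = x + a" "z = x + b" by (auto simp: a_def b_def)
  have Cab: "C = {emb x, emb (x + a), emb (x + b)}" using Cyz unfolding yz .
  have TX: "T \<subseteq> hull_of X" using tri T(1) unfolding triangulation_of_def by blast
  have empty: "w = x \<or> w = y \<or> w = z" if "emb w \<in> convex hull {emb x, emb y, emb z}" for w
  proof -
    have wT: "emb w \<in> T" using that by (simp add: C(3) Cyz)
    then have "w \<in> X" using TX hull_X by blast
    then have "emb w \<in> C" using triangulation_vertex[OF tri T(1) _ wT] ext by blast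
    then show ?thesis by (simp add: Cyz)
  qed
  have ab: "det2 a b = 1" unfolding a_def b_def by (rule empty_triangle_unimodular[OF D empty])
  obtain r s t where rst: "0 \<le> r" "0 \<le> s" "0 \<le> t" "r + s + t = 1"
    and pt: "emb x + (1 / real n) *\<^sub>R emb e = r *\<^sub>R emb x + s *\<^sub>R emb (x + a) + t *\<^sub>R emb (x + b)"
    using n(2) unfolding C(3) Cab by (rule triangleE)
  have "r *\<^sub>R emb x + s *\<^sub>R emb (x + a) + t *\<^sub>R emb (x + b) = (r + s + t) *\<^sub>R emb x + (s *\<^sub>R emb a + t *\<^sub>R emb b)"
    by (simp add: algebra_simps)
  then have pt': "(1 / real n) *\<^sub>R emb e = s *\<^sub>R emb a + t *\<^sub>R emb b" using pt rst(4) by simp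
  have lin: "cross (k *\<^sub>R u) v = k * cross u v" "cross v (k *\<^sub>R u) = k * cross v u"
    "cross (u + u') v = cross u v + cross u' v" "cross v (u + u') = cross v u + cross v u'"
    "cross v v = 0" for k u u' v
    by (auto simp: cross_def algebra_simps)
  have nonneg: "0 \<le> d" if d: "(1 / real n) * of_int d = w" "0 \<le> w" for d :: int and w
  proof (rule ccontr)
    assume "\<not> 0 \<le> d"
    then have "(1 / real n) * of_int d < 0" using n(1) by (intro mult_pos_neg) simp_all
    then show False using d by linarith
  qed
  have ae: "det2 a e \<ge> 0"
    by (rule nonneg[OF _ rst(3)]) (use arg_cong[OF pt', of "cross (emb a)"] ab in \<open>simp add: lin cross_emb\<close>)
  have eb: "det2 e b \<ge> 0"
    by (rule nonneg[OF _ rst(2)])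
      (use arg_cong[OF pt', of "\<lambda>p. cross p (emb b)"] ab in \<open>simp add: lin cross_emb\<close>)
  from ae eb consider "det2 a e = 0" | "det2 e b = 0" | "det2 a e \<ge> 1" "det2 e b \<ge> 1" by linarith
  note directions = this
  have abX: "x + a \<in> X" "x + b \<in> X" using CX unfolding Cab by (auto simp del: emb_simps)
  have nz: "a \<noteq> 0" "b \<noteq> 0" using irred_det2_1[OF ab] irred_nz by auto
  have indep: "\<not> affine_dependent {emb x, emb (x + a), emb (x + b)}" using C(1) unfolding Cab .
  have neq: "emb x \<noteq> emb (x + a)" "emb x \<noteq> emb (x + b)"
    unfolding emb_eq_iff using nz by simp_all
  have edge_a: "closed_segment (emb x) (emb (x + a)) edge_of T"
    unfolding C(3) Cab by (rule triangle_edge[OF indep neq(1)])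
  have swap: "{emb x, emb (x + a), emb (x + b)} = {emb x, emb (x + b), emb (x + a)}" by (rule arg_cong[OF insert_commute])
  have edge_b: "closed_segment (emb x) (emb (x + b)) edge_of T"
    unfolding C(3) Cab swap by (rule triangle_edge[OF indep[unfolded swap] neq(2)])
  from directions show ?thesis
  proof cases
    case 1
    then have "e = a \<or> e = - a" using irred_parallel_irred[OF _ e'(1)] irred_det2_1[OF ab] by blast
    then have "e = a" using eb ab by auto
    then show ?thesis using edge[OF T(1)] edge_a by simp
  next
    case 2
    then have "b = e \<or> b = - e" using irred_parallel_irred[OF e'(1)] irred_det2_1[OF ab] by blast
    then have "b = e" using ae ab by auto
    then show ?thesis using edge[OF T(1)] edge_b by simp
  next
    case 3
    show ?thesis
      by (rule triangle[OF T(1)[unfolded C(3) Cab] abX edge_a[unfolded C(3) Cab] edge_b[unfolded C(3) Cab] ab 3])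
  qed
qed

text \<open>Both parents are in the stencil and in the closed cone of the enclosing basis, whose
  interior contains no stencil direction; so they are that basis.\<close>

lemma candidate_cone_empty:
  assumes x: "x \<in> X" and e: "e \<in> Vmax X x" "e \<notin> V x" and fg: "parents e f g" "f \<in> V x" "g \<in> V x"
  shows "V x \<inter> open_cone f g = {}"
proof -
  obtain a b where ab: "a \<in> V x" "b \<in> V x" "det2 a b = 1" "dot2 a b \<ge> 0" "e \<in> open_cone a b"
    "V x \<inter> open_cone a b = {}"
    using enclosing_basis[OF x e] by blast
  have fg': "det2 f g = 1" "dot2 f g \<ge> 0" "e = f + g" using fg by (auto simp: parents_iff)
  note cone = parents_in_cone[OF ab(3-5) fg']
  have "det2 a e \<ge> 1" "det2 e b \<ge> 1" using ab(5) by (auto simp: open_cone_def)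
  then have pos: "det2 f b \<ge> 1 \<and> det2 a g \<ge> 1"
    using unimodular_nonneg[OF basis_change_det[OF ab(3) fg'(1)]] cone by (simp add: fg'(3))
  have irr: "irred a" "irred b" "irred f" "irred g"
    using irred_det2_1[OF ab(3)] irred_det2_1[OF fg'(1)] by auto
  have "f \<notin> open_cone a b" "g \<notin> open_cone a b" using ab(6) fg by auto
  then have "det2 a f = 0" "det2 g b = 0" using pos cone ab(3) by (auto simp: open_cone_def)
  then have "f = a \<or> f = - a" "b = g \<or> b = - g" using irred_parallel_irred irr by blast+
  moreover have "f \<noteq> - a" "b \<noteq> - g" using pos ab(3) fg'(1) by auto
  ultimately show ?thesis using ab(6) by simp
qed

text \<open>For P, the edges a, b of the triangle are stencil directions, so they do not enter the
  cone (f, g), and f, g lie between them. J1 + J2 bounds the values at f and g by N - 2 times the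
  value at e plus p + r and q + s times those at a and b; J3 trades the last two for N - 1 times the
  value at x and one more at e.\<close>

lemma Conv_triangulation_subset:
  assumes tri: "triangulation_of X \<T>" and sub: "subordinate X \<T> V" and u: "u \<in> Conv_triangulation X \<T>"
  shows "u \<in> Conv_stencils X V"
proof -
  obtain F where F: "pl_interpolation X \<T> u F" "convex_on (hull_of X) F" and uE: "u \<in> X \<rightarrow>\<^sub>E UNIV"
    using u unfolding Conv_triangulation_def by blast
  have Fu: "F (emb w) = u w" if "w \<in> X" for w using F(1) that unfolding pl_interpolation_def by blast
  have inhull: "emb w \<in> hull_of X" if "w \<in> X" for w
    unfolding hull_of_def by (rule hull_inc[OF imageI[OF that]])
  have jensen: "of_int n * u (x + w) \<le> of_int (n - k1 - k2 - k3) * u x + of_int k1 * u (x + a)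
      + of_int k2 * u (x + b) + of_int k3 * u (x + c)"
    if "x \<in> X" "x + a \<in> X" "x + b \<in> X" "x + c \<in> X" "x + w \<in> X"
      "k1 \<ge> 0" "k2 \<ge> 0" "k3 \<ge> 0" "k1 + k2 + k3 \<le> n" "n > 0"
      "sm n w = sm k1 a + sm k2 b + sm k3 c" for x a b c w k1 k2 k3 n
    using lattice_jensen[OF F(2) inhull[OF that(1)] inhull[OF that(2)] inhull[OF that(3)] inhull[OF that(4)] that(6-11)]
    unfolding Fu[OF that(1)] Fu[OF that(2)] Fu[OF that(3)] Fu[OF that(4)] Fu[OF that(5)] .
  have "S_form u x e \<ge> 0" if "{x + e, x, x - e} \<subseteq> X" for x e
  proof -
    have "sm 2 e = sm 1 (e + e) + sm 0 e + sm 0 e" by (simp add: sm_def prod_eq_iff)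
    then have "of_int 2 * u (x - e + e) \<le> of_int (2 - 1 - 0 - 0) * u (x - e) + of_int 1 * u (x - e + (e + e))
        + of_int 0 * u (x - e + e) + of_int 0 * u (x - e + e)"
      by (intro jensen) (use that in \<open>auto simp: algebra_simps\<close>)
    moreover have "x - e + (e + e) = x + e" by simp
    ultimately show ?thesis by (simp add: S_form_def)
  qed
  moreover have "T_form u x e f g \<ge> 0" if "parents e f g" "{x + e, x - f, x - g, x} \<subseteq> X" for x e f g
  proof -
    have e: "e = f + g" using that(1) by (simp add: parents_iff)
    have pts: "x + e + (- e - f) = x - f" "x + e + (- e - g) = x - g" "x + e + - e = x" by simp_all
    have "sm 3 (- e) = sm 1 (- e - f) + sm 1 (- e - g) + sm 0 (- e)"
      by (simp add: e sm_def prod_eq_iff)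
    then have "of_int 3 * u (x + e + - e) \<le> of_int (3 - 1 - 1 - 0) * u (x + e) + of_int 1 * u (x + e + (- e - f))
        + of_int 1 * u (x + e + (- e - g)) + of_int 0 * u (x + e + - e)"
      by (intro jensen) (use that(2) pts in simp_all)
    then show ?thesis unfolding pts by (simp add: T_form_def)
  qed
  moreover have "P_form u x e f g \<ge> 0" if x: "x \<in> X" and e: "e \<in> candidates X V x" and fg: "parents e f g" for x e f g
  proof -
    have eV: "e \<in> Vmax X x" "e \<notin> V x" using e by (auto simp: candidates_def)
    have fg': "det2 f g = 1" "dot2 f g \<ge> 0" "e = f + g" using fg by (auto simp: parents_iff)
    have fgX: "x + e \<in> X" "x + f \<in> X" "x + g \<in> X" using candidate_parallelogram(1)[OF x e fg] by auto
    obtain f' g' where f'g': "parents e f' g'" "f' \<in> V x" "g' \<in> V x"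
      using e unfolding candidates_def by blast
    have "f' = f \<and> g' = g" by (rule parents_unique[OF f'g'(1) fg])
    then have fgV: "f \<in> V x" "g \<in> V x" using f'g' by auto
    have emp: "V x \<inter> open_cone f g = {}" by (rule candidate_cone_empty[OF x eV fg fgV])
    have noedge: "\<not> (\<exists>T\<in>\<T>. closed_segment (emb x) (emb (x + e)) edge_of T)"
      using sub x eV(2) unfolding subordinate_def by blast
    obtain a b where T: "convex hull {emb x, emb (x + a), emb (x + b)} \<in> \<T>"
      and abX: "x + a \<in> X" "x + b \<in> X"
      and edges: "closed_segment (emb x) (emb (x + a)) edge_of convex hull {emb x, emb (x + a), emb (x + b)}"
        "closed_segment (emb x) (emb (x + b)) edge_of convex hull {emb x, emb (x + a), emb (x + b)}"
      and ab: "det2 a b = 1" "det2 a e \<ge> 1" "det2 e b \<ge> 1"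
    proof (rule triangulation_direction[OF tri x eV(1)])
      fix T assume "T \<in> \<T>" "closed_segment (emb x) (emb (x + e)) edge_of T"
      then show thesis using noedge by blast
    qed (rule that)
    let ?T = "convex hull {emb x, emb (x + a), emb (x + b)}"
    have abV: "a \<in> V x" "b \<in> V x" using sub x T edges unfolding subordinate_def by blast+
    have "det2 a f \<ge> 0"
    proof (rule ccontr)
      assume "\<not> ?thesis"
      then have "a \<in> open_cone f g" using ab(2) fg' det2_swap[of f a] by (simp add: open_cone_def)
      then show False using emp abV by blast
    qed
    moreover have "det2 g b \<ge> 0"
    proof (rule ccontr)
      assume "\<not> ?thesis"
      then have "b \<in> open_cone f g" using ab(3) fg' det2_swap[of g b] by (simp add: open_cone_def)
      then show False using emp abV by blast
    qed
    moreover define p q r s where "p = det2 f b" and "q = det2 a f" and "r = det2 g b" and "s = det2 a g"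
    moreover have pq: "p + r = det2 e b" "q + s = det2 a e" by (simp_all add: p_def q_def r_def s_def fg'(3))
    moreover have det: "p * s - q * r = 1"
      unfolding p_def q_def r_def s_def by (rule basis_change_det[OF ab(1) fg'(1)])
    ultimately have nn: "q \<ge> 0" "r \<ge> 0" "p \<ge> 1" "s \<ge> 1"
      using unimodular_nonneg[of p s q r] ab by auto
    have f: "f = sm p a + sm q b" and g: "g = sm r a + sm s b"
      unfolding p_def q_def r_def s_def by (rule basis_coords[OF ab(1)])+
    note hc = hull_coords[OF det f g]
    define N where "N = p + q + r + s"
    have J1: "of_int (N - 1) * u (x + f) \<le> of_int (N - 1 - (p + q - 1) - (1 + r) - (s - 1)) * u x
        + of_int (p + q - 1) * u (x + e) + of_int (1 + r) * u (x + a) + of_int (s - 1) * u (x + b)"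
      unfolding N_def by (rule jensen) (use x fgX abX nn hc(1) fg'(3) in auto)
    have J2: "of_int (N - 1) * u (x + g) \<le> of_int (N - 1 - (r + s - 1) - (p - 1) - (1 + q)) * u x
        + of_int (r + s - 1) * u (x + e) + of_int (p - 1) * u (x + a) + of_int (1 + q) * u (x + b)"
      unfolding N_def by (rule jensen) (use x fgX abX nn hc(2) fg'(3) in auto)
    obtain A k where Ak: "\<forall>y\<in>?T. F y = A \<bullet> y + k" using F(1) T unfolding pl_interpolation_def by blast
    have uA: "u x = A \<bullet> emb x + k" "u (x + a) = A \<bullet> emb (x + a) + k" "u (x + b) = A \<bullet> emb (x + b) + k"
      using Ak Fu[OF x] Fu[OF abX(1)] Fu[OF abX(2)] by (metis hull_inc insertI1 insertI2)+
    have Npos: "real_of_int N > 0" using nn by (simp add: N_def)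
    \<comment> \<open>m is where the segment from x to x + e crosses the edge opposite to x, since p
      + r and q + s are the coordinates of e and add up to N. As F is affine on the triangle, its
      value at m is exact.\<close>
    define m where "m = (of_int (p + r) / of_int N) *\<^sub>R emb (x + a) + (of_int (q + s) / of_int N) *\<^sub>R emb (x + b)"
    have sum1: "of_int (p + r) / of_int N + of_int (q + s) / of_int N = (1 :: real)"
      using Npos by (simp add: N_def add_divide_distrib[symmetric])
    have mT: "m \<in> ?T"
      by (rule triangleI[of m 0 _ "of_int (p + r) / of_int N" _ "of_int (q + s) / of_int N"])
        (use sum1 nn Npos in \<open>auto simp: m_def simp del: emb_simps\<close>)
    have "F m = A \<bullet> m + k" using Ak mT by blast
    also have "\<dots> = of_int (p + r) / of_int N * u (x + a) + of_int (q + s) / of_int N * u (x + b)"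
    proof -
      have "k = (of_int (p + r) / of_int N + of_int (q + s) / of_int N) * k" using sum1 by simp
      then show ?thesis unfolding uA m_def inner_add_right[of A "_ *\<^sub>R _"] inner_scaleR_right by (simp add: algebra_simps)
    qed
    finally have Fm: "F m = of_int (p + r) / of_int N * u (x + a) + of_int (q + s) / of_int N * u (x + b)" .
    have e_eq: "e = sm (p + r) a + sm (q + s) b" unfolding fg'(3) f g by (simp add: sm_algebra)
    have emb_e: "emb e = of_int (p + r) *\<^sub>R emb a + of_int (q + s) *\<^sub>R emb b"
      unfolding e_eq by (simp only: emb_simps)
    have "m = (of_int (p + r) / of_int N + of_int (q + s) / of_int N) *\<^sub>R emb x + (1 / of_int N) *\<^sub>R emb e"
      unfolding m_def emb_e emb_simps(1)
      by (simp only: scaleR_add_left scaleR_add_right scaleR_scaleR times_divide_eq_left mult_1_left add_ac)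
    then have m_eq: "m = (1 - 1 / of_int N) *\<^sub>R emb x + (1 / of_int N) *\<^sub>R emb (x + e)"
      unfolding sum1 by (simp add: scaleR_left_diff_distrib scaleR_add_right)
    have "1 / real_of_int N \<le> 1" using nn by (simp add: N_def)
    then have "F m \<le> (1 - 1 / of_int N) * F (emb x) + 1 / of_int N * F (emb (x + e))"
      unfolding m_eq using Npos
      by (intro convex_onD[OF F(2)] inhull x fgX(1)) simp_all
    from mult_left_mono[OF this less_imp_le[OF Npos]]
    have "of_int N * F m \<le> of_int N * ((1 - 1 / of_int N) * u x + 1 / of_int N * u (x + e))"
      unfolding Fu[OF x] Fu[OF fgX(1)] .
    also have "\<dots> = (of_int N - 1) * u x + u (x + e)" using Npos by (simp add: field_simps)
    finally have J3: "of_int (p + r) * u (x + a) + of_int (q + s) * u (x + b) \<le> (of_int N - 1) * u x + u (x + e)"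
      unfolding Fm using Npos by (simp add: distrib_left)
    have "of_int (N - 1) * u (x + f) + of_int (N - 1) * u (x + g) \<le> of_int (N - 1) * (u (x + e) + u x)"
      using J1 J2 J3 by (simp add: N_def algebra_simps)
    then have "of_int (N - 1) * (u (x + f) + u (x + g)) \<le> of_int (N - 1) * (u (x + e) + u x)"
      by (simp only: distrib_left)
    moreover have "real_of_int (N - 1) > 0" using nn by (simp add: N_def)
    ultimately have "u (x + f) + u (x + g) \<le> u (x + e) + u x" by (rule mult_left_le_imp_le)
    then show ?thesis by (simp add: P_form_def)
  qed
  ultimately show ?thesis using uE unfolding Conv_stencils_def by blast
qed

end

theorem theorem1p13:
  fixes \<Omega> :: "(real \<times> real) set"
    and X :: "ivec set"
    and V :: "ivec \<Rightarrow> ivec set"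
  assumes "compact \<Omega>" and "convex \<Omega>"
    and "X = lattice_pts \<Omega>"
    and "interior (hull_of X) \<noteq> {}"
    and "stencils X V"
    and "powertop_real X interior_of Conv_stencils X V \<noteq> {}"
  shows "Conv_stencils X V =
    (\<Union>\<T>\<in>{\<T>. triangulation_of X \<T> \<and> subordinate X \<T> V}. Conv_triangulation X \<T>)"
proof -
  have "finite X" unfolding assms(3) by (rule finite_lattice_pts[OF assms(1)])
  moreover have "w \<in> X" if "emb w \<in> hull_of X" for w
  proof -
    have "hull_of X \<subseteq> \<Omega>"
      unfolding hull_of_def by (rule hull_minimal) (use assms(2,3) in \<open>auto simp: lattice_pts_def\<close>)
    then show ?thesis using that unfolding assms(3) lattice_pts_def by blast
  qed
  ultimately interpret lattice_stencils X V using assms(5) by unfold_locales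
  show ?thesis
    using Conv_stencils_subset[OF assms(4,6)] Conv_triangulation_subset by blast
qed

end
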